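(* For $t\in\mathbb{C}$ let $X_t=\{(x,y,z)\in\mathbb{C}^3 : x^5+z^{15}+y^7z+txy^6=0\}$. Then $X_t$ has a separating set at $0$ if $t\ne0$, and $X_0$ does not have a separating set at $0$.
   Context: $X_t$ is viewed as a real 4-dimensional semialgebraic subset of $\mathbb{C}^3=\mathbb{R}^6$. Densities: $\underline\Theta^j(W,x_0)=\liminf_{\epsilon\to0^+}\frac{\mathcal H^j(W\cap \epsilon B(x_0))}{\eta\epsilon^j}$, $\overline\Theta^j(W,x_0)=\limsup_{\epsilon\to0^+}\frac{\mathcal H^j(W\cap \epsilon B(x_0))}{\eta\epsilon^j}$ ($\mathcal H^j$ Hausdorff measure, $\epsilon B(x_0)$ closed Euclidean ball, $\eta$ volume of unit $j$-ball). Separating set: for a $k$-dimensional semialgebraic $X\subset\mathbb{R}^n$ and $x_0\in X$ with connected link and positive $k$-density at $x_0$, a $(k-1)$-dimensional rectifiable $Y\subset X$ with $x_0\in Y$ is a separating set at $x_0$ if for some small $\epsilon>0$, $(\epsilon B(x_0)\cap X)\setminus Y$ has at least two connected components $A,B$ with $\overline\Theta^{k-1}(Y,x_0)=0$ and $\underline\Theta^k(A,x_0)>0$, $\underline\Theta^k(B,x_0)>0$. *)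

theory Defs
  imports "HOL-Analysis.Analysis"
begin

section \<open>Hausdorff measure (normalised so that it agrees with Lebesgue measure)\<close>

definition hausdorff_pre :: "real \<Rightarrow> real \<Rightarrow> 'a::metric_space set \<Rightarrow> ennreal" where
  "hausdorff_pre s \<delta> A =
     (INF C \<in> {C :: nat \<Rightarrow> 'a set. A \<subseteq> (\<Union>i. C i) \<and> (\<forall>i. bounded (C i) \<and> diameter (C i) \<le> \<delta>)}.
        (\<Sum>i. ennreal (unit_ball_vol s * (diameter (C i) / 2) powr s)))"

definition hausdorff_measure :: "real \<Rightarrow> 'a::metric_space set \<Rightarrow> ennreal" where
  "hausdorff_measure s A = (SUP \<delta> \<in> {0<..}. hausdorff_pre s \<delta> A)"

definition hausdorff_dimension :: "'a::metric_space set \<Rightarrow> real" where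
  "hausdorff_dimension A = Inf {s. s \<ge> 0 \<and> hausdorff_measure s A = 0}"

definition lower_density :: "real \<Rightarrow> 'a::metric_space set \<Rightarrow> 'a \<Rightarrow> ennreal" where
  "lower_density j W x0 = Liminf (at_right 0)
     (\<lambda>\<epsilon>. hausdorff_measure j (W \<inter> cball x0 \<epsilon>) / ennreal (unit_ball_vol j * \<epsilon> powr j))"

definition upper_density :: "real \<Rightarrow> 'a::metric_space set \<Rightarrow> 'a \<Rightarrow> ennreal" where
  "upper_density j W x0 = Limsup (at_right 0)
     (\<lambda>\<epsilon>. hausdorff_measure j (W \<inter> cball x0 \<epsilon>) / ennreal (unit_ball_vol j * \<epsilon> powr j))"

definition rectifiable_set :: "'d::euclidean_space itself \<Rightarrow> 'a::metric_space set \<Rightarrow> bool" where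
  "rectifiable_set d Y \<longleftrightarrow>
     (\<exists>(A :: nat \<Rightarrow> 'd set) (f :: nat \<Rightarrow> 'd \<Rightarrow> 'a).
        (\<forall>i. \<exists>L. L-lipschitz_on (A i) (f i)) \<and>
        hausdorff_measure (real DIM('d)) (Y - (\<Union>i. f i ` A i)) = 0) \<and>
     hausdorff_dimension Y = real DIM('d)"

definition connected_link :: "'a::real_normed_vector set \<Rightarrow> 'a \<Rightarrow> bool" where
  "connected_link X x0 \<longleftrightarrow> (\<forall>\<^sub>F \<epsilon> in at_right 0. connected (X \<inter> sphere x0 \<epsilon>))"

text \<open>Separating set at x0 for a k-dimensional set X; the parameter d is a type R^(k-1)
  (DIM('d) = k - 1) used to express (k-1)-dimensional rectifiability. The standing
  assumptions of the definition (connected link, positive k-density) are included.\<close>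
definition separating_set ::
  "'d::euclidean_space itself \<Rightarrow> nat \<Rightarrow> 'a::euclidean_space set \<Rightarrow> 'a \<Rightarrow> 'a set \<Rightarrow> bool" where
  "separating_set d k X x0 Y \<longleftrightarrow>
     DIM('d) + 1 = k \<and> x0 \<in> X \<and>
     connected_link X x0 \<and> lower_density (real k) X x0 > 0 \<and>
     rectifiable_set d Y \<and> Y \<subseteq> X \<and> x0 \<in> Y \<and>
     (\<exists>\<epsilon>>0. \<exists>A B. A \<in> components ((cball x0 \<epsilon> \<inter> X) - Y) \<and>
                   B \<in> components ((cball x0 \<epsilon> \<inter> X) - Y) \<and> A \<noteq> B \<and>
                   upper_density (real k - 1) Y x0 = 0 \<and>
                   lower_density (real k) A x0 > 0 \<and> lower_density (real k) B x0 > 0)"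

definition has_separating_set ::
  "'d::euclidean_space itself \<Rightarrow> nat \<Rightarrow> 'a::euclidean_space set \<Rightarrow> 'a \<Rightarrow> bool" where
  "has_separating_set d k X x0 \<longleftrightarrow> (\<exists>Y. separating_set d k X x0 Y)"

definition Xt :: "complex \<Rightarrow> (complex^3) set" where
  "Xt t = {v. (v$1)^5 + (v$3)^15 + (v$2)^7 * v$3 + t * v$1 * (v$2)^6 = 0}"

end

theory Submission
  imports Defs "HOL-Computational_Algebra.Fundamental_Theorem_Algebra"
begin

text \<open>For \<open>t \<noteq> 0\<close>, put \<open>y = s\<^sup>2\<close>, \<open>z = s \<zeta>\<close>, \<open>x = s\<^sup>3 h\<close>; the equation becomes
  \<open>h\<^sup>5 + t h = - (\<zeta> + \<zeta>\<^sup>1\<^sup>5)\<close>. For small \<open>\<zeta>\<close> the root \<open>h\<close> near \<open>0\<close> stays away from the four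
  others, so the hypersurface \<open>|z|\<^sup>2 = \<rho>\<^sup>2 |y|\<close> inside the sheet of that root separates this sheet from
  the rest. In it \<open>z\<close> has size \<open>\<epsilon>\<close> while \<open>y\<close> has size \<open>\<epsilon>\<^sup>2\<close> only, so its measure in the
  \<open>\<epsilon>\<close>-ball is \<open>O(\<epsilon>\<^sup>4)\<close>, whereas both sides contain graphs over \<open>{|z| \<le> c \<epsilon>, |y| \<approx> c \<epsilon>}\<close>. The link is
  connected because the plane curve \<open>x\<^sup>5 + t x y\<^sup>6 + y\<^sup>7 + 1 = 0\<close> is: over each \<open>x\<close> with \<open>x\<^sup>5 = -1\<close>
  six of the seven points come together at \<open>y = 0\<close>.

  For \<open>t = 0\<close>, the part of \<open>X\<^sub>0\<close> over \<open>\<eta> \<epsilon> \<le> |y|, |z| \<le> \<epsilon>\<close> is, through logarithmic coordinates and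
  the single-valued fifth root of \<open>- z (y\<^sup>7 + z\<^sup>1\<^sup>4)\<close>, the image of one convex box under a map which
  is Lipschitz and locally expanding, uniformly after rescaling by \<open>\<epsilon>\<close>. A set of zero \<open>3\<close>-density
  pulls back to a set of small measure, which cannot separate two sets of positive volume in a
  convex body. The rest of \<open>X\<^sub>0\<close> in the \<open>\<epsilon>\<close>-ball has measure \<open>O(\<eta>\<^sup>2 \<epsilon>\<^sup>4)\<close> by projecting to the
  three coordinate planes.\<close>

section \<open>Hausdorff measure and densities\<close>

text \<open>The two cases part at the reduced equation: for \<open>t = 0\<close> it reads
  \<open>h^5 = - (\<zeta> + \<zeta>^15)\<close>, whose five roots merge at
  \<open>\<zeta> = 0\<close>, while for \<open>t \<noteq> 0\<close> the root \<open>h = 0\<close>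
  over \<open>\<zeta> = 0\<close> is simple. The obstacle for \<open>t = 0\<close> is that the
  pulled-back set comes with a bound on its measure but with no shape. Averaging over segments takes
  the place of an isoperimetric inequality: outside a set of starting points of small volume, any
  two points are joined by two segments through a common third point. The threshold on the measure
  depends on the box only, and the box depends on \<open>\<eta>\<close> but not on
  \<open>\<epsilon>\<close>. Hence the constants can be fixed in the order density bound,
  \<open>\<eta>\<close>, threshold, \<open>\<epsilon>\<close>. Densities are only ever compared with
  0, so Hausdorff and Lebesgue measure are compared up to the factors \<open>2^n\<close> and
  \<open>5^n\<close>. This dispenses with the isodiametric inequality and with Jacobians.\<close>

lemma hausdorff_pre_le:
  assumes "A \<subseteq> (\<Union>i. C i)" "\<And>i. bounded (C i)" "\<And>i. diameter (C i) \<le> \<delta>"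
  shows "hausdorff_pre s \<delta> A \<le> (\<Sum>i. ennreal (unit_ball_vol s * (diameter (C i) / 2) powr s))"
  unfolding hausdorff_pre_def by (rule INF_lower) (use assms in auto)

lemma hausdorff_pre_mono: "A \<subseteq> B \<Longrightarrow> hausdorff_pre s \<delta> A \<le> hausdorff_pre s \<delta> B"
  unfolding hausdorff_pre_def by (rule INF_superset_mono) auto

lemma hausdorff_pre_antimono: "\<delta> \<le> \<delta>' \<Longrightarrow> hausdorff_pre s \<delta>' A \<le> hausdorff_pre s \<delta> A"
  unfolding hausdorff_pre_def by (rule INF_superset_mono) (auto intro: order_trans)

lemma hausdorff_pre_le_measure: "0 < \<delta> \<Longrightarrow> hausdorff_pre s \<delta> A \<le> hausdorff_measure s A"
  unfolding hausdorff_measure_def by (rule SUP_upper) auto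

lemma hausdorff_measure_leI:
  "(\<And>\<delta>. 0 < \<delta> \<Longrightarrow> hausdorff_pre s \<delta> A \<le> c) \<Longrightarrow> hausdorff_measure s A \<le> c"
  unfolding hausdorff_measure_def by (rule SUP_least) auto

lemma hausdorff_measure_mono: "A \<subseteq> B \<Longrightarrow> hausdorff_measure s A \<le> hausdorff_measure s B"
  unfolding hausdorff_measure_def by (rule SUP_mono) (auto intro: hausdorff_pre_mono)

text \<open>Near-optimal covers of the pieces, with errors \<open>e / 2^(n+1)\<close>, are merged
  into one sequence by pairing. They exist because the epsilon principle allows the right-hand side
  to be taken finite.\<close>

lemma hausdorff_pre_UN:
  "hausdorff_pre s \<delta> (\<Union>n. A n) \<le> (\<Sum>n. hausdorff_pre s \<delta> (A n))"
proof (rule ennreal_le_epsilon)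
  fix e :: real
  assume e: "0 < e" and fin: "(\<Sum>n. hausdorff_pre s \<delta> (A n)) < top"
  let ?w = "\<lambda>B::'a set. ennreal (unit_ball_vol s * (diameter B / 2) powr s)"
  have nfin: "hausdorff_pre s \<delta> (A n) \<noteq> \<infinity>" for n
    using ennreal_suminf_lessD[OF fin] by (auto simp: less_top)
  have "\<exists>C. A n \<subseteq> (\<Union>i. C i) \<and> (\<forall>i. bounded (C i) \<and> diameter (C i) \<le> \<delta>) \<and>
      (\<Sum>i. ?w (C i)) < hausdorff_pre s \<delta> (A n) + ennreal (e * (1/2)^Suc n)" for n
  proof -
    have p: "0 < e * (1/2)^Suc n" using e by simp
    have "\<exists>C \<in> {C :: nat \<Rightarrow> 'a set. A n \<subseteq> (\<Union>i. C i) \<and> (\<forall>i. bounded (C i) \<and> diameter (C i) \<le> \<delta>)}.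
        (\<Sum>i. ?w (C i)) < hausdorff_pre s \<delta> (A n) + ennreal (e * (1/2)^Suc n)"
      by (rule INF_approx_ennreal[OF p _ nfin]) (simp add: hausdorff_pre_def)
    then show ?thesis by auto
  qed
  then obtain C where C: "\<And>n. A n \<subseteq> (\<Union>i. C n i)" "\<And>n i. bounded (C n i)"
    "\<And>n i. diameter (C n i) \<le> \<delta>"
    "\<And>n. (\<Sum>i. ?w (C n i)) < hausdorff_pre s \<delta> (A n) + ennreal (e * (1/2)^Suc n)"
    by metis
  define D where "D k = (case prod_decode k of (n, i) \<Rightarrow> C n i)" for k
  have "(\<Union>n. A n) \<subseteq> (\<Union>k. D k)"
  proof
    fix x assume "x \<in> (\<Union>n. A n)"
    then obtain n i where "x \<in> C n i" using C(1) by blast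
    then have "x \<in> D (prod_encode (n, i))" by (simp add: D_def)
    then show "x \<in> (\<Union>k. D k)" by blast
  qed
  then have "hausdorff_pre s \<delta> (\<Union>n. A n) \<le> (\<Sum>k. ?w (D k))"
    by (rule hausdorff_pre_le) (simp_all add: D_def C(2,3) split: prod.split)
  also have "(\<Sum>k. ?w (D k)) = (\<Sum>k. (\<lambda>(n,i). ?w (C n i)) (prod_decode k))"
    by (simp add: D_def case_prod_unfold)
  also have "\<dots> = (\<Sum>n. \<Sum>i. ?w (C n i))"
    by (rule suminf_ennreal_2dimen) simp
  also have "\<dots> \<le> (\<Sum>n. hausdorff_pre s \<delta> (A n) + ennreal (e * (1/2)^Suc n))"
    by (intro suminf_le less_imp_le C) auto
  also have "\<dots> = (\<Sum>n. hausdorff_pre s \<delta> (A n)) + (\<Sum>n. ennreal (e * (1/2)^Suc n))"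
    by (intro suminf_add[symmetric]) auto
  also have "(\<Sum>n. ennreal (e * (1/2)^Suc n)) = ennreal e"
    using e sums_mult[OF power_half_series, of e]
    by (intro suminf_ennreal_eq) auto
  finally show "hausdorff_pre s \<delta> (\<Union>n. A n) \<le> (\<Sum>n. hausdorff_pre s \<delta> (A n)) + ennreal e" .
qed

lemma hausdorff_measure_UN:
  "hausdorff_measure s (\<Union>n::nat. A n) \<le> (\<Sum>n. hausdorff_measure s (A n))"
proof (rule hausdorff_measure_leI)
  fix \<delta> :: real assume "0 < \<delta>"
  show "hausdorff_pre s \<delta> (\<Union>n. A n) \<le> (\<Sum>n. hausdorff_measure s (A n))"
    by (rule order_trans[OF hausdorff_pre_UN])
       (intro suminf_le hausdorff_pre_le_measure \<open>0 < \<delta>\<close>; simp)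
qed

lemma hausdorff_measure_empty [simp]: "hausdorff_measure s {} = 0"
proof -
  have "hausdorff_measure s {} \<le> 0"
    by (rule hausdorff_measure_leI, rule order_trans[OF hausdorff_pre_le[of _ "\<lambda>_. {}"]]) auto
  then show ?thesis by simp
qed

lemma hausdorff_measure_finite_UN:
  assumes "finite I"
  shows "hausdorff_measure s (\<Union>i\<in>I. A i) \<le> (\<Sum>i\<in>I. hausdorff_measure s (A i))"
proof -
  obtain f :: "nat \<Rightarrow> _" where f: "bij_betw f {..<card I} I"
    using ex_bij_betw_nat_finite[OF assms] by (auto simp: atLeast0LessThan)
  let ?B = "\<lambda>n. if n < card I then A (f n) else {}"
  have "(\<Union>i\<in>I. A i) = (\<Union>n. ?B n)"
    using f by (force simp: bij_betw_def split: if_splits)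
  then have "hausdorff_measure s (\<Union>i\<in>I. A i) \<le> (\<Sum>n. hausdorff_measure s (?B n))"
    by (simp only: hausdorff_measure_UN)
  also have "\<dots> = (\<Sum>n<card I. hausdorff_measure s (?B n))"
    by (rule suminf_finite) auto
  also have "\<dots> = (\<Sum>n<card I. hausdorff_measure s (A (f n)))" by simp
  also have "\<dots> = (\<Sum>i\<in>I. hausdorff_measure s (A i))"
    by (rule sum.reindex_bij_betw[OF f])
  finally show ?thesis .
qed

lemma hausdorff_measure_Un:
  "hausdorff_measure s (A \<union> B) \<le> hausdorff_measure s A + hausdorff_measure s B"
  using hausdorff_measure_finite_UN[of "UNIV::bool set" s "\<lambda>b. if b then A else B"]
  by (simp add: UNIV_bool Un_commute add.commute)

text \<open>Covering sets are cut down to \<open>S\<close> before they are mapped, since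
  \<open>f\<close> is controlled only there. The factor is moved to the left as
  \<open>L powr (-s)\<close>, so that the estimate can be checked against one cover at a
  time.\<close>

lemma hausdorff_measure_lipschitz_image:
  fixes f :: "'a::metric_space \<Rightarrow> 'b::metric_space"
  assumes lip: "L-lipschitz_on S f" and L: "0 < L" and s: "0 \<le> s"
  shows "hausdorff_measure s (f ` S) \<le> ennreal (L powr s) * hausdorff_measure s S"
proof (rule hausdorff_measure_leI)
  fix \<delta> :: real assume \<delta>: "0 < \<delta>"
  let ?w = "\<lambda>d. ennreal (unit_ball_vol s * (d / 2) powr s)"
  have inv: "ennreal (L powr s) * ennreal (L powr (-s)) = 1"
    using L by (simp add: ennreal_mult'[symmetric] powr_minus)
  have "ennreal (L powr (-s)) * hausdorff_pre s \<delta> (f ` S) \<le> hausdorff_pre s (\<delta> / L) S"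
    unfolding hausdorff_pre_def[of s "\<delta> / L"]
  proof (rule INF_greatest, clarify)
    fix C :: "nat \<Rightarrow> 'a set"
    assume C: "S \<subseteq> (\<Union>i. C i)" "\<forall>i. bounded (C i) \<and> diameter (C i) \<le> \<delta> / L"
    let ?D = "\<lambda>i. f ` (S \<inter> C i)"
    have dist: "dist x y \<le> L * diameter (C i)" if xy: "x \<in> ?D i" "y \<in> ?D i" for i x y
    proof -
      obtain a b where ab: "a \<in> S" "a \<in> C i" "b \<in> S" "b \<in> C i" "x = f a" "y = f b"
        using xy by blast
      then have "dist x y \<le> L * dist a b" using lipschitz_onD[OF lip] by auto
      also have "\<dots> \<le> L * diameter (C i)"
        using L C ab by (intro mult_left_mono diameter_bounded_bound) auto
      finally show ?thesis .
    qed
    have b: "bounded (?D i)" for i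
      unfolding bounded_two_points using dist[of _ i] by blast
    have d: "diameter (?D i) \<le> L * diameter (C i)" for i
    proof (cases "?D i = {}")
      case True
      have "diameter (?D i) = 0" unfolding True by simp
      then show ?thesis using L C(2) by (simp add: diameter_ge_0)
    next
      case False
      then have ne: "?D i \<times> ?D i \<noteq> {}" by (simp add: Times_empty)
      have "(SUP (x, y)\<in>?D i \<times> ?D i. dist x y) \<le> L * diameter (C i)"
      proof (rule cSUP_least[OF ne])
        fix p assume "p \<in> ?D i \<times> ?D i"
        then show "(case p of (x, y) \<Rightarrow> dist x y) \<le> L * diameter (C i)"
          using dist[of "fst p" i "snd p"] by (simp only: case_prod_unfold mem_Times_iff)
      qed
      then show ?thesis unfolding diameter_def[of "?D i"] by (simp only: False if_False)
    qed
    have "hausdorff_pre s \<delta> (f ` S) \<le> (\<Sum>i. ?w (diameter (?D i)))"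
    proof (rule hausdorff_pre_le)
      show "f ` S \<subseteq> (\<Union>i. ?D i)" using C(1) by blast
      show "diameter (?D i) \<le> \<delta>" for i
        using d[of i] C(2) L by (auto simp: field_simps intro: order_trans)
    qed (use b in auto)
    also have "\<dots> \<le> (\<Sum>i. ennreal (L powr s) * ?w (diameter (C i)))"
    proof (rule suminf_le)
      fix i
      have "(diameter (?D i) / 2) powr s \<le> (L * (diameter (C i) / 2)) powr s"
        using d[of i] s b[of i] by (intro powr_mono2) (auto simp: diameter_ge_0)
      also have "\<dots> = L powr s * (diameter (C i) / 2) powr s"
        using L C(2) by (intro powr_mult)
      finally have "unit_ball_vol s * (diameter (?D i) / 2) powr s
          \<le> L powr s * (unit_ball_vol s * (diameter (C i) / 2) powr s)"
        using unit_ball_vol_pos[OF s] by (simp add: mult_left_mono mult.left_commute)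
      then have "?w (diameter (?D i)) \<le> ennreal (L powr s * (unit_ball_vol s * (diameter (C i) / 2) powr s))"
        by (rule ennreal_leI)
      also have "\<dots> = ennreal (L powr s) * ?w (diameter (C i))"
        using unit_ball_vol_pos[OF s] by (intro ennreal_mult) auto
      finally show "?w (diameter (?D i)) \<le> ennreal (L powr s) * ?w (diameter (C i))" .
    qed auto
    also have "\<dots> = ennreal (L powr s) * (\<Sum>i. ?w (diameter (C i)))" by (rule ennreal_suminf_cmult)
    finally have "ennreal (L powr (-s)) * hausdorff_pre s \<delta> (f ` S)
       \<le> ennreal (L powr (-s)) * (ennreal (L powr s) * (\<Sum>i. ?w (diameter (C i))))"
      by (rule mult_left_mono) simp
    also have "\<dots> = (\<Sum>i. ?w (diameter (C i)))"
      using inv by (simp add: mult.assoc[symmetric] mult.commute)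
    finally show "ennreal (L powr (-s)) * hausdorff_pre s \<delta> (f ` S) \<le> (\<Sum>i. ?w (diameter (C i)))" .
  qed
  also have "\<dots> \<le> hausdorff_measure s S"
    using \<delta> L by (intro hausdorff_pre_le_measure) simp
  finally have "ennreal (L powr s) * (ennreal (L powr (-s)) * hausdorff_pre s \<delta> (f ` S))
     \<le> ennreal (L powr s) * hausdorff_measure s S"
    by (rule mult_left_mono) simp
  then show "hausdorff_pre s \<delta> (f ` S) \<le> ennreal (L powr s) * hausdorff_measure s S"
    using inv by (simp add: mult.assoc[symmetric])
qed

text \<open>A piece of diameter at most \<open>\<delta>\<close> has a \<open>b\<close>-weight of at
  most \<open>K * (\<delta> / 2) powr (b - a)\<close> times its \<open>a\<close>-weight.\<close>

lemma hausdorff_measure_eq_0_of_finite: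
  assumes "hausdorff_measure a S < \<infinity>" "0 \<le> a" "a < b"
  shows "hausdorff_measure b S = 0"
proof -
  obtain M where M: "hausdorff_measure a S = ennreal M" "0 \<le> M"
    using assms(1) by (cases "hausdorff_measure a S") auto
  define K where "K = unit_ball_vol b / unit_ball_vol a"
  have ua: "0 < unit_ball_vol a" and ub: "0 < unit_ball_vol b"
    using assms by (auto intro: unit_ball_vol_pos)
  have K: "0 < K" using ua ub by (simp add: K_def)
  have le: "hausdorff_pre b \<delta> S \<le> ennreal (K * (\<delta> / 2) powr (b - a) * M)" if \<delta>: "0 < \<delta>" for \<delta>
  proof -
    define k where "k = K * (\<delta> / 2) powr (b - a)"
    have k: "0 < k" using K \<delta> by (simp add: k_def)
    have "ennreal (1 / k) * hausdorff_pre b \<delta> S \<le> hausdorff_pre a \<delta> S"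
      unfolding hausdorff_pre_def[of a]
    proof (rule INF_greatest, clarify)
      fix C :: "nat \<Rightarrow> 'a set"
      assume C: "S \<subseteq> (\<Union>i. C i)" "\<forall>i. bounded (C i) \<and> diameter (C i) \<le> \<delta>"
      have "hausdorff_pre b \<delta> S \<le> (\<Sum>i. ennreal (unit_ball_vol b * (diameter (C i) / 2) powr b))"
        using C by (intro hausdorff_pre_le) auto
      also have "\<dots> \<le> (\<Sum>i. ennreal k * ennreal (unit_ball_vol a * (diameter (C i) / 2) powr a))"
      proof (rule suminf_le)
        fix i
        let ?d = "diameter (C i) / 2"
        have d: "0 \<le> ?d" "?d \<le> \<delta> / 2" using C(2) by (auto simp: diameter_ge_0)
        have "?d powr b = ?d powr (b - a) * ?d powr a" by (simp add: powr_add[symmetric])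
        also have "\<dots> \<le> (\<delta> / 2) powr (b - a) * ?d powr a"
          using d assms by (intro mult_right_mono powr_mono2) auto
        finally have "unit_ball_vol b * ?d powr b \<le> unit_ball_vol b * ((\<delta> / 2) powr (b - a) * ?d powr a)"
          using ub by (intro mult_left_mono) auto
        also have "\<dots> = k * (unit_ball_vol a * ?d powr a)"
          using ua by (simp add: k_def K_def)
        finally show "ennreal (unit_ball_vol b * ?d powr b) \<le> ennreal k * ennreal (unit_ball_vol a * ?d powr a)"
          using k ua by (subst ennreal_mult[symmetric]) (auto intro!: ennreal_leI)
      qed auto
      also have "\<dots> = ennreal k * (\<Sum>i. ennreal (unit_ball_vol a * (diameter (C i) / 2) powr a))"
        by (rule ennreal_suminf_cmult)
      finally have "ennreal (1/k) * hausdorff_pre b \<delta> S \<le> ennreal (1/k) * (ennreal k * (\<Sum>i. ennreal (unit_ball_vol a * (diameter (C i) / 2) powr a)))"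
        by (rule mult_left_mono) simp
      also have "\<dots> = (\<Sum>i. ennreal (unit_ball_vol a * (diameter (C i) / 2) powr a))"
        using k by (simp add: mult.assoc[symmetric] ennreal_mult'[symmetric])
      finally show "ennreal (1/k) * hausdorff_pre b \<delta> S \<le> (\<Sum>i. ennreal (unit_ball_vol a * (diameter (C i) / 2) powr a))" .
    qed
    also have "\<dots> \<le> ennreal M" using hausdorff_pre_le_measure[OF \<delta>, of a S] M by simp
    finally have "ennreal k * (ennreal (1/k) * hausdorff_pre b \<delta> S) \<le> ennreal k * ennreal M"
      by (rule mult_left_mono) simp
    then show ?thesis
      using k M unfolding k_def[symmetric] by (simp add: mult.assoc[symmetric] ennreal_mult'[symmetric])
  qed
  \<comment> \<open>The premeasure at a fixed \<open>\<delta>\<close> is bounded by the one at every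
    smaller \<open>d\<close>, whose bound tends to 0 because \<open>a < b\<close>.\<close>
  have "hausdorff_pre b \<delta> S \<le> 0" if \<delta>: "0 < \<delta>" for \<delta>
  proof (rule tendsto_lowerbound)
    have "((\<lambda>d. K * (d / 2) powr (b - a) * M) \<longlongrightarrow> K * (0 / 2) powr (b - a) * M) (at_right 0)"
      using assms by (intro tendsto_intros) (auto intro: eventually_at_right_less simp: eventually_at_filter)
    then have "((\<lambda>d. ennreal (K * (d / 2) powr (b - a) * M)) \<longlongrightarrow> ennreal (K * (0 / 2) powr (b - a) * M)) (at_right 0)"
      by (rule tendsto_ennrealI)
    then show "((\<lambda>d. ennreal (K * (d / 2) powr (b - a) * M)) \<longlongrightarrow> 0) (at_right 0)"
      by simp
    show "\<forall>\<^sub>F d in at_right 0. hausdorff_pre b \<delta> S \<le> ennreal (K * (d / 2) powr (b - a) * M)"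
      using eventually_at_right_real[OF \<delta>]
    proof eventually_elim
      case (elim d)
      then show ?case using le[of d] hausdorff_pre_antimono[of d \<delta> b S] by (auto intro: order_trans)
    qed
  qed auto
  then have "hausdorff_measure b S \<le> 0" by (rule hausdorff_measure_leI)
  then show ?thesis by simp
qed

section \<open>Comparison of Hausdorff and Lebesgue measure in full dimension\<close>

text \<open>A set of diameter \<open>d\<close> lies in a ball of radius \<open>d\<close> around any
  of its points; measuring against radius \<open>d / 2\<close> costs \<open>2^n\<close>. For a set
  that is not Borel, \<open>emeasure\<close> is 0 by convention.\<close>

lemma emeasure_lborel_le_hausdorff:
  fixes E :: "'a::euclidean_space set"
  shows "emeasure lborel E \<le> ennreal (2 ^ DIM('a)) * hausdorff_measure (real DIM('a)) E"
proof (cases "E \<in> sets lborel")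
  case True
  let ?n = "real DIM('a)"
  have inv: "ennreal (2 ^ DIM('a)) * ennreal (1 / 2 ^ DIM('a)) = 1"
    by (simp add: ennreal_mult'[symmetric])
  have "ennreal (1 / 2 ^ DIM('a)) * emeasure lborel E \<le> hausdorff_pre ?n 1 E"
    unfolding hausdorff_pre_def
  proof (rule INF_greatest, clarify)
    fix C :: "nat \<Rightarrow> 'a set"
    assume C: "E \<subseteq> (\<Union>i. C i)" "\<forall>i. bounded (C i) \<and> diameter (C i) \<le> 1"
    define c where "c i = (SOME x. x \<in> C i)" for i
    have sub: "C i \<subseteq> cball (c i) (diameter (C i))" for i
    proof
      fix x assume x: "x \<in> C i"
      then have "c i \<in> C i" unfolding c_def by (rule someI)
      then show "x \<in> cball (c i) (diameter (C i))"
        using x C by (simp add: diameter_bounded_bound)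
    qed
    have "emeasure lborel E \<le> emeasure lborel (\<Union>i. cball (c i) (diameter (C i)))"
      using C sub by (intro emeasure_mono) (blast, auto)
    also have "\<dots> \<le> (\<Sum>i. emeasure lborel (cball (c i) (diameter (C i))))"
      by (intro emeasure_subadditive_countably) auto
    also have "\<dots> = (\<Sum>i. ennreal (2 ^ DIM('a)) * ennreal (unit_ball_vol ?n * (diameter (C i) / 2) powr ?n))"
    proof (rule suminf_cong)
      fix i
      have d: "0 \<le> diameter (C i)" using C by (simp add: diameter_ge_0)
      have "(diameter (C i) / 2) powr ?n = (diameter (C i) / 2) ^ DIM('a)"
      proof (cases "diameter (C i) = 0")
        case True then show ?thesis by simp
      next
        case False then show ?thesis using d by (intro powr_realpow) auto
      qed
      then have "unit_ball_vol ?n * diameter (C i) ^ DIM('a) = 2 ^ DIM('a) * (unit_ball_vol ?n * (diameter (C i) / 2) powr ?n)"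
        by (simp add: power_divide)
      then show "emeasure lborel (cball (c i) (diameter (C i))) = ennreal (2 ^ DIM('a)) * ennreal (unit_ball_vol ?n * (diameter (C i) / 2) powr ?n)"
        using d by (simp add: emeasure_cball ennreal_mult'[symmetric])
    qed
    also have "\<dots> = ennreal (2 ^ DIM('a)) * (\<Sum>i. ennreal (unit_ball_vol ?n * (diameter (C i) / 2) powr ?n))"
      by (rule ennreal_suminf_cmult)
    finally have "ennreal (1 / 2 ^ DIM('a)) * emeasure lborel E
       \<le> ennreal (1 / 2 ^ DIM('a)) * (ennreal (2 ^ DIM('a)) * (\<Sum>i. ennreal (unit_ball_vol ?n * (diameter (C i) / 2) powr ?n)))"
      by (rule mult_left_mono) simp
    then show "ennreal (1 / 2 ^ DIM('a)) * emeasure lborel E \<le> (\<Sum>i. ennreal (unit_ball_vol ?n * (diameter (C i) / 2) powr ?n))"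
      using inv by (simp add: mult.assoc[symmetric] mult.commute)
  qed
  also have "\<dots> \<le> hausdorff_measure ?n E" by (rule hausdorff_pre_le_measure) simp
  finally have "ennreal (2 ^ DIM('a)) * (ennreal (1 / 2 ^ DIM('a)) * emeasure lborel E) \<le> ennreal (2 ^ DIM('a)) * hausdorff_measure ?n E"
    by (rule mult_left_mono) simp
  then show ?thesis using inv by (simp add: mult.assoc[symmetric])
qed (simp add: emeasure_notin_sets)

text \<open>By Vitali's covering lemma, disjoint balls inside an open set \<open>U\<close> barely
  larger than \<open>E\<close> cover \<open>E\<close> once they are enlarged five times, hence the
  factor \<open>5^n\<close>.\<close>

lemma hausdorff_measure_le_lborel:
  fixes E :: "'a::euclidean_space set"
  assumes E: "E \<in> sets lborel"
  shows "hausdorff_measure (real DIM('a)) E \<le> ennreal (5 ^ DIM('a)) * emeasure lborel E"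
proof (rule hausdorff_measure_leI)
  fix \<delta> :: real assume \<delta>: "0 < \<delta>"
  let ?n = "real DIM('a)"
  show "hausdorff_pre ?n \<delta> E \<le> ennreal (5 ^ DIM('a)) * emeasure lborel E"
  proof (rule ennreal_le_epsilon)
    fix e :: real assume e: "0 < e"
    define e' where "e' = e / 5 ^ DIM('a)"
    have e': "0 < e'" using e by (simp add: e'_def)
    obtain U where U: "open U" "E \<subseteq> U" "emeasure lborel (U - E) < ennreal e'"
      using outer_regular_lborel[of E e'] E e' by auto
    \<comment> \<open>With radius at most \<open>\<delta> / 10\<close> the enlarged balls still have
      diameter at most \<open>\<delta>\<close>.\<close>
    have "\<exists>r>0. r \<le> \<delta> / 10 \<and> cball x r \<subseteq> U" if x: "x \<in> E" for x
    proof -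
      have "x \<in> U" using x U(2) by blast
      then obtain r where "r > 0" "cball x r \<subseteq> U"
        using U(1) open_contains_cball_eq by metis
      then show ?thesis using \<delta> by (intro exI[of _ "min r (\<delta>/10)"]) auto
    qed
    then have "\<forall>x\<in>E. \<exists>r. 0 < r \<and> r \<le> \<delta> / 10 \<and> cball x r \<subseteq> U" by blast
    from bchoice[OF this]
    obtain r where r: "\<And>x. x \<in> E \<Longrightarrow> 0 < r x \<and> r x \<le> \<delta> / 10 \<and> cball x (r x) \<subseteq> U"
      by blast
    obtain C where C: "countable C" "C \<subseteq> E"
      "pairwise (\<lambda>i j. disjnt (cball i (r i)) (cball j (r j))) C"
      "E \<subseteq> (\<Union>i\<in>C. cball i (5 * r i))"
    proof (rule Vitali_covering_lemma_cballs[of E "\<lambda>x. x" r E "\<delta>/10"])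
      show "E \<subseteq> (\<Union>i\<in>E. cball i (r i))"
      proof
        fix x assume "x \<in> E"
        then show "x \<in> (\<Union>i\<in>E. cball i (r i))" using r[of x] by (intro UN_I[of x]) auto
      qed
    qed (use r in auto)
    let ?I = "to_nat_on C ` C"
    let ?g = "from_nat_into C"
    have g: "?g i \<in> C" "to_nat_on C (?g i) = i" if "i \<in> ?I" for i using that C(1) by auto
    \<comment> \<open>Covers are indexed by all naturals, whereas the Vitali family is merely
      countable. The remaining indices get the empty set, which has weight 0.\<close>
    define B where "B i = (if i \<in> ?I then cball (?g i) (r (?g i)) else {})" for i
    define D where "D i = (if i \<in> ?I then cball (?g i) (5 * r (?g i)) else {})" for i
    have disj: "disjoint_family B"
      unfolding disjoint_family_on_def
    proof safe
      fix i j x assume ij: "i \<noteq> j" "x \<in> B i" "x \<in> B j"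
      then have I: "i \<in> ?I" "j \<in> ?I" by (auto simp: B_def split: if_splits)
      then have "?g i \<noteq> ?g j" using ij(1) g by metis
      then have "disjnt (B i) (B j)"
        using I g C(3) by (auto simp: B_def pairwise_def)
      then show "x \<in> {}" using ij by (auto simp: disjnt_def)
    qed
    have D: "bounded (D i)" "diameter (D i) \<le> \<delta>"
        "ennreal (unit_ball_vol ?n * (diameter (D i) / 2) powr ?n) = ennreal (5 ^ DIM('a)) * emeasure lborel (B i)" for i
    proof -
      show "bounded (D i)" by (simp add: D_def)
      show "diameter (D i) \<le> \<delta>"
        using \<delta> r[of "?g i"] g(1)[of i] C(2) by (auto simp: D_def)
      show "ennreal (unit_ball_vol ?n * (diameter (D i) / 2) powr ?n) = ennreal (5 ^ DIM('a)) * emeasure lborel (B i)"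
      proof (cases "i \<in> ?I")
        case True
        then have rp: "0 < r (?g i)" using r g(1) C(2) by blast
        have "unit_ball_vol ?n * (diameter (D i) / 2) powr ?n = unit_ball_vol ?n * (5 * r (?g i)) ^ DIM('a)"
          using True rp by (simp add: D_def powr_realpow)
        also have "\<dots> = 5 ^ DIM('a) * (unit_ball_vol ?n * r (?g i) ^ DIM('a))"
          by (simp add: power_mult_distrib)
        finally show ?thesis
          using True rp by (simp only: B_def emeasure_cball[OF less_imp_le[OF rp]] if_True) (rule ennreal_mult', simp)
      qed (simp add: D_def B_def)
    qed
    have "hausdorff_pre ?n \<delta> E \<le> (\<Sum>i. ennreal (unit_ball_vol ?n * (diameter (D i) / 2) powr ?n))"
    proof (rule hausdorff_pre_le)
      show "E \<subseteq> (\<Union>i. D i)"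
      proof
        fix x assume "x \<in> E"
        then obtain c where c: "c \<in> C" "x \<in> cball c (5 * r c)" using C(4) by blast
        then have "x \<in> D (to_nat_on C c)" using C(1) by (simp add: D_def)
        then show "x \<in> (\<Union>i. D i)" by blast
      qed
    qed (use D in auto)
    also have "\<dots> = ennreal (5 ^ DIM('a)) * (\<Sum>i. emeasure lborel (B i))"
      by (simp add: D(3) ennreal_suminf_cmult)
    also have "(\<Sum>i. emeasure lborel (B i)) = emeasure lborel (\<Union>i. B i)"
      by (rule suminf_emeasure[OF _ disj]) (auto simp: B_def)
    also have "\<dots> \<le> emeasure lborel U"
    proof (rule emeasure_mono)
      show "(\<Union>i. B i) \<subseteq> U"
      proof
        fix x assume "x \<in> (\<Union>i. B i)"
        then obtain i where i: "x \<in> B i" by blast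
        then have "i \<in> ?I" by (auto simp: B_def split: if_splits)
        moreover from this have "x \<in> cball (?g i) (r (?g i))" using i by (simp only: B_def if_True)
        ultimately show "x \<in> U" using r[of "?g i"] g(1)[of i] C(2) by blast
      qed
    qed (use U in auto)
    also have "emeasure lborel U \<le> emeasure lborel E + emeasure lborel (U - E)"
    proof -
      have "U = E \<union> (U - E)" using U by blast
      then show ?thesis
        using emeasure_subadditive[of E lborel "U - E"] E U by auto
    qed
    also have "\<dots> \<le> emeasure lborel E + ennreal e'" using U by (intro add_left_mono) simp
    also have "ennreal (5 ^ DIM('a)) * (emeasure lborel E + ennreal e') = ennreal (5 ^ DIM('a)) * emeasure lborel E + ennreal e"
      using e by (simp add: distrib_left e'_def ennreal_mult'[symmetric])
    finally show "hausdorff_pre ?n \<delta> E \<le> ennreal (5 ^ DIM('a)) * emeasure lborel E + ennreal e"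
      by (simp add: mult_left_mono)
  qed
qed

text \<open>A point has diameter 0, and \<open>0 powr s = 0\<close> for every \<open>s\<close>. By
  this convention even the case \<open>s = 0\<close> gives 0 and not the counting measure.\<close>

lemma hausdorff_measure_singleton: "0 \<le> s \<Longrightarrow> hausdorff_measure s {x} = 0"
proof -
  have "hausdorff_measure s {x} \<le> 0"
    by (rule hausdorff_measure_leI, rule order_trans[OF hausdorff_pre_le[of _ "\<lambda>_. {x}"]]) auto
  then show ?thesis by simp
qed

section \<open>Densities as eventual inequalities\<close>

text \<open>Replaces a density by a plain inequality with an unspecified constant, into which the
  volume of the unit ball is absorbed. An infinite measure is a case of its own because the quotient
  is formed in \<open>ennreal\<close>.\<close>

lemma lower_density_posD:
  assumes "0 < lower_density j W x0" "0 \<le> j"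
  obtains c where "0 < c"
    "\<forall>\<^sub>F \<epsilon> in at_right 0. ennreal (c * \<epsilon> powr j) \<le> hausdorff_measure j (W \<inter> cball x0 \<epsilon>)"
proof -
  obtain y where y: "0 < y" "y < lower_density j W x0" using dense[OF assms(1)] by blast
  then have "y < top" by (meson less_le_trans top_greatest)
  then obtain c where c: "y = ennreal c" "0 < c" using y(1) by (cases y) auto
  let ?u = "unit_ball_vol j"
  have u: "0 < ?u" using assms(2) by (rule unit_ball_vol_pos)
  have "\<forall>\<^sub>F \<epsilon> in at_right 0. y < hausdorff_measure j (W \<inter> cball x0 \<epsilon>) / ennreal (?u * \<epsilon> powr j)"
    using y(2) unfolding lower_density_def by (rule less_LiminfD)
  then have "\<forall>\<^sub>F \<epsilon> in at_right 0. ennreal (c * ?u * \<epsilon> powr j) \<le> hausdorff_measure j (W \<inter> cball x0 \<epsilon>)"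
    using eventually_at_right_less
  proof eventually_elim
    case (elim \<epsilon>)
    let ?D = "?u * \<epsilon> powr j"
    have D: "0 < ?D" using u elim(2) by simp
    show ?case
    proof (cases "hausdorff_measure j (W \<inter> cball x0 \<epsilon>)")
      case (real h)
      then have "ennreal c < ennreal (h / ?D)"
        using elim(1) c D by (simp add: divide_ennreal)
      then have "c < h / ?D" using c by (simp add: ennreal_less_iff)
      then have "c * ?D \<le> h" using D by (simp add: pos_less_divide_eq)
      then show ?thesis using real by (simp add: mult.assoc ennreal_leI)
    qed simp
  qed
  then show ?thesis using that[of "c * ?u"] c u by simp
qed

lemma lower_density_posI:
  assumes "0 < c" "0 \<le> j"
    "\<forall>\<^sub>F \<epsilon> in at_right 0. ennreal (c * \<epsilon> powr j) \<le> hausdorff_measure j (W \<inter> cball x0 \<epsilon>)"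
  shows "0 < lower_density j W x0"
proof -
  let ?u = "unit_ball_vol j"
  have u: "0 < ?u" using assms(2) by (rule unit_ball_vol_pos)
  have "\<forall>\<^sub>F \<epsilon> in at_right 0. ennreal (c / ?u) \<le> hausdorff_measure j (W \<inter> cball x0 \<epsilon>) / ennreal (?u * \<epsilon> powr j)"
    using assms(3) eventually_at_right_less
  proof eventually_elim
    case (elim \<epsilon>)
    let ?D = "?u * \<epsilon> powr j"
    have D: "0 < ?D" using u elim(2) by simp
    have "ennreal (c / ?u) = ennreal (c * \<epsilon> powr j) / ennreal ?D"
      using D assms(1) u elim(2) by (subst divide_ennreal) auto
    also have "\<dots> \<le> hausdorff_measure j (W \<inter> cball x0 \<epsilon>) / ennreal ?D"
      using elim(1) by (rule divide_right_mono_ennreal)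
    finally show ?case .
  qed
  then have "ennreal (c / ?u) \<le> lower_density j W x0"
    unfolding lower_density_def by (rule Liminf_bounded)
  moreover have "0 < ennreal (c / ?u)" using assms(1) u by simp
  ultimately show ?thesis by (rule less_le_trans[rotated])
qed

lemma upper_density_eq_0D:
  assumes "upper_density j W x0 = 0" "0 \<le> j" "0 < c"
  shows "\<forall>\<^sub>F \<epsilon> in at_right 0. hausdorff_measure j (W \<inter> cball x0 \<epsilon>) \<le> ennreal (c * \<epsilon> powr j)"
proof -
  let ?u = "unit_ball_vol j"
  have u: "0 < ?u" using assms(2) by (rule unit_ball_vol_pos)
  have "upper_density j W x0 < ennreal (c / ?u)" using assms u by simp
  then have "\<forall>\<^sub>F \<epsilon> in at_right 0. hausdorff_measure j (W \<inter> cball x0 \<epsilon>) / ennreal (?u * \<epsilon> powr j) < ennreal (c / ?u)"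
    unfolding upper_density_def by (rule Limsup_lessD)
  then show ?thesis using eventually_at_right_less
  proof eventually_elim
    case (elim \<epsilon>)
    let ?D = "?u * \<epsilon> powr j"
    have D: "0 < ?D" using u elim(2) by simp
    show ?case
    proof (cases "hausdorff_measure j (W \<inter> cball x0 \<epsilon>)")
      case (real h)
      then have "ennreal (h / ?D) < ennreal (c / ?u)"
        using elim(1) D by (simp add: divide_ennreal)
      then have "h / ?D < c / ?u" using real D by (simp add: ennreal_less_iff)
      then have "h \<le> c * \<epsilon> powr j" using D u by (simp add: pos_divide_less_eq mult.commute)
      then show ?thesis using real by (simp add: ennreal_leI)
    next
      case top
      have "hausdorff_measure j (W \<inter> cball x0 \<epsilon>) / ennreal ?D = top"
        unfolding top using D by (simp add: ennreal_top_divide)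
      then show ?thesis using elim(1) by simp
    qed
  qed
qed

lemma upper_density_eq_0I:
  assumes "0 \<le> j"
    "\<And>c. 0 < c \<Longrightarrow> \<forall>\<^sub>F \<epsilon> in at_right 0. hausdorff_measure j (W \<inter> cball x0 \<epsilon>) \<le> ennreal (c * \<epsilon> powr j)"
  shows "upper_density j W x0 = 0"
proof -
  let ?u = "unit_ball_vol j"
  have u: "0 < ?u" using assms(1) by (rule unit_ball_vol_pos)
  have "upper_density j W x0 \<le> 0 + ennreal e" if e: "0 < e" for e
  proof -
    have "\<forall>\<^sub>F \<epsilon> in at_right 0. hausdorff_measure j (W \<inter> cball x0 \<epsilon>) / ennreal (?u * \<epsilon> powr j) \<le> ennreal e"
      using assms(2)[OF mult_pos_pos[OF e u]] eventually_at_right_less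
    proof eventually_elim
      case (elim \<epsilon>)
      let ?D = "?u * \<epsilon> powr j"
      have D: "0 < ?D" using u elim(2) by simp
      have "hausdorff_measure j (W \<inter> cball x0 \<epsilon>) / ennreal ?D \<le> ennreal (e * ?u * \<epsilon> powr j) / ennreal ?D"
        using elim(1) e u by (intro divide_right_mono_ennreal) simp
      also have "\<dots> = ennreal e" using D e u elim(2) by (subst divide_ennreal) auto
      finally show ?case .
    qed
    then show ?thesis unfolding upper_density_def by (simp add: Limsup_bounded)
  qed
  then have "upper_density j W x0 \<le> 0" by (rule ennreal_le_epsilon)
  then show ?thesis by simp
qed

section \<open>Multiplicity bounds and small sets of codimension one\<close>

text \<open>Fubini: with one endpoint fixed, the other endpoint ranges over a ball of radius
  \<open>R\<close> divided by its weight in the convex combination. Integrating first over the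
  endpoint with weight at least \<open>1/2\<close> bounds this radius by
  \<open>2 * R\<close>.\<close>

lemma segment_hits_ball_pairs_bound:
  fixes K :: "'a::euclidean_space set" and c :: 'a
  assumes K: "compact K" and s: "0 \<le> s" "s \<le> 1" and R: "0 \<le> R"
  defines "Q \<equiv> {(a, p). a \<in> K \<and> p \<in> K \<and> dist ((1 - s) *\<^sub>R a + s *\<^sub>R p) c \<le> R}"
  shows "Q \<in> sets (lborel \<Otimes>\<^sub>M lborel)"
    and "emeasure (lborel \<Otimes>\<^sub>M lborel) Q
           \<le> emeasure lborel K * ennreal (unit_ball_vol (real DIM('a)) * (2 * R) ^ DIM('a))"
proof -
  have cl: "closed Q"
  proof -
    have "Q = (K \<times> K) \<inter> {x. dist ((1 - s) *\<^sub>R fst x + s *\<^sub>R snd x) c \<le> R}"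
      by (auto simp: Q_def)
    moreover have "closed {x. dist ((1 - s) *\<^sub>R fst x + s *\<^sub>R snd x) c \<le> R}"
      by (intro closed_Collect_le continuous_intros)
    ultimately show ?thesis using K by (simp add: closed_Int closed_Times compact_imp_closed)
  qed
  then show meas: "Q \<in> sets (lborel \<Otimes>\<^sub>M lborel)" by (simp only: lborel_prod sets_lborel borel_closed)
  let ?B = "ennreal (unit_ball_vol (real DIM('a)) * (2 * R) ^ DIM('a))"
  have slice: "emeasure lborel {p. p \<in> K \<and> dist (u *\<^sub>R p) d \<le> R} \<le> ?B" if u: "1 / 2 \<le> u" for u d
  proof -
    have "{p. p \<in> K \<and> dist (u *\<^sub>R p) d \<le> R} \<subseteq> cball (d /\<^sub>R u) (2 * R)"
    proof (clarsimp)
      fix p assume p: "dist (u *\<^sub>R p) d \<le> R"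
      have "u *\<^sub>R p - d = u *\<^sub>R (p - d /\<^sub>R u)" using u by (simp add: algebra_simps)
      then have "dist (u *\<^sub>R p) d = u * dist (d /\<^sub>R u) p"
        using u by (simp add: dist_norm norm_minus_commute)
      then have "1/2 * dist (d /\<^sub>R u) p \<le> R"
        using p u mult_right_mono[OF u, of "dist (d /\<^sub>R u) p"] by simp
      then show "dist (d /\<^sub>R u) p \<le> 2 * R" by simp
    qed
    then have "emeasure lborel {p. p \<in> K \<and> dist (u *\<^sub>R p) d \<le> R} \<le> emeasure lborel (cball (d /\<^sub>R u) (2 * R))"
      by (rule emeasure_mono) simp
    also have "\<dots> = ?B" using R by (subst emeasure_cball) auto
    finally show ?thesis .
  qed
  show "emeasure (lborel \<Otimes>\<^sub>M lborel) Q \<le> emeasure lborel K * ?B"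
  proof (cases "1/2 \<le> s")
    case True
    have "emeasure (lborel \<Otimes>\<^sub>M lborel) Q = (\<integral>\<^sup>+ a. emeasure lborel (Pair a -` Q) \<partial>lborel)"
      by (rule lborel.emeasure_pair_measure_alt[OF meas])
    also have "\<dots> \<le> (\<integral>\<^sup>+ a. ?B * indicator K a \<partial>lborel)"
    proof (rule nn_integral_mono)
      fix a :: 'a
      show "emeasure lborel (Pair a -` Q) \<le> ?B * indicator K a"
      proof (cases "a \<in> K")
        case aK: True
        have "Pair a -` Q = {p. p \<in> K \<and> dist (s *\<^sub>R p) (c - (1 - s) *\<^sub>R a) \<le> R}"
          using aK by (auto simp: Q_def dist_norm algebra_simps)
        then show ?thesis using slice[OF True] aK by simp
      next
        case False
        then have "Pair a -` Q = {}" by (auto simp: Q_def)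
        then show ?thesis by simp
      qed
    qed
    also have "\<dots> = emeasure lborel K * ?B"
      using K by (subst nn_integral_cmult_indicator) (auto simp: mult.commute borel_compact)
    finally show ?thesis .
  next
    case False
    have "emeasure (lborel \<Otimes>\<^sub>M lborel) Q = (\<integral>\<^sup>+ p. emeasure lborel ((\<lambda>a. (a, p)) -` Q) \<partial>lborel)"
      by (rule lborel_pair.emeasure_pair_measure_alt2[OF meas])
    also have "\<dots> \<le> (\<integral>\<^sup>+ a. ?B * indicator K a \<partial>lborel)"
    proof (rule nn_integral_mono)
      fix p :: 'a
      show "emeasure lborel ((\<lambda>a. (a, p)) -` Q) \<le> ?B * indicator K p"
      proof (cases "p \<in> K")
        case pK: True
        have "(\<lambda>a. (a, p)) -` Q = {a. a \<in> K \<and> dist ((1 - s) *\<^sub>R a) (c - s *\<^sub>R p) \<le> R}"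
          using pK by (auto simp: Q_def dist_norm algebra_simps)
        then show ?thesis using slice[of "1 - s"] False pK by simp
      next
        case False
        then have "(\<lambda>a. (a, p)) -` Q = {}" by (auto simp: Q_def)
        then show ?thesis by simp
      qed
    qed
    also have "\<dots> = emeasure lborel K * ?B"
      using K by (subst nn_integral_cmult_indicator) (auto simp: mult.commute borel_compact)
    finally show ?thesis .
  qed
qed

lemma power_add_le_two_powers:
  fixes a b :: real
  assumes "0 \<le> a" "0 \<le> b"
  shows "(a + b) ^ m \<le> 2 ^ m * (a ^ m + b ^ m)"
proof -
  have "(a + b) ^ m \<le> (2 * max a b) ^ m" using assms by (intro power_mono) auto
  also have "\<dots> = 2 ^ m * max a b ^ m" by (simp add: power_mult_distrib)
  also have "\<dots> \<le> 2 ^ m * (a ^ m + b ^ m)"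
    using assms by (intro mult_left_mono) (auto simp: max_def)
  finally show ?thesis .
qed

text \<open>Each covering set of diameter \<open>d i\<close> goes into a ball of radius
  \<open>d i + \<tau> i\<close>. The summand \<open>2^Suc m / unit_ball_vol m\<close> of the
  constant pays for the diameters, the summand 1 for the additions \<open>\<tau> i\<close>.\<close>

lemma small_hausdorff_measure_ball_cover:
  fixes Z :: "'a::metric_space set"
  assumes H: "hausdorff_measure (real m) Z \<le> ennreal \<delta>" and \<delta>: "0 < \<delta>" and m: "1 \<le> m"
  obtains c :: "nat \<Rightarrow> 'a" and r :: "nat \<Rightarrow> real"
  where "\<And>i. 0 < r i" "\<And>i. r i \<le> 2" "Z \<subseteq> (\<Union>i. cball (c i) (r i))"
    "(\<Sum>i. ennreal (r i ^ m)) \<le> ennreal (2 ^ m * (2 ^ Suc m / unit_ball_vol (real m) + 1) * \<delta>)"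
proof -
  let ?u = "unit_ball_vol (real m)"
  have u: "0 < ?u" by (rule unit_ball_vol_pos) simp
  have "hausdorff_pre (real m) 1 Z \<le> ennreal \<delta>"
    by (rule order_trans[OF hausdorff_pre_le_measure H]) simp
  also have "\<dots> < ennreal (2 * \<delta>)" using \<delta> by (simp add: ennreal_lessI)
  finally obtain C :: "nat \<Rightarrow> 'a set" where C: "Z \<subseteq> (\<Union>i. C i)" "\<And>i. bounded (C i)" "\<And>i. diameter (C i) \<le> 1"
      "(\<Sum>i. ennreal (?u * (diameter (C i) / 2) powr real m)) < ennreal (2 * \<delta>)"
    unfolding hausdorff_pre_def INF_less_iff by auto
  define d where "d i = diameter (C i)" for i
  have d: "0 \<le> d i" "d i \<le> 1" for i using C by (auto simp: d_def diameter_ge_0)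
  \<comment> \<open>Covering sets may have diameter 0, but the radii are later divided by and must
    be positive. The additions are summable with total at most \<open>\<delta>\<close>, and their
    \<open>m\<close>-th powers are no larger because \<open>\<tau> i \<le> 1\<close>.\<close>
  define \<tau> where "\<tau> i = min 1 \<delta> * (1/2) ^ Suc i" for i
  have \<tau>: "0 < \<tau> i" "\<tau> i \<le> 1" "\<tau> i \<le> \<delta> * (1/2) ^ Suc i" for i
  proof -
    show "0 < \<tau> i" using \<delta> by (simp add: \<tau>_def)
    have "min 1 \<delta> * (1/2) ^ Suc i \<le> 1 * 1" using \<delta>
      by (intro mult_mono power_le_one) auto
    then show "\<tau> i \<le> 1" by (simp add: \<tau>_def)
    show "\<tau> i \<le> \<delta> * (1/2) ^ Suc i" unfolding \<tau>_def by (intro mult_right_mono) auto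
  qed
  define r where "r i = d i + \<tau> i" for i
  define c where "c i = (SOME x. x \<in> C i)" for i
  have sub: "C i \<subseteq> cball (c i) (r i)" for i
  proof
    fix x assume x: "x \<in> C i"
    then have "c i \<in> C i" unfolding c_def by (rule someI)
    then have "dist (c i) x \<le> d i" using x C(2) by (simp add: d_def diameter_bounded_bound)
    then show "x \<in> cball (c i) (r i)" using \<tau>(1)[of i] by (simp add: r_def)
  qed
  have cov: "Z \<subseteq> (\<Union>i. cball (c i) (r i))"
    by (rule order_trans[OF C(1)]) (intro UN_mono order_refl sub)
  define k where "k = 2 ^ m / ?u"
  have kp: "0 < k" using u by (simp add: k_def)
  have pw: "?u * (d i / 2) powr real m = d i ^ m / k" for i
  proof (cases "d i = 0")
    case True then show ?thesis using m by simp
  next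
    case False
    then have "(d i / 2) powr real m = (d i / 2) ^ m" using d(1)[of i] by (intro powr_realpow) auto
    then show ?thesis by (simp add: k_def power_divide)
  qed
  have "(\<Sum>i. ennreal (r i ^ m)) \<le> (\<Sum>i. ennreal (2 ^ m * k) * ennreal (?u * (d i / 2) powr real m) + ennreal (2 ^ m * (\<delta> * (1/2) ^ Suc i)))"
  proof (rule suminf_le)
    fix i
    have "\<tau> i ^ m \<le> \<tau> i ^ 1" using \<tau>[of i] m by (intro power_decreasing) auto
    then have t: "\<tau> i ^ m \<le> \<delta> * (1/2) ^ Suc i" using \<tau>(3)[of i] by simp
    have "r i ^ m \<le> 2 ^ m * (d i ^ m + \<tau> i ^ m)"
      unfolding r_def using d(1)[of i] \<tau>(1)[of i] by (intro power_add_le_two_powers) auto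
    also have "\<dots> \<le> 2 ^ m * (d i ^ m + \<delta> * (1/2) ^ Suc i)"
      using t by (intro mult_left_mono) auto
    also have "\<dots> = (2 ^ m * k) * (?u * (d i / 2) powr real m) + 2 ^ m * (\<delta> * (1/2) ^ Suc i)"
      using kp unfolding pw by (simp add: distrib_left)
    finally have "ennreal (r i ^ m) \<le> ennreal ((2 ^ m * k) * (?u * (d i / 2) powr real m) + 2 ^ m * (\<delta> * (1/2) ^ Suc i))"
      by (rule ennreal_leI)
    also have "\<dots> = ennreal (2 ^ m * k) * ennreal (?u * (d i / 2) powr real m) + ennreal (2 ^ m * (\<delta> * (1/2) ^ Suc i))"
      using kp u \<delta> by (subst ennreal_plus) (auto simp: ennreal_mult)
    finally show "ennreal (r i ^ m) \<le> ennreal (2 ^ m * k) * ennreal (?u * (d i / 2) powr real m) + ennreal (2 ^ m * (\<delta> * (1/2) ^ Suc i))" .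
  qed auto
  also have "\<dots> = ennreal (2 ^ m * k) * (\<Sum>i. ennreal (?u * (d i / 2) powr real m)) + (\<Sum>i. ennreal (2 ^ m * (\<delta> * (1/2) ^ Suc i)))"
    by (subst suminf_add[symmetric]) (auto simp: ennreal_suminf_cmult)
  also have "(\<Sum>i. ennreal (2 ^ m * (\<delta> * (1/2) ^ Suc i))) = ennreal (2 ^ m * \<delta>)"
    using \<delta> sums_mult[OF power_half_series, of "2 ^ m * \<delta>"]
    by (intro suminf_ennreal_eq) (auto simp: mult.assoc)
  also have "ennreal (2 ^ m * k) * (\<Sum>i. ennreal (?u * (d i / 2) powr real m)) \<le> ennreal (2 ^ m * k) * ennreal (2 * \<delta>)"
    using C(4) unfolding d_def by (intro mult_left_mono) auto
  also have "ennreal (2 ^ m * k) * ennreal (2 * \<delta>) + ennreal (2 ^ m * \<delta>) = ennreal (2 ^ m * (2 ^ Suc m / ?u + 1) * \<delta>)"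
    using kp \<delta> by (simp add: ennreal_mult'[symmetric] ennreal_plus[symmetric] k_def algebra_simps del: ennreal_plus)
  finally have sm: "(\<Sum>i. ennreal (r i ^ m)) \<le> ennreal (2 ^ m * (2 ^ Suc m / ?u + 1) * \<delta>)"
    by (simp add: add_right_mono)
  show ?thesis
  proof (rule that[OF _ _ cov sm])
    fix i
    show "0 < r i" "r i \<le> 2" using d[of i] \<tau>(1,2)[of i] by (auto simp: r_def)
  qed
qed

text \<open>The pairs \<open>(a, p)\<close> whose segment meets a ball of radius \<open>r\<close> have measure \<open>O(r\<^sup>n\<^sup>-\<^sup>1)\<close>, as one
  sees by testing \<open>O(1/r)\<close> equidistant parameters on the segment. Hence for generic \<open>a\<close> and \<open>b\<close> some
  \<open>p\<close> is joined to both off \<open>Z\<close>.\<close>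

lemma generic_points_joined_avoiding_small_set:
  fixes K :: "'a::euclidean_space set"
  assumes K: "compact K" "convex K" "0 < emeasure lborel K" and dim: "2 \<le> DIM('a)" and \<kappa>: "0 < \<kappa>"
  obtains \<delta> where "0 < \<delta>"
    "\<And>Z. hausdorff_measure (real (DIM('a) - 1)) Z \<le> ennreal \<delta> \<Longrightarrow>
       \<exists>M. M \<in> sets lborel \<and> emeasure lborel M \<le> ennreal \<kappa> \<and>
         (\<forall>a\<in>K - M. \<forall>b\<in>K - M. \<exists>T. connected T \<and> a \<in> T \<and> b \<in> T \<and> T \<subseteq> K - Z)"
proof -
  define n where "n = DIM('a)"
  define m where "m = n - 1"
  have nm: "n = Suc m" "1 \<le> m" using dim by (auto simp: n_def m_def)
  obtain D0 where D0: "\<And>x. x \<in> K \<Longrightarrow> norm x \<le> D0"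
    using compact_imp_bounded[OF K(1)] bounded_iff by metis
  define D where "D = 2 * \<bar>D0\<bar>"
  have D: "0 \<le> D" "\<And>x y. x \<in> K \<Longrightarrow> y \<in> K \<Longrightarrow> dist x y \<le> D"
  proof -
    fix x y assume "x \<in> K" "y \<in> K"
    then show "dist x y \<le> D" using D0[of x] D0[of y] norm_triangle_ineq4[of x y] by (simp add: D_def dist_norm)
  qed (simp add: D_def)
  define \<mu> where "\<mu> = measure lborel K"
  have fin: "emeasure lborel K \<noteq> \<infinity>" using emeasure_lborel_cbox_finite K(1)
    by (metis compact_imp_bounded emeasure_bounded_finite less_top infinity_ennreal_def)
  have em: "emeasure lborel K = ennreal \<mu>" using fin by (simp add: \<mu>_def emeasure_eq_ennreal_measure)
  have \<mu>: "0 < \<mu>" using K(3) em by simp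
  let ?ub = "unit_ball_vol (real n)"
  have ub: "0 < ?ub" "0 < unit_ball_vol (real m)" by (auto intro: unit_ball_vol_pos)
  define C1 where "C1 = 2 ^ m * (2 ^ Suc m / unit_ball_vol (real m) + 1)"
  define C2 where "C2 = 5 * \<mu> * ?ub * (2 * (1 + D)) ^ n"
  have C12: "0 < C1" "0 < C2"
    using ub \<mu> D(1) by (auto simp: C1_def C2_def intro!: mult_pos_pos add_pos_pos divide_pos_pos)
  \<comment> \<open>Chosen so that the pairs with an obstructed segment have total measure at most
    \<open>C2 * (C1 * \<delta>) = \<kappa> * \<mu> / 3\<close>.\<close>
  define \<delta> where "\<delta> = \<kappa> * \<mu> / (3 * C1 * C2)"
  have \<delta>: "0 < \<delta>" using C12 \<mu> \<kappa> by (simp add: \<delta>_def)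
  show ?thesis
  proof (rule that[OF \<delta>])
    fix Z :: "'a set" assume Z: "hausdorff_measure (real (DIM('a) - 1)) Z \<le> ennreal \<delta>"
    obtain c r where cr: "\<And>i. 0 < r i" "\<And>i. r i \<le> 2" "Z \<subseteq> (\<Union>i::nat. cball (c i) (r i))"
      "(\<Sum>i. ennreal (r i ^ m)) \<le> ennreal (C1 * \<delta>)"
      by (rule small_hausdorff_measure_ball_cover[OF Z[folded n_def, folded m_def] \<delta> nm(2), folded C1_def])
        (rule that, assumption+)
    \<comment> \<open>The test parameters have spacing \<open>1 / N i \<le> r i\<close>. There are
      \<open>N i + 1 \<le> 5 / r i\<close> of them, where \<open>r i \<le> 2\<close> absorbs the
      rounding.\<close>
    define N where "N i = nat \<lceil>1 / r i\<rceil>" for i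
    have N: "0 < N i" "1 / real (N i) \<le> r i" "real (Suc (N i)) \<le> 5 / r i" for i
    proof -
      have p: "0 < 1 / r i" using cr(1) by simp
      then show "0 < N i" by (simp add: N_def)
      have "1 / r i \<le> real (N i)" unfolding N_def by linarith
      then show "1 / real (N i) \<le> r i" using cr(1)[of i] \<open>0 < N i\<close> by (simp add: field_simps)
      have "real (N i) \<le> 1 / r i + 1" unfolding N_def using p by linarith
      moreover have "2 \<le> 4 / r i" using cr(1)[of i] cr(2)[of i] by (simp add: field_simps)
      ultimately show "real (Suc (N i)) \<le> 5 / r i" by (simp add: add_divide_distrib[symmetric])
    qed
    \<comment> \<open>Moving the parameter by at most \<open>r i\<close> moves the point of the
      segment by at most \<open>D * r i\<close>; enlarging the ball to \<open>(1 + D) * r i\<close>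
      therefore lets the test parameters detect every hit.\<close>
    define Q where "Q i k = {(a, p). a \<in> K \<and> p \<in> K \<and>
        dist ((1 - real k / real (N i)) *\<^sub>R a + (real k / real (N i)) *\<^sub>R p) (c i) \<le> (1 + D) * r i}" for i k
    define QQ where "QQ = (\<Union>i. \<Union>k\<in>{..N i}. Q i k)"
    have Qm: "Q i k \<in> sets (lborel \<Otimes>\<^sub>M lborel)"
         "emeasure (lborel \<Otimes>\<^sub>M lborel) (Q i k) \<le> ennreal (\<mu> * (?ub * (2 * ((1 + D) * r i)) ^ n))"
         if "k \<le> N i" for i k
    proof -
      have s: "0 \<le> real k / real (N i)" "real k / real (N i) \<le> 1" "0 \<le> (1 + D) * r i"
        using that N(1)[of i] D(1) cr(1)[of i] by auto
      note * = segment_hits_ball_pairs_bound[OF K(1) s, of "c i", folded Q_def]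
      show "Q i k \<in> sets (lborel \<Otimes>\<^sub>M lborel)" by (rule *(1))
      show "emeasure (lborel \<Otimes>\<^sub>M lborel) (Q i k) \<le> ennreal (\<mu> * (?ub * (2 * ((1 + D) * r i)) ^ n))"
        using *(2) \<mu> unfolding em n_def[symmetric] by (simp add: ennreal_mult')
    qed
    have QQm: "QQ \<in> sets (lborel \<Otimes>\<^sub>M lborel)"
      unfolding QQ_def using Qm(1) by (intro sets.countable_UN sets.finite_UN) auto
    have one: "emeasure (lborel \<Otimes>\<^sub>M lborel) (\<Union>k\<in>{..N i}. Q i k) \<le> ennreal C2 * ennreal (r i ^ m)" for i
    proof -
      have "emeasure (lborel \<Otimes>\<^sub>M lborel) (\<Union>k\<in>{..N i}. Q i k) \<le> (\<Sum>k\<in>{..N i}. emeasure (lborel \<Otimes>\<^sub>M lborel) (Q i k))"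
        using Qm(1) by (intro emeasure_subadditive_finite) auto
      also have "\<dots> \<le> (\<Sum>k\<in>{..N i}. ennreal (\<mu> * (?ub * (2 * ((1 + D) * r i)) ^ n)))"
        using Qm(2) by (intro sum_mono) auto
      also have "\<dots> = ennreal (real (Suc (N i)) * (\<mu> * (?ub * (2 * ((1 + D) * r i)) ^ n)))"
        using \<mu> ub D(1) cr(1)[of i] by (subst sum_ennreal) auto
      also have "\<dots> \<le> ennreal (5 / r i * (\<mu> * (?ub * (2 * ((1 + D) * r i)) ^ n)))"
        using \<mu> ub D(1) cr(1)[of i] N(3)[of i] by (intro ennreal_leI mult_right_mono) auto
      also have "5 / r i * (\<mu> * (?ub * (2 * ((1 + D) * r i)) ^ n)) = C2 * r i ^ m"
      proof -
        have "(2 * ((1 + D) * r i)) ^ n = ((2 * (1 + D)) * r i) ^ n" by (simp only: mult.assoc)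
        also have "\<dots> = (2 * (1 + D)) ^ n * (r i * r i ^ m)"
          by (simp only: power_mult_distrib[of "2 * (1 + D)" "r i"] nm(1) power_Suc[of "r i"])
        finally show ?thesis using cr(1)[of i] unfolding C2_def by simp
      qed
      also have "ennreal (C2 * r i ^ m) = ennreal C2 * ennreal (r i ^ m)"
        using C12 by (intro ennreal_mult') simp
      finally show ?thesis .
    qed
    have "emeasure (lborel \<Otimes>\<^sub>M lborel) QQ \<le> (\<Sum>i. emeasure (lborel \<Otimes>\<^sub>M lborel) (\<Union>k\<in>{..N i}. Q i k))"
      unfolding QQ_def using Qm(1)
      by (intro emeasure_subadditive_countably) (auto intro!: sets.finite_UN)
    also have "\<dots> \<le> (\<Sum>i. ennreal C2 * ennreal (r i ^ m))" by (intro suminf_le one) auto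
    also have "\<dots> = ennreal C2 * (\<Sum>i. ennreal (r i ^ m))" by (rule ennreal_suminf_cmult)
    also have "\<dots> \<le> ennreal C2 * ennreal (C1 * \<delta>)" by (intro mult_left_mono cr(4)) simp
    also have "\<dots> = ennreal (\<kappa> * (\<mu> / 3))"
      using C12 \<delta> by (subst ennreal_mult'[symmetric]) (auto simp: \<delta>_def field_simps)
    finally have QQle: "emeasure (lborel \<Otimes>\<^sub>M lborel) QQ \<le> ennreal (\<kappa> * (\<mu> / 3))" .
    define f where "f a = emeasure lborel (Pair a -` QQ)" for a
    have fm: "f \<in> borel_measurable lborel"
      unfolding f_def by (rule lborel.measurable_emeasure_Pair[OF QQm])
    \<comment> \<open>The bad starting points are those whose obstructed partners have measure at
      least \<open>\<mu> / 3\<close>; Markov's inequality bounds their volume by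
      \<open>\<kappa>\<close>. Two good points together obstruct less than
      \<open>2 * \<mu> / 3\<close> of \<open>K\<close>, which leaves a common partner.\<close>
    define M where "M = {a. 1 \<le> ennreal (3 / \<mu>) * f a}"
    have Mm: "M \<in> sets lborel"
    proof -
      have "{a \<in> space lborel. 1 \<le> ennreal (3 / \<mu>) * f a} \<in> sets lborel" using fm by measurable
      then show ?thesis by (simp add: M_def)
    qed
    have "emeasure lborel M \<le> ennreal (3 / \<mu>) * (\<integral>\<^sup>+a. f a \<partial>lborel)"
      using nn_integral_Markov_inequality[of f UNIV lborel "ennreal (3 / \<mu>)"] fm by (simp add: M_def)
    also have "(\<integral>\<^sup>+a. f a \<partial>lborel) = emeasure (lborel \<Otimes>\<^sub>M lborel) QQ"
      unfolding f_def by (rule lborel.emeasure_pair_measure_alt[OF QQm, symmetric])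
    also have "ennreal (3 / \<mu>) * \<dots> \<le> ennreal (3 / \<mu>) * ennreal (\<kappa> * (\<mu> / 3))"
      by (intro mult_left_mono QQle) simp
    also have "\<dots> = ennreal \<kappa>" using \<mu> \<kappa> by (simp add: ennreal_mult'[symmetric])
    finally have Mle: "emeasure lborel M \<le> ennreal \<kappa>" .
    have seg: "closed_segment a p \<inter> Z = {}" if ap: "a \<in> K" "p \<in> K" "(a, p) \<notin> QQ" for a p
    proof (rule ccontr)
      assume "closed_segment a p \<inter> Z \<noteq> {}"
      then obtain s where s: "0 \<le> s" "s \<le> 1" "(1 - s) *\<^sub>R a + s *\<^sub>R p \<in> Z"
        by (auto simp: in_segment)
      let ?z = "(1 - s) *\<^sub>R a + s *\<^sub>R p"
      obtain i where i: "dist (c i) ?z \<le> r i" using s(3) cr(3) by auto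
      define k where "k = nat \<lfloor>s * real (N i)\<rfloor>"
      have sN: "0 \<le> s * real (N i)" "s * real (N i) \<le> real (N i)" using s by (auto simp: mult_left_le_one_le)
      have k: "real k \<le> s * real (N i)" "s * real (N i) \<le> real k + 1" using sN unfolding k_def by linarith+
      have kN: "k \<le> N i" using k(1) sN(2) by linarith
      let ?y = "(1 - real k / real (N i)) *\<^sub>R a + (real k / real (N i)) *\<^sub>R p"
      have "\<bar>s - real k / real (N i)\<bar> \<le> 1 / real (N i)"
      proof -
        have "s - real k / real (N i) = (s * real (N i) - real k) / real (N i)"
          using N(1)[of i] by (simp add: diff_divide_distrib)
        then show ?thesis using k N(1)[of i] by (simp add: divide_right_mono)
      qed
      then have sk: "\<bar>s - real k / real (N i)\<bar> \<le> r i" using N(2)[of i] by linarith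
      have "?y - ?z = (s - real k / real (N i)) *\<^sub>R (a - p)" by (simp add: algebra_simps)
      then have "dist ?y ?z = \<bar>s - real k / real (N i)\<bar> * dist a p" by (simp add: dist_norm)
      also have "\<dots> \<le> r i * D" using sk D(2)[OF ap(1,2)] cr(1)[of i] by (intro mult_mono) auto
      finally have "dist ?y (c i) \<le> (1 + D) * r i"
        using i dist_triangle[of ?y "c i" ?z] by (simp add: dist_commute algebra_simps)
      then have "(a, p) \<in> Q i k" using ap by (simp add: Q_def)
      then show False using ap(3) kN by (auto simp: QQ_def)
    qed
    have sec: "Pair a -` QQ \<in> sets lborel" for a using QQm by (rule sets_Pair1)
    have "\<exists>T. connected T \<and> a \<in> T \<and> b \<in> T \<and> T \<subseteq> K - Z" if ab: "a \<in> K - M" "b \<in> K - M" for a b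
    proof -
      have fs: "f x < ennreal (\<mu> / 3)" if "x \<notin> M" for x
      proof (rule ccontr)
        assume "\<not> ?thesis"
        then have "ennreal (3 / \<mu>) * ennreal (\<mu> / 3) \<le> ennreal (3 / \<mu>) * f x" by (intro mult_left_mono) auto
        then have "x \<in> M" using \<mu> by (simp add: M_def ennreal_mult'[symmetric])
        then show False using that by simp
      qed
      have "\<not> K \<subseteq> Pair a -` QQ \<union> Pair b -` QQ"
      proof
        assume "K \<subseteq> Pair a -` QQ \<union> Pair b -` QQ"
        then have "emeasure lborel K \<le> emeasure lborel (Pair a -` QQ \<union> Pair b -` QQ)"
          using sec by (intro emeasure_mono) auto
        also have "\<dots> \<le> f a + f b" unfolding f_def using sec by (intro emeasure_subadditive) auto
        also have "\<dots> \<le> ennreal (\<mu> / 3) + ennreal (\<mu> / 3)"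
          using fs[of a] fs[of b] ab by (intro add_mono less_imp_le) auto
        also have "\<dots> = ennreal (2 * \<mu> / 3)" using \<mu> by (subst ennreal_plus[symmetric]) auto
        finally show False using em \<mu> by (simp add: ennreal_le_iff)
      qed
      then obtain p where p: "p \<in> K" "(a, p) \<notin> QQ" "(b, p) \<notin> QQ" by auto
      have "closed_segment a p \<subseteq> K" "closed_segment b p \<subseteq> K"
        using closed_segment_subset[OF _ p(1) K(2)] ab by blast+
      then have "closed_segment a p \<union> closed_segment b p \<subseteq> K - Z"
        using seg[of a p] seg[of b p] p ab by auto
      moreover have "connected (closed_segment a p \<union> closed_segment b p)"
        by (rule connected_Un) auto
      ultimately show ?thesis
        by (intro exI[of _ "closed_segment a p \<union> closed_segment b p"]) auto
    qed
    then show "\<exists>M. M \<in> sets lborel \<and> emeasure lborel M \<le> ennreal \<kappa> \<and>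
         (\<forall>a\<in>K - M. \<forall>b\<in>K - M. \<exists>T. connected T \<and> a \<in> T \<and> b \<in> T \<and> T \<subseteq> K - Z)"
      using Mm Mle by blast
  qed
qed

text \<open>A substitute for the area formula. \<open>T\<close> is cut into countably many disjoint
  pieces on which \<open>\<pi>\<close> has an \<open>L\<close>-Lipschitz inverse; points of
  different pieces over the same \<open>w\<close> are distinct, so the images overlap at most
  \<open>m\<close> times. \<open>G\<close> confines the count to a region in which the fibres are
  finite.\<close>

lemma hausdorff_measure_le_multiplicity:
  fixes \<pi> :: "'a::euclidean_space \<Rightarrow> 'b::euclidean_space"
  assumes S: "compact S" and cont: "continuous_on S \<pi>" and L: "0 < L"
    and T: "T \<subseteq> S"
    and loc: "\<And>p. p \<in> T \<Longrightarrow> \<exists>V. open V \<and> p \<in> V \<and> V \<subseteq> G \<and>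
                (\<forall>q\<in>S \<inter> V. \<forall>q'\<in>S \<inter> V. dist q q' \<le> L * dist (\<pi> q) (\<pi> q'))"
    and fib: "\<And>w. finite {q \<in> S \<inter> G. \<pi> q = w} \<and> card {q \<in> S \<inter> G. \<pi> q = w} \<le> m"
  shows "hausdorff_measure (real DIM('b)) T
           \<le> ennreal ((5 * L) ^ DIM('b) * real m) * emeasure lborel (\<pi> ` S)"
proof (cases "T = {}")
  case False
  let ?n = "DIM('b)"
  define F where "F = {V. open V \<and> V \<subseteq> G \<and> (\<forall>q\<in>S \<inter> V. \<forall>q'\<in>S \<inter> V. dist q q' \<le> L * dist (\<pi> q) (\<pi> q'))}"
  have TF: "T \<subseteq> \<Union>F"
  proof
    fix p assume "p \<in> T"
    from loc[OF this] obtain V where "V \<in> F" "p \<in> V" unfolding F_def mem_Collect_eq by metis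
    then show "p \<in> \<Union>F" by (rule UnionI)
  qed
  obtain F' where F': "F' \<subseteq> F" "countable F'" "\<Union>F' = \<Union>F"
    by (rule Lindelof[of F]) (simp_all add: F_def)
  have "F' \<noteq> {}"
  proof
    assume "F' = {}"
    with F'(3) have "\<Union>F = {}" by simp
    with TF have "T \<subseteq> {}" by (simp only:)
    with False show False by blast
  qed
  define V where "V = from_nat_into F'"
  have rV: "range V = F'" unfolding V_def by (rule range_from_nat_into[OF \<open>F' \<noteq> {}\<close> F'(2)])
  then have V: "open (V i)" "V i \<subseteq> G" "\<And>q q'. q \<in> S \<inter> V i \<Longrightarrow> q' \<in> S \<inter> V i \<Longrightarrow> dist q q' \<le> L * dist (\<pi> q) (\<pi> q')" for i
    using F'(1) unfolding F_def by blast+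
  define W where "W i = S \<inter> disjointed V i" for i
  have WS: "W i \<subseteq> S \<inter> V i" for i using disjointed_subset[of V i] by (auto simp: W_def)
  define E where "E i = \<pi> ` W i" for i
  have Em: "E i \<in> sets lborel" for i
  proof -
    \<comment> \<open>An open set is a countable union of compact sets, and removing open sets
      preserves compactness. Thus \<open>E i\<close> is a countable union of compact images, hence
      Borel.\<close>
    obtain C :: "nat \<Rightarrow> 'a set" where C: "\<And>n. compact (C n)" "(\<Union>n. C n) = V i"
      using open_Union_compact_subsets[OF V(1)[of i]] by metis
    have eq: "W i = (\<Union>n. (S \<inter> C n) - (\<Union>j<i. V j))"
      unfolding W_def disjointed_def C(2)[symmetric] by (auto simp: atLeast0LessThan)
    have "compact ((S \<inter> C n) - (\<Union>j<i. V j))" for n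
      using S C V by (intro compact_diff compact_Int) auto
    then have "compact (\<pi> ` ((S \<inter> C n) - (\<Union>j<i. V j)))" for n
      by (rule compact_continuous_image[rotated]) (rule continuous_on_subset[OF cont], auto)
    then have "(\<Union>n. \<pi> ` ((S \<inter> C n) - (\<Union>j<i. V j))) \<in> sets lborel"
      by (intro sets.countable_UN) (auto intro: borel_compact)
    moreover have "E i = (\<Union>n. \<pi> ` ((S \<inter> C n) - (\<Union>j<i. V j)))"
      unfolding E_def eq by (rule image_UN)
    ultimately show ?thesis by simp
  qed
  have inj: "inj_on \<pi> (W i)" for i
  proof (rule inj_onI)
    fix x y assume "x \<in> W i" "y \<in> W i" "\<pi> x = \<pi> y"
    then show "x = y" using V(3)[of x i y] WS[of i] by auto
  qed
  have HW: "hausdorff_measure (real ?n) (W i) \<le> ennreal ((5 * L) ^ ?n) * emeasure lborel (E i)" for i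
  proof -
    let ?g = "the_inv_into (W i) \<pi>"
    have "?g ` E i = W i" unfolding E_def using inj[of i] by (simp add: the_inv_into_onto)
    moreover have "L-lipschitz_on (E i) ?g"
    proof (rule lipschitz_onI)
      fix x y assume "x \<in> E i" "y \<in> E i"
      then obtain q q' where "q \<in> W i" "q' \<in> W i" "x = \<pi> q" "y = \<pi> q'" by (auto simp: E_def)
      then show "dist (?g x) (?g y) \<le> L * dist x y"
        using V(3)[of q i q'] WS[of i] inj[of i] by (auto simp: the_inv_into_f_f)
    qed (use L in simp)
    ultimately have "hausdorff_measure (real ?n) (W i) \<le> ennreal (L powr real ?n) * hausdorff_measure (real ?n) (E i)"
      using hausdorff_measure_lipschitz_image[of L "E i" ?g "real ?n"] L by simp
    also have "\<dots> \<le> ennreal (L powr real ?n) * (ennreal (5 ^ ?n) * emeasure lborel (E i))"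
      by (intro mult_left_mono hausdorff_measure_le_lborel Em) simp
    also have "\<dots> = ennreal ((5 * L) ^ ?n) * emeasure lborel (E i)"
      using L by (simp only: mult.assoc[symmetric])
        (simp add: powr_realpow power_mult_distrib ennreal_mult mult.commute)
    finally show ?thesis .
  qed
  have "T \<subseteq> (\<Union>i. W i)"
    unfolding W_def Int_UN_distrib[symmetric] UN_disjointed_eq using TF T F'(3) rV by auto
  then have "hausdorff_measure (real ?n) T \<le> (\<Sum>i. hausdorff_measure (real ?n) (W i))"
    by (rule order_trans[OF hausdorff_measure_mono hausdorff_measure_UN])
  also have "\<dots> \<le> (\<Sum>i. ennreal ((5 * L) ^ ?n) * emeasure lborel (E i))"
    by (intro suminf_le HW) auto
  also have "\<dots> = ennreal ((5 * L) ^ ?n) * (\<Sum>i. emeasure lborel (E i))"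
    by (rule ennreal_suminf_cmult)
  also have "(\<Sum>i. emeasure lborel (E i)) = (\<Sum>i. \<integral>\<^sup>+w. indicator (E i) w \<partial>lborel)"
    using Em by simp
  also have "\<dots> = (\<integral>\<^sup>+w. (\<Sum>i. indicator (E i) w) \<partial>lborel)"
    using Em by (intro nn_integral_suminf[symmetric]) simp
  also have "\<dots> \<le> (\<integral>\<^sup>+w. ennreal (real m) * indicator (\<pi> ` S) w \<partial>lborel)"
  proof (rule nn_integral_mono)
    fix w :: 'b
    define I where "I = {i. w \<in> E i}"
    have "\<forall>i\<in>I. \<exists>q. q \<in> W i \<and> \<pi> q = w" by (auto simp: I_def E_def)
    from bchoice[OF this] obtain q where q: "\<And>i. i \<in> I \<Longrightarrow> q i \<in> W i \<and> \<pi> (q i) = w" by blast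
    have iq: "inj_on q I"
    proof (rule inj_onI, rule ccontr)
      fix i j assume ij: "i \<in> I" "j \<in> I" "q i = q j" "i \<noteq> j"
      then have "q i \<in> disjointed V i \<inter> disjointed V j" using q[of i] q[of j] by (auto simp: W_def)
      then show False using disjoint_family_disjointed[of V] ij(4) by (auto simp: disjoint_family_on_def)
    qed
    have sub: "q ` I \<subseteq> {q \<in> S \<inter> G. \<pi> q = w}" using q WS V(2) by blast
    have fI: "finite I" using finite_subset[OF sub] fib iq finite_imageD by blast
    have cI: "card I \<le> m"
      using card_mono[OF _ sub] fib[of w] card_image[OF iq] by linarith
    have "(\<Sum>i. indicator (E i) w :: ennreal) = (\<Sum>i\<in>I. indicator (E i) w)"
      by (rule suminf_finite[OF fI]) (auto simp: I_def)
    also have "\<dots> = ennreal (real (card I))" by (simp add: I_def ennreal_of_nat_eq_real_of_nat)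
    also have "\<dots> \<le> ennreal (real m) * indicator (\<pi> ` S) w"
    proof (cases "I = {}")
      case False
      then have "w \<in> \<pi> ` S" using q WS by blast
      then show ?thesis using cI by (simp add: ennreal_leI)
    qed simp
    finally show "(\<Sum>i. indicator (E i) w) \<le> ennreal (real m) * indicator (\<pi> ` S) w" .
  qed
  also have "\<dots> = ennreal (real m) * emeasure lborel (\<pi> ` S)"
    using compact_continuous_image[OF cont S] by (intro nn_integral_cmult_indicator) (simp add: borel_compact)
  finally show ?thesis
    using L by (simp add: mult_left_mono ennreal_mult mult.assoc)
qed simp

section \<open>The surface for t = 0\<close>

lemma norm_vec3_le: "norm (v :: complex^3) \<le> norm (v$1) + norm (v$2) + norm (v$3)"
proof -
  have "norm v \<le> (\<Sum>i\<in>UNIV. norm (v$i))" unfolding norm_vec_def by (rule L2_set_le_sum) simp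
  then show ?thesis by (simp add: sum_3)
qed

lemma dist_vec3_le: "dist (v :: complex^3) w \<le> dist (v$1) (w$1) + dist (v$2) (w$2) + dist (v$3) (w$3)"
  unfolding dist_norm vector_minus_component[symmetric] by (rule norm_vec3_le)

lemma emeasure_lborel_cball_Times:
  fixes a b :: complex
  assumes "0 \<le> r" "0 \<le> s"
  shows "emeasure lborel (cball a r \<times> cball b s) = ennreal (unit_ball_vol 2 ^ 2 * r^2 * s^2)"
proof -
  have "emeasure lborel (cball a r \<times> cball b s) = emeasure (lborel \<Otimes>\<^sub>M lborel) (cball a r \<times> cball b s)"
    by (simp only: lborel_prod)
  also have "\<dots> = emeasure lborel (cball a r) * emeasure lborel (cball b s)"
    by (rule lborel.emeasure_pair_measure_Times) auto
  also have "\<dots> = ennreal (unit_ball_vol 2 * r^2) * ennreal (unit_ball_vol 2 * s^2)"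
    using assms by (simp add: emeasure_cball)
  also have "\<dots> = ennreal ((unit_ball_vol 2 * r^2) * (unit_ball_vol 2 * s^2))"
    by (subst ennreal_mult) auto
  finally show ?thesis by (simp add: power2_eq_square algebra_simps)
qed

section \<open>Divided differences and local graphs\<close>

text \<open>The divided difference \<open>(u^n - w^n) / (u - w)\<close> written as a polynomial, so
  that it is defined and continuous on the diagonal, where it becomes the derivative.\<close>

definition power_quot :: "nat \<Rightarrow> complex \<Rightarrow> complex \<Rightarrow> complex" where
  "power_quot n u w = (\<Sum>i<n. w ^ (n - Suc i) * u ^ i)"

lemma power_quot: "u ^ n - w ^ n = power_quot n u w * (u - w)"
  unfolding power_quot_def by (simp only: power_diff_sumr2 mult.commute)

lemma power_quot_diag: "power_quot n u u = of_nat n * u ^ (n - 1)"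
proof -
  have "power_quot n u u = (\<Sum>i<n. u ^ (n - 1))"
    unfolding power_quot_def by (rule sum.cong) (auto simp: power_add[symmetric])
  then show ?thesis by simp
qed

text \<open>Stands in for the implicit function theorem. \<open>A\<close>, \<open>B\<close>,
  \<open>C\<close> will be divided differences of one equation, so the linear relation between the
  increments is exact. Near \<open>(p, p)\<close> the dominant coefficient stays above
  \<open>m / 2\<close> and the others below \<open>2 * m\<close>, whence the factor 4.\<close>

lemma max_gradient_local_graph:
  fixes A B C :: "'a::topological_space \<times> 'a \<Rightarrow> complex"
  assumes cont: "continuous_on UNIV A" "continuous_on UNIV B" "continuous_on UNIV C"
    and nz: "A (p, p) \<noteq> 0" and max: "norm (B (p, p)) \<le> norm (A (p, p))" "norm (C (p, p)) \<le> norm (A (p, p))"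
  obtains V where "open V" "p \<in> V"
    "\<And>q q' u v w. q \<in> V \<Longrightarrow> q' \<in> V \<Longrightarrow> A (q, q') * u + B (q, q') * v + C (q, q') * w = 0 \<Longrightarrow>
       norm u \<le> 4 * (norm v + norm w)"
proof -
  define m where "m = norm (A (p, p))"
  have m: "0 < m" using nz by (simp add: m_def)
  define W where "W = {z. m / 2 < norm (A z)} \<inter> {z. norm (B z) < 2 * m} \<inter> {z. norm (C z) < 2 * m}"
  have "open W" unfolding W_def
    by (intro open_Int open_Collect_less continuous_on_norm continuous_on_const cont)
  moreover have "(p, p) \<in> W" using m max[folded m_def] by (simp add: W_def m_def[symmetric])
  ultimately obtain V1 V2 where V: "open V1" "open V2" "(p, p) \<in> V1 \<times> V2" "V1 \<times> V2 \<subseteq> W"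
    by (rule open_prod_elim)
  show ?thesis
  proof (rule that[of "V1 \<inter> V2"])
    fix q q' u v w assume q: "q \<in> V1 \<inter> V2" "q' \<in> V1 \<inter> V2"
      and eq: "A (q, q') * u + B (q, q') * v + C (q, q') * w = 0"
    have W: "(q, q') \<in> W" using V(4) q by blast
    have "A (q, q') * u = - (B (q, q') * v + C (q, q') * w)" using eq by (simp add: add_eq_0_iff2 add.assoc)
    then have "norm (A (q, q')) * norm u = norm (B (q, q') * v + C (q, q') * w)"
      by (metis norm_minus_cancel norm_mult)
    also have "\<dots> \<le> norm (B (q, q')) * norm v + norm (C (q, q')) * norm w"
      by (metis norm_mult norm_triangle_ineq)
    also have "\<dots> \<le> 2 * m * norm v + 2 * m * norm w"
      using W by (intro add_mono mult_right_mono) (auto simp: W_def)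
    finally have "norm (A (q, q')) * norm u \<le> 2 * m * (norm v + norm w)" by (simp add: algebra_simps)
    moreover have "m / 2 * norm u \<le> norm (A (q, q')) * norm u"
      using W by (intro mult_right_mono) (auto simp: W_def)
    ultimately have "m * norm u \<le> m * (4 * (norm v + norm w))" by (simp add: algebra_simps)
    then show "norm u \<le> 4 * (norm v + norm w)" using m by simp
  qed (use V in auto)
qed

lemma card_fibre_le_of_poly:
  fixes P :: "complex poly"
  assumes "P \<noteq> 0" "degree P \<le> m" "inj_on g S" "\<And>q. q \<in> S \<Longrightarrow> poly P (g q) = 0"
  shows "finite S \<and> card S \<le> m"
proof -
  have sub: "g ` S \<subseteq> {x. poly P x = 0}" using assms(4) by auto
  have fin: "finite {x. poly P x = 0}" using assms(1) by (rule poly_roots_finite)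
  have "finite S" using finite_imageD[OF finite_subset[OF sub fin] assms(3)] .
  moreover have "card S = card (g ` S)" using assms(3) by (simp add: card_image)
  moreover have "card (g ` S) \<le> card {x. poly P x = 0}" using sub fin by (intro card_mono)
  moreover have "card {x. poly P x = 0} \<le> degree P" using assms(1) by (rule card_poly_roots_bound)
  ultimately show ?thesis using assms(2) by linarith
qed

text \<open>The defining polynomial has 0 as its only critical point, so elsewhere the surface is a
  Lipschitz graph in the direction of its largest partial derivative. The slope 4 bounds the full
  increment by 5 times the sum of two coordinate increments, hence by 10 times their distance in the
  product.\<close>

lemma X0_local_graph:
  assumes p: "p \<in> Xt 0" "p \<noteq> 0"
  obtains V where "open V" "p \<in> V"
    "(\<forall>q\<in>Xt 0 \<inter> V. \<forall>q'\<in>Xt 0 \<inter> V. dist q q' \<le> 10 * dist (q$2, q$3) (q'$2, q'$3)) \<or>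
     V \<subseteq> {v. v$3 \<noteq> 0} \<and>
       (\<forall>q\<in>Xt 0 \<inter> V. \<forall>q'\<in>Xt 0 \<inter> V. dist q q' \<le> 10 * dist (q$1, q$3) (q'$1, q'$3)) \<or>
     (\<forall>q\<in>Xt 0 \<inter> V. \<forall>q'\<in>Xt 0 \<inter> V. dist q q' \<le> 10 * dist (q$1, q$2) (q'$1, q'$2))"
proof -
  \<comment> \<open>The difference of the equations at two points is telescoped one variable at a
    time. This is why \<open>B\<close> takes the \<open>z\<close> of the first point and
    \<open>C\<close> the \<open>y\<close> of the second.\<close>
  define A :: "(complex^3) \<times> (complex^3) \<Rightarrow> complex" where "A z = power_quot 5 (fst z $ 1) (snd z $ 1)" for z
  define B :: "(complex^3) \<times> (complex^3) \<Rightarrow> complex" where "B z = power_quot 7 (fst z $ 2) (snd z $ 2) * fst z $ 3" for z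
  define C :: "(complex^3) \<times> (complex^3) \<Rightarrow> complex" where "C z = power_quot 15 (fst z $ 3) (snd z $ 3) + (snd z $ 2)^7" for z
  have cont: "continuous_on UNIV A" "continuous_on UNIV B" "continuous_on UNIV C"
    unfolding A_def B_def C_def power_quot_def by (intro continuous_intros)+
  have eq: "A (q, q') * (q$1 - q'$1) + B (q, q') * (q$2 - q'$2) + C (q, q') * (q$3 - q'$3) = 0"
    if "q \<in> Xt 0" "q' \<in> Xt 0" for q q'
  proof -
    have "A (q, q') * (q$1 - q'$1) + B (q, q') * (q$2 - q'$2) + C (q, q') * (q$3 - q'$3)
      = power_quot 5 (q$1) (q'$1) * (q$1 - q'$1) + power_quot 7 (q$2) (q'$2) * (q$2 - q'$2) * q$3
        + (power_quot 15 (q$3) (q'$3) * (q$3 - q'$3) + (q'$2)^7 * (q$3 - q'$3))"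
      unfolding A_def B_def C_def fst_conv snd_conv by (simp only: algebra_simps)
    also have "\<dots> = ((q$1)^5 + (q$3)^15 + (q$2)^7 * q$3) - ((q'$1)^5 + (q'$3)^15 + (q'$2)^7 * q'$3)"
      unfolding power_quot[symmetric] by (simp add: algebra_simps)
    also have "\<dots> = 0" using that by (simp add: Xt_def)
    finally show ?thesis .
  qed
  have d: "dist q q' \<le> 10 * dist (q$i, q$j) (q'$i, q'$j)"
    if "norm (q$k - q'$k) \<le> 4 * (norm (q$i - q'$i) + norm (q$j - q'$j))"
       "{k, i, j} = {1, 2, 3}" "k \<noteq> i" "k \<noteq> j" "i \<noteq> j" for q q' :: "complex^3" and i j k :: 3
  proof -
    have "dist q q' \<le> norm (q$1 - q'$1) + norm (q$2 - q'$2) + norm (q$3 - q'$3)"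
      using dist_vec3_le[of q q'] by (simp add: dist_norm)
    also have "\<dots> = (\<Sum>l\<in>{1,2,3}. norm (q$l - q'$l))" by simp
    also have "\<dots> = (\<Sum>l\<in>{k,i,j}. norm (q$l - q'$l))" using that(2) by simp
    also have "\<dots> = norm (q$k - q'$k) + norm (q$i - q'$i) + norm (q$j - q'$j)" using that(3-5) by simp
    also have "\<dots> \<le> 5 * (norm (q$i - q'$i) + norm (q$j - q'$j))" using that(1) by simp
    also have "\<dots> \<le> 10 * dist (q$i, q$j) (q'$i, q'$j)"
      using dist_fst_le[of "(q$i, q$j)" "(q'$i, q'$j)"] dist_snd_le[of "(q$i, q$j)" "(q'$i, q'$j)"]
      by (simp add: dist_norm)
    finally show ?thesis .
  qed
  have diag: "A (p, p) = 5 * (p$1)^4" "B (p, p) = 7 * (p$2)^6 * p$3" "C (p, p) = 15 * (p$3)^14 + (p$2)^7"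
    by (simp_all add: A_def B_def C_def power_quot_diag)
  have nz: "A (p, p) \<noteq> 0 \<or> B (p, p) \<noteq> 0 \<or> C (p, p) \<noteq> 0"
  proof (rule ccontr)
    assume "\<not> ?thesis"
    then have z: "p$1 = 0" "p$2 = 0 \<or> p$3 = 0" "15 * (p$3)^14 + (p$2)^7 = 0" unfolding diag by auto
    then have "p$2 = 0" "p$3 = 0" by auto
    then have "p = 0" using z(1) by (simp add: vec_eq_iff forall_3)
    then show False using p by simp
  qed
  define a b c where "a = norm (A (p, p))" and "b = norm (B (p, p))" and "c = norm (C (p, p))"
  have abc: "0 \<le> a" "0 \<le> b" "0 \<le> c" "a \<noteq> 0 \<or> b \<noteq> 0 \<or> c \<noteq> 0" using nz by (auto simp: a_def b_def c_def)
  then have "(b \<le> a \<and> c \<le> a \<and> a \<noteq> 0) \<or> (a \<le> b \<and> c \<le> b \<and> b \<noteq> 0) \<or> (a \<le> c \<and> b \<le> c \<and> c \<noteq> 0)"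
    by linarith
  then consider "b \<le> a" "c \<le> a" "a \<noteq> 0" | "a \<le> b" "c \<le> b" "b \<noteq> 0" | "a \<le> c" "b \<le> c" "c \<noteq> 0" by blast
  then show ?thesis
  proof cases
    case 1
    then have h: "A (p, p) \<noteq> 0" "norm (B (p, p)) \<le> norm (A (p, p))" "norm (C (p, p)) \<le> norm (A (p, p))"
      by (auto simp: a_def b_def c_def)
    obtain V where V: "open V" "p \<in> V"
      "\<And>q q' u v w. q \<in> V \<Longrightarrow> q' \<in> V \<Longrightarrow> A (q, q') * u + B (q, q') * v + C (q, q') * w = 0 \<Longrightarrow>
       norm u \<le> 4 * (norm v + norm w)"
      by (rule max_gradient_local_graph[OF cont(1,2,3) h]) (rule that, assumption+)
    have "dist q q' \<le> 10 * dist (q$2, q$3) (q'$2, q'$3)" if "q \<in> Xt 0 \<inter> V" "q' \<in> Xt 0 \<inter> V" for q q'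
    proof (rule d[where k = 1])
      show "norm (q$1 - q'$1) \<le> 4 * (norm (q$2 - q'$2) + norm (q$3 - q'$3))"
        using eq[of q q'] that by (intro V(3)[of q q']) auto
    qed auto
    then show ?thesis using that[OF V(1,2)] by blast
  next
    case 2
    then have h: "B (p, p) \<noteq> 0" "norm (A (p, p)) \<le> norm (B (p, p))" "norm (C (p, p)) \<le> norm (B (p, p))"
      by (auto simp: a_def b_def c_def)
    obtain V where V: "open V" "p \<in> V"
      "\<And>q q' u v w. q \<in> V \<Longrightarrow> q' \<in> V \<Longrightarrow> B (q, q') * u + A (q, q') * v + C (q, q') * w = 0 \<Longrightarrow>
       norm u \<le> 4 * (norm v + norm w)"
      by (rule max_gradient_local_graph[OF cont(2,1,3) h]) (rule that, assumption+)
    \<comment> \<open>The surface contains the whole \<open>y\<close>-axis, over which the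
      projection to \<open>(x, z)\<close> has an infinite fibre. The derivative in \<open>y\<close>
      has the factor \<open>z\<close>, so this case stays off that axis.\<close>
    have "p$3 \<noteq> 0" using 2(3) unfolding b_def diag by auto
    have o: "open {v :: complex^3. v$3 \<noteq> 0}" by (intro open_Collect_neq continuous_intros)
    have "dist q q' \<le> 10 * dist (q$1, q$3) (q'$1, q'$3)"
      if "q \<in> Xt 0 \<inter> (V \<inter> {v. v$3 \<noteq> 0})" "q' \<in> Xt 0 \<inter> (V \<inter> {v. v$3 \<noteq> 0})" for q q'
    proof (rule d[where k = 2])
      show "norm (q$2 - q'$2) \<le> 4 * (norm (q$1 - q'$1) + norm (q$3 - q'$3))"
        using eq[of q q'] that by (intro V(3)[of q q']) (auto simp: ac_simps)
    qed auto
    then show ?thesis using that[OF open_Int[OF V(1) o]] V(2) \<open>p$3 \<noteq> 0\<close> by blast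
  next
    case 3
    then have h: "C (p, p) \<noteq> 0" "norm (A (p, p)) \<le> norm (C (p, p))" "norm (B (p, p)) \<le> norm (C (p, p))"
      by (auto simp: a_def b_def c_def)
    obtain V where V: "open V" "p \<in> V"
      "\<And>q q' u v w. q \<in> V \<Longrightarrow> q' \<in> V \<Longrightarrow> C (q, q') * u + A (q, q') * v + B (q, q') * w = 0 \<Longrightarrow>
       norm u \<le> 4 * (norm v + norm w)"
      by (rule max_gradient_local_graph[OF cont(3,1,2) h]) (rule that, assumption+)
    have "dist q q' \<le> 10 * dist (q$1, q$2) (q'$1, q'$2)" if "q \<in> Xt 0 \<inter> V" "q' \<in> Xt 0 \<inter> V" for q q'
    proof (rule d[where k = 3])
      show "norm (q$3 - q'$3) \<le> 4 * (norm (q$1 - q'$1) + norm (q$2 - q'$2))"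
        using eq[of q q'] that by (intro V(3)[of q q']) (auto simp: ac_simps)
    qed auto
    then show ?thesis using that[OF V(1,2)] by blast
  qed
qed

lemma closed_Xt: "closed (Xt t)"
  unfolding Xt_def by (intro closed_Collect_eq continuous_intros)

section \<open>The part of the surface near the coordinate hyperplanes\<close>

text \<open>Each of the three coordinate shadows lies in products of discs of radii
  \<open>\<eta> * \<epsilon>\<close> and \<open>\<epsilon>\<close>: either \<open>y\<close> or
  \<open>z\<close> is small by assumption, and \<open>x\<close> is small because \<open>x^5\<close>
  has order at least 8 in \<open>\<epsilon>\<close>. The fibres are root sets of polynomials of
  degree 5, 7 and 15.\<close>

lemma X0_thin_part_area:
  obtains C where "0 < C"
    "\<And>\<eta>. 0 < \<eta> \<Longrightarrow> \<eta> < 1 \<Longrightarrow> \<exists>\<epsilon>0>0. \<forall>\<epsilon>. 0 < \<epsilon> \<and> \<epsilon> < \<epsilon>0 \<longrightarrow>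
       hausdorff_measure 4 (Xt 0 \<inter> cball 0 \<epsilon> \<inter> {v. norm (v$2) \<le> \<eta> * \<epsilon> \<or> norm (v$3) \<le> \<eta> * \<epsilon>})
         \<le> ennreal (C * \<eta>^2 * \<epsilon>^4)"
proof -
  define U where "U = unit_ball_vol 2 ^ 2"
  have U: "0 < U" unfolding U_def by (intro zero_less_power unit_ball_vol_pos) simp
  \<comment> \<open>\<open>50 = 5 * 10\<close> combines the covering factor with the graph constant,
    15 is the largest fibre degree, and \<open>2 * U\<close> comes from two products of
    discs.\<close>
  define D where "D = 50 ^ 4 * 15 * (2 * U)"
  have D: "0 < D" using U by (simp add: D_def)
  show ?thesis
  proof (rule that[of "3 * D"])
    show "0 < 3 * D" using D by simp
    fix \<eta> :: real assume \<eta>: "0 < \<eta>" "\<eta> < 1"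
    show "\<exists>\<epsilon>0>0. \<forall>\<epsilon>. 0 < \<epsilon> \<and> \<epsilon> < \<epsilon>0 \<longrightarrow>
       hausdorff_measure 4 (Xt 0 \<inter> cball 0 \<epsilon> \<inter> {v. norm (v$2) \<le> \<eta> * \<epsilon> \<or> norm (v$3) \<le> \<eta> * \<epsilon>})
         \<le> ennreal (3 * D * \<eta>^2 * \<epsilon>^4)"
    \<comment> \<open>On the surface \<open>norm (v$1) ^ 5 \<le> 2 * \<epsilon>^6\<close>, which is
      at most \<open>(\<eta> * \<epsilon>)^5\<close> as soon as
      \<open>\<epsilon> \<le> \<eta>^5 / 2\<close>.\<close>
    proof (intro exI[of _ "min 1 (\<eta>^5 / 2)"] conjI allI impI)
      show "0 < min 1 (\<eta>^5 / 2)" using \<eta> by simp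
      fix \<epsilon> assume e: "0 < \<epsilon> \<and> \<epsilon> < min 1 (\<eta>^5 / 2)"
      define S where "S = Xt 0 \<inter> cball 0 \<epsilon> \<inter> {v. norm (v$2) \<le> \<eta> * \<epsilon> \<or> norm (v$3) \<le> \<eta> * \<epsilon>}"
      have "closed {v :: complex^3. norm (v$2) \<le> \<eta> * \<epsilon> \<or> norm (v$3) \<le> \<eta> * \<epsilon>}"
        by (intro closed_Collect_disj closed_Collect_le continuous_intros)
      then have S: "compact S" unfolding S_def
        by (intro compact_Int_closed closed_Int_compact closed_Xt) auto
      have comp: "norm (v$i) \<le> \<epsilon>" if "v \<in> S" for v i
        using that Finite_Cartesian_Product.norm_nth_le[of v i] by (simp add: S_def)
      have x: "norm (v$1) \<le> \<eta> * \<epsilon>" if v: "v \<in> S" for v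
      proof -
        have "(v$1)^5 + ((v$3)^15 + (v$2)^7 * v$3) = 0" using v by (simp add: S_def Xt_def add.assoc)
        then have "(v$1)^5 = - ((v$3)^15 + (v$2)^7 * v$3)" by (simp only: eq_neg_iff_add_eq_0)
        then have "norm (v$1) ^ 5 = norm ((v$3)^15 + (v$2)^7 * v$3)" by (metis norm_minus_cancel norm_power)
        also have "\<dots> \<le> norm (v$3) ^ 15 + norm (v$2) ^ 7 * norm (v$3)"
          by (metis norm_mult norm_power norm_triangle_ineq)
        also have "\<dots> \<le> \<epsilon> ^ 15 + \<epsilon> ^ 7 * \<epsilon>"
          using comp[OF v] e by (intro add_mono power_mono mult_mono) auto
        also have "\<dots> \<le> \<epsilon> ^ 6 + \<epsilon> ^ 6"
          using e by (intro add_mono power_decreasing) (auto simp: power_Suc2[symmetric] simp del: power_Suc intro!: power_decreasing)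
        also have "\<dots> = (2 * \<epsilon>) * \<epsilon> ^ 5" by (simp add: eval_nat_numeral)
        also have "\<dots> \<le> \<eta> ^ 5 * \<epsilon> ^ 5" using e by (intro mult_right_mono) auto
        finally have "norm (v$1) ^ 5 \<le> (\<eta> * \<epsilon>) ^ 5" by (simp add: power_mult_distrib)
        then show ?thesis using \<eta> e by (meson less_imp_le mult_pos_pos power_mono_iff norm_ge_zero zero_less_numeral)
      qed
      define T :: "(complex^3 \<Rightarrow> complex \<times> complex) \<Rightarrow> (complex^3) set \<Rightarrow> (complex^3) set" where
        "T \<pi> G = {p \<in> S. \<exists>V. open V \<and> p \<in> V \<and> V \<subseteq> G \<and>
           (\<forall>q\<in>Xt 0 \<inter> V. \<forall>q'\<in>Xt 0 \<inter> V. dist q q' \<le> 10 * dist (\<pi> q) (\<pi> q'))}" for \<pi> G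
      have bnd: "hausdorff_measure 4 (T \<pi> G) \<le> ennreal (D * \<eta>^2 * \<epsilon>^4)"
        if cont: "continuous_on S \<pi>" and
          fib: "\<And>w. finite {q \<in> S \<inter> G. \<pi> q = w} \<and> card {q \<in> S \<inter> G. \<pi> q = w} \<le> 15" and
          im: "\<pi> ` S \<subseteq> cball 0 (\<eta> * \<epsilon>) \<times> cball 0 \<epsilon> \<union> cball 0 \<epsilon> \<times> cball 0 (\<eta> * \<epsilon>)"
        for \<pi> :: "complex^3 \<Rightarrow> complex \<times> complex" and G
      proof -
        have loc: "\<exists>V. open V \<and> p \<in> V \<and> V \<subseteq> G \<and>
                (\<forall>q\<in>S \<inter> V. \<forall>q'\<in>S \<inter> V. dist q q' \<le> 10 * dist (\<pi> q) (\<pi> q'))" if "p \<in> T \<pi> G" for p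
        proof -
          obtain V where "open V" "p \<in> V" "V \<subseteq> G"
            and V: "\<forall>q\<in>Xt 0 \<inter> V. \<forall>q'\<in>Xt 0 \<inter> V. dist q q' \<le> 10 * dist (\<pi> q) (\<pi> q')"
            using \<open>p \<in> T \<pi> G\<close> unfolding T_def mem_Collect_eq by (elim conjE exE)
          moreover have "S \<inter> V \<subseteq> Xt 0 \<inter> V" by (auto simp: S_def)
          then have "\<forall>q\<in>S \<inter> V. \<forall>q'\<in>S \<inter> V. dist q q' \<le> 10 * dist (\<pi> q) (\<pi> q')"
            using V by (meson subsetD)
          ultimately show ?thesis by (intro exI[of _ V] conjI)
        qed
        have TS: "T \<pi> G \<subseteq> S" by (auto simp: T_def)
        have "hausdorff_measure (real DIM(complex \<times> complex)) (T \<pi> G)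
           \<le> ennreal ((5 * 10) ^ DIM(complex \<times> complex) * real 15) * emeasure lborel (\<pi> ` S)"
          by (rule hausdorff_measure_le_multiplicity[OF S cont _ TS loc fib]) simp_all
        then have "hausdorff_measure 4 (T \<pi> G) \<le> ennreal (50 ^ 4 * 15) * emeasure lborel (\<pi> ` S)" by simp
        also have "emeasure lborel (\<pi> ` S) \<le> emeasure lborel (cball (0::complex) (\<eta> * \<epsilon>) \<times> cball (0::complex) \<epsilon> \<union> cball 0 \<epsilon> \<times> cball 0 (\<eta> * \<epsilon>))"
          using im by (intro emeasure_mono) (auto intro!: sets.Un borel_closed closed_Times)
        also have "\<dots> \<le> emeasure lborel (cball (0::complex) (\<eta> * \<epsilon>) \<times> cball (0::complex) \<epsilon>) + emeasure lborel (cball (0::complex) \<epsilon> \<times> cball (0::complex) (\<eta> * \<epsilon>))"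
          by (intro emeasure_subadditive) (auto intro!: borel_closed closed_Times)
        also have "\<dots> = ennreal (U * (\<eta> * \<epsilon>)^2 * \<epsilon>^2) + ennreal (U * \<epsilon>^2 * (\<eta> * \<epsilon>)^2)"
          using \<eta> e unfolding U_def by (subst (1 2) emeasure_lborel_cball_Times) auto
        also have "\<dots> = ennreal (2 * U * \<eta>^2 * \<epsilon>^4)"
        proof -
          have "U * (\<eta> * \<epsilon>)^2 * \<epsilon>^2 + U * \<epsilon>^2 * (\<eta> * \<epsilon>)^2 = 2 * U * \<eta>^2 * \<epsilon>^4"
            by (simp add: power_mult_distrib eval_nat_numeral algebra_simps)
          then show ?thesis using U by (simp add: ennreal_plus[symmetric] del: ennreal_plus)
        qed
        also have "ennreal (50 ^ 4 * 15) * ennreal (2 * U * \<eta>^2 * \<epsilon>^4) = ennreal (D * \<eta>^2 * \<epsilon>^4)"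
          by (subst ennreal_mult'[symmetric]) (auto simp: D_def mult.assoc)
        finally show ?thesis by (simp add: mult_left_mono)
      qed
      define T1 where "T1 = T (\<lambda>q. (q$2, q$3)) UNIV"
      define T2 where "T2 = T (\<lambda>q. (q$1, q$3)) {v. v$3 \<noteq> 0}"
      define T3 where "T3 = T (\<lambda>q. (q$1, q$2)) UNIV"
      have cover: "S \<subseteq> {0} \<union> (T1 \<union> (T2 \<union> T3))"
      proof
        fix p assume p: "p \<in> S"
        show "p \<in> {0} \<union> (T1 \<union> (T2 \<union> T3))"
        proof (cases "p = 0")
          case False
          have "p \<in> Xt 0" using p by (simp add: S_def)
          then obtain V where V: "open V" "p \<in> V" and
            "(\<forall>q\<in>Xt 0 \<inter> V. \<forall>q'\<in>Xt 0 \<inter> V. dist q q' \<le> 10 * dist (q$2, q$3) (q'$2, q'$3)) \<or>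
             V \<subseteq> {v. v$3 \<noteq> 0} \<and>
             (\<forall>q\<in>Xt 0 \<inter> V. \<forall>q'\<in>Xt 0 \<inter> V. dist q q' \<le> 10 * dist (q$1, q$3) (q'$1, q'$3)) \<or>
             (\<forall>q\<in>Xt 0 \<inter> V. \<forall>q'\<in>Xt 0 \<inter> V. dist q q' \<le> 10 * dist (q$1, q$2) (q'$1, q'$2))"
            (is "?L1 \<or> ?L2 \<or> ?L3")
            by (rule X0_local_graph[OF _ False]) (rule that, assumption+)
          then have "p \<in> T1 \<or> p \<in> T2 \<or> p \<in> T3"
          proof (elim disjE)
            assume ?L1 then show ?thesis using p V unfolding T1_def T_def by (intro disjI1 CollectI conjI exI[of _ V]) auto
          next
            assume ?L2 then show ?thesis using p V unfolding T2_def T_def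
              by (intro disjI2[OF disjI1] CollectI conjI exI[of _ V]) auto
          next
            assume ?L3 then show ?thesis using p V unfolding T3_def T_def
              by (intro disjI2[OF disjI2] CollectI conjI exI[of _ V]) auto
          qed
          then show ?thesis by blast
        qed simp
      qed
      have "hausdorff_measure 4 T1 \<le> ennreal (D * \<eta>^2 * \<epsilon>^4)"
      unfolding T1_def
      proof (rule bnd[where \<pi> = "\<lambda>q. (q$2, q$3)" and G = UNIV])
        show "continuous_on S (\<lambda>q. (q$2, q$3))" by (intro continuous_intros)
        show "(\<lambda>q. (q$2, q$3)) ` S \<subseteq> cball 0 (\<eta> * \<epsilon>) \<times> cball 0 \<epsilon> \<union> cball 0 \<epsilon> \<times> cball 0 (\<eta> * \<epsilon>)"
          using comp by (auto simp: S_def[symmetric]) (auto simp: S_def)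
        fix w :: "complex \<times> complex"
        let ?P = "monom 1 5 + [:(snd w)^15 + (fst w)^7 * snd w:] :: complex poly"
        have "coeff ?P 5 = 1" by (simp add: coeff_pCons split: nat.split)
        then have "?P \<noteq> 0" by (metis coeff_0 zero_neq_one)
        moreover have "degree ?P \<le> 15" by (intro degree_add_le) (auto simp: degree_monom_eq)
        ultimately show "finite {q \<in> S \<inter> UNIV. (q$2, q$3) = w} \<and> card {q \<in> S \<inter> UNIV. (q$2, q$3) = w} \<le> 15"
          by (rule card_fibre_le_of_poly[where g = "\<lambda>q. q$1"])
             (auto simp: inj_on_def vec_eq_iff forall_3 S_def Xt_def poly_monom add.assoc)
      qed
      moreover have "hausdorff_measure 4 T2 \<le> ennreal (D * \<eta>^2 * \<epsilon>^4)"
      unfolding T2_def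
      proof (rule bnd[where \<pi> = "\<lambda>q. (q$1, q$3)" and G = "{v. v$3 \<noteq> 0}"])
        show "continuous_on S (\<lambda>q. (q$1, q$3))" by (intro continuous_intros)
        show "(\<lambda>q. (q$1, q$3)) ` S \<subseteq> cball 0 (\<eta> * \<epsilon>) \<times> cball 0 \<epsilon> \<union> cball 0 \<epsilon> \<times> cball 0 (\<eta> * \<epsilon>)"
          using comp x by auto
        fix w :: "complex \<times> complex"
        let ?P = "smult (snd w) (monom 1 7) + [:(fst w)^5 + (snd w)^15:] :: complex poly"
        show "finite {q \<in> S \<inter> {v. v$3 \<noteq> 0}. (q$1, q$3) = w} \<and> card {q \<in> S \<inter> {v. v$3 \<noteq> 0}. (q$1, q$3) = w} \<le> 15"
        proof (cases "snd w = 0")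
          case True
          then have "{q \<in> S \<inter> {v. v$3 \<noteq> 0}. (q$1, q$3) = w} = {}" by auto
          then show ?thesis by (simp only: finite.emptyI card.empty) simp
        next
          case False
          have "coeff ?P 7 = snd w" by (simp add: coeff_pCons split: nat.split)
          then have "?P \<noteq> 0" using False by (metis coeff_0)
          moreover have "degree ?P \<le> 15"
            by (intro degree_add_le order_trans[OF degree_smult_le]) (auto simp: degree_monom_eq)
          ultimately show ?thesis
            by (rule card_fibre_le_of_poly[where g = "\<lambda>q. q$2"])
               (auto simp: inj_on_def vec_eq_iff forall_3 S_def Xt_def poly_monom algebra_simps)
        qed
      qed
      moreover have "hausdorff_measure 4 T3 \<le> ennreal (D * \<eta>^2 * \<epsilon>^4)"
      unfolding T3_def
      proof (rule bnd[where \<pi> = "\<lambda>q. (q$1, q$2)" and G = UNIV])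
        show "continuous_on S (\<lambda>q. (q$1, q$2))" by (intro continuous_intros)
        show "(\<lambda>q. (q$1, q$2)) ` S \<subseteq> cball 0 (\<eta> * \<epsilon>) \<times> cball 0 \<epsilon> \<union> cball 0 \<epsilon> \<times> cball 0 (\<eta> * \<epsilon>)"
          using comp x by auto
        fix w :: "complex \<times> complex"
        let ?P = "monom 1 15 + [:(fst w)^5, (snd w)^7:] :: complex poly"
        have "coeff ?P 15 = 1" by (simp add: coeff_pCons split: nat.split)
        then have "?P \<noteq> 0" by (metis coeff_0 zero_neq_one)
        moreover have "degree ?P \<le> 15" by (intro degree_add_le) (auto simp: degree_monom_eq)
        ultimately show "finite {q \<in> S \<inter> UNIV. (q$1, q$2) = w} \<and> card {q \<in> S \<inter> UNIV. (q$1, q$2) = w} \<le> 15"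
          by (rule card_fibre_le_of_poly[where g = "\<lambda>q. q$3"])
             (auto simp: inj_on_def vec_eq_iff forall_3 S_def Xt_def poly_monom algebra_simps)
      qed
      moreover have "hausdorff_measure 4 S \<le> hausdorff_measure 4 {0 :: complex^3} + (hausdorff_measure 4 T1 + (hausdorff_measure 4 T2 + hausdorff_measure 4 T3))"
      proof -
        have "hausdorff_measure 4 S \<le> hausdorff_measure 4 ({0} \<union> (T1 \<union> (T2 \<union> T3)))"
          by (rule hausdorff_measure_mono[OF cover])
        also have "\<dots> \<le> hausdorff_measure 4 {0 :: complex^3} + hausdorff_measure 4 (T1 \<union> (T2 \<union> T3))"
          by (rule hausdorff_measure_Un)
        also have "hausdorff_measure 4 (T1 \<union> (T2 \<union> T3)) \<le> hausdorff_measure 4 T1 + hausdorff_measure 4 (T2 \<union> T3)"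
          by (rule hausdorff_measure_Un)
        also have "hausdorff_measure 4 (T2 \<union> T3) \<le> hausdorff_measure 4 T2 + hausdorff_measure 4 T3"
          by (rule hausdorff_measure_Un)
        finally show ?thesis by (simp add: add_left_mono)
      qed
      ultimately have "hausdorff_measure 4 S \<le> 0 + (ennreal (D * \<eta>^2 * \<epsilon>^4) + (ennreal (D * \<eta>^2 * \<epsilon>^4) + ennreal (D * \<eta>^2 * \<epsilon>^4)))"
        by (elim order_trans) (auto intro!: add_mono simp: hausdorff_measure_singleton)
      also have "\<dots> = ennreal (3 * D * \<eta>^2 * \<epsilon>^4)"
        using D by (simp add: ennreal_plus[symmetric] del: ennreal_plus)
      finally show "hausdorff_measure 4 (Xt 0 \<inter> cball 0 \<epsilon> \<inter> {v. norm (v$2) \<le> \<eta> * \<epsilon> \<or> norm (v$3) \<le> \<eta> * \<epsilon>})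
         \<le> ennreal (3 * D * \<eta>^2 * \<epsilon>^4)" unfolding S_def .
    qed
  qed
qed

section \<open>Logarithmic coordinates\<close>

lemma norm_exp_diff_le:
  fixes a b :: complex
  assumes "Re a \<le> M" "Re b \<le> M"
  shows "norm (exp a - exp b) \<le> exp M * norm (a - b)"
proof (rule field_differentiable_bound[of "{z. Re z \<le> M}"])
  show "convex {z. Re z \<le> M}" by (rule convex_halfspace_Re_le)
  show "(exp has_field_derivative exp z) (at z within {z. Re z \<le> M})" for z
    by (rule has_field_derivative_at_within) (rule DERIV_exp)
qed (use assms in auto)

lemma norm_Ln_diff_le:
  assumes "norm u \<le> 1/2" "norm v \<le> 1/2"
  shows "norm (Ln (1 + u) - Ln (1 + v)) \<le> 2 * norm (u - v)"
proof (rule field_differentiable_bound[of "cball 0 (1/2)" "\<lambda>u. Ln (1 + u)" "\<lambda>u. inverse (1 + u)"])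
  fix z :: complex assume "z \<in> cball 0 (1/2)"
  then have z: "norm z \<le> 1/2" by simp
  then have "\<bar>Re z\<bar> \<le> 1/2" using abs_Re_le_cmod[of z] by linarith
  then have re: "0 < Re (1 + z)" by simp
  then have "1 + z \<notin> \<real>\<^sub>\<le>\<^sub>0" by (auto simp: complex_nonpos_Reals_iff)
  then show "((\<lambda>u. Ln (1 + u)) has_field_derivative inverse (1 + z)) (at z within cball 0 (1/2))"
    by (auto intro!: derivative_eq_intros)
  have "1/2 \<le> norm (1 + z)" using norm_triangle_ineq2[of 1 "-z"] z by simp
  then have "inverse (norm (1 + z)) \<le> inverse (1/2)" by (intro le_imp_inverse_le) auto
  then show "norm (inverse (1 + z)) \<le> 2" by (simp add: norm_inverse)
qed (use assms in auto)

text \<open>Near 1 the principal logarithm inverts \<open>exp\<close> and is 2-Lipschitz; away from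
  1 the bound is trivial. The restriction on \<open>d\<close> excludes the period
  \<open>2 * pi * \<i>\<close>.\<close>

lemma norm_le_norm_exp_minus_one:
  fixes d :: complex
  assumes "norm d \<le> 1"
  shows "norm d \<le> 2 * norm (exp d - 1)"
proof (cases "norm (exp d - 1) \<le> 1/2")
  case True
  have "\<bar>Im d\<bar> \<le> 1" using assms abs_Im_le_cmod[of d] by linarith
  then have "- pi < Im d" "Im d \<le> pi" using pi_gt3 by linarith+
  then have "Ln (1 + (exp d - 1)) = d" by simp
  then show ?thesis using norm_Ln_diff_le[OF True, of 0] by simp
next
  case False then show ?thesis using assms by linarith
qed

text \<open>With \<open>y = \<epsilon> * exp c1\<close> and \<open>z = \<epsilon> * exp c2\<close>
  the equation becomes \<open>x^5 = - \<epsilon>^8 * exp (7 * c1 + c2) * (1 + u)\<close> with small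
  \<open>u\<close>, and a fifth root can be read off the exponent. The second factor of
  \<open>K\<close> is long enough for \<open>z\<close> to wind around 0 until all five roots have
  appeared; this is how a single convex box reaches every sheet.\<close>

lemma X0_log_parametrization:
  assumes \<eta>: "0 < \<eta>" "\<eta> < 1"
  defines "K \<equiv> cbox (Complex (ln \<eta>) (- pi)) (Complex 0 pi) \<times> cbox (Complex (ln \<eta>) (- pi)) (Complex 0 (10 * pi))"
  assumes \<epsilon>: "0 < \<epsilon>" "\<epsilon> \<le> \<eta> / 2"
  obtains \<Phi> :: "complex \<times> complex \<Rightarrow> complex^3" where
    "(20 * \<epsilon>)-lipschitz_on K \<Phi>"
    "\<Phi> ` K \<subseteq> Xt 0 \<inter> cball 0 (5 * \<epsilon>)"
    "Xt 0 \<inter> cball 0 \<epsilon> \<inter> {v. \<eta> * \<epsilon> \<le> norm (v$2) \<and> \<eta> * \<epsilon> \<le> norm (v$3)} \<subseteq> \<Phi> ` K"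
    "\<And>a b. a \<in> K \<Longrightarrow> b \<in> K \<Longrightarrow> dist a b \<le> 1 \<Longrightarrow> dist a b \<le> 4 / (\<eta> * \<epsilon>) * dist (\<Phi> a) (\<Phi> b)"
proof -
  \<comment> \<open>The natural size of \<open>x\<close>, since \<open>y^7 * z\<close> has size
    \<open>\<epsilon>^8\<close>; it is at most \<open>\<epsilon>\<close>.\<close>
  define \<kappa> where "\<kappa> = root 5 (\<epsilon> ^ 8)"
  have \<kappa>: "0 < \<kappa>" "\<kappa> ^ 5 = \<epsilon> ^ 8" using \<epsilon> by (auto simp: \<kappa>_def)
  have e1: "\<epsilon> \<le> 1" using \<epsilon> \<eta> by simp
  have "\<kappa> ^ 5 \<le> \<epsilon> ^ 5" unfolding \<kappa>(2) using \<epsilon> e1 by (intro power_decreasing) auto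
  then have \<kappa>e: "\<kappa> \<le> \<epsilon>" using \<kappa>(1) \<epsilon> by (meson less_imp_le power_mono_iff zero_less_numeral)
  \<comment> \<open>This is \<open>z^14 / y^7\<close> in the new coordinates. On \<open>K\<close>
    its modulus is at most \<open>(\<epsilon> / \<eta>)^7\<close>, so \<open>1 + u\<close> stays
    away from the cut of \<open>Ln\<close>.\<close>
  define u :: "complex \<times> complex \<Rightarrow> complex" where "u w = of_real \<epsilon> ^ 7 * exp (14 * snd w - 7 * fst w)" for w
  define g :: "complex \<times> complex \<Rightarrow> complex" where "g w = (7 * fst w + snd w + Ln (1 + u w)) / 5" for w
  define \<Phi> :: "complex \<times> complex \<Rightarrow> complex^3" where
    "\<Phi> w = vector [- (of_real \<kappa> * exp (g w)), of_real \<epsilon> * exp (fst w), of_real \<epsilon> * exp (snd w)]" for w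
  have K: "ln \<eta> \<le> Re (fst w)" "Re (fst w) \<le> 0" "ln \<eta> \<le> Re (snd w)" "Re (snd w) \<le> 0" if "w \<in> K" for w
    using that by (auto simp: K_def in_cbox_complex_iff)
  have eln: "exp (-7 * ln \<eta>) = inverse (\<eta> ^ 7)"
  proof -
    have "exp (7 * ln \<eta>) = \<eta> ^ 7" using \<eta> exp_of_nat_mult[of 7 "ln \<eta>"] by simp
    then show ?thesis by (simp add: exp_minus)
  qed
  have ep: "\<epsilon> ^ 7 * exp (-7 * ln \<eta>) \<le> 1 / 2"
  proof -
    have "\<epsilon> ^ 7 * exp (-7 * ln \<eta>) = (\<epsilon> / \<eta>) ^ 7" unfolding eln power_divide by (simp only: divide_inverse)
    also have "\<dots> \<le> (1/2) ^ 7" using \<epsilon> \<eta> by (intro power_mono) (auto simp: field_simps)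
    also have "(1/2) ^ 7 \<le> (1/2 :: real)" by (simp add: power_divide)
    finally show ?thesis .
  qed
  have Rel: "Re (14 * snd w - 7 * fst w) \<le> -7 * ln \<eta>" if "w \<in> K" for w
    using K[OF that] \<eta> by simp
  have un: "norm (u w) \<le> 1/2" if "w \<in> K" for w
  proof -
    have "norm (u w) = \<epsilon> ^ 7 * exp (Re (14 * snd w - 7 * fst w))"
      using \<epsilon> by (simp add: u_def norm_mult norm_power)
    also have "\<dots> \<le> \<epsilon> ^ 7 * exp (-7 * ln \<eta>)" using Rel[OF that] \<epsilon> by (intro mult_left_mono) auto
    finally show ?thesis using ep by linarith
  qed
  have fs: "norm (fst a - fst b) \<le> dist a b" "norm (snd a - snd b) \<le> dist a b" for a b :: "complex \<times> complex"
    using dist_fst_le[of a b] dist_snd_le[of a b] by (auto simp: dist_norm)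
  have ud: "norm (u a - u b) \<le> 21/2 * dist a b" if "a \<in> K" "b \<in> K" for a b
  proof -
    have "u a - u b = of_real \<epsilon> ^ 7 * (exp (14 * snd a - 7 * fst a) - exp (14 * snd b - 7 * fst b))"
      by (simp add: u_def algebra_simps)
    then have "norm (u a - u b) = \<epsilon> ^ 7 * norm (exp (14 * snd a - 7 * fst a) - exp (14 * snd b - 7 * fst b))"
      using \<epsilon> by (simp add: norm_mult norm_power)
    also have "\<dots> \<le> \<epsilon> ^ 7 * (exp (-7 * ln \<eta>) * norm ((14 * snd a - 7 * fst a) - (14 * snd b - 7 * fst b)))"
      using Rel that \<epsilon> by (intro mult_left_mono norm_exp_diff_le) auto
    also have "\<dots> = (\<epsilon> ^ 7 * exp (-7 * ln \<eta>)) * norm (14 * (snd a - snd b) - 7 * (fst a - fst b))"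
      by (simp add: algebra_simps)
    also have "\<dots> \<le> 1/2 * (14 * dist a b + 7 * dist a b)"
    proof (rule mult_mono[OF ep])
      have "norm (14 * (snd a - snd b) - 7 * (fst a - fst b)) \<le> norm (14 * (snd a - snd b)) + norm (7 * (fst a - fst b))"
        by (rule norm_triangle_ineq4)
      moreover have "norm (14 * (snd a - snd b)) = 14 * norm (snd a - snd b)"
        "norm (7 * (fst a - fst b)) = 7 * norm (fst a - fst b)"
        by (simp_all only: norm_mult norm_numeral)
      ultimately show "norm (14 * (snd a - snd b) - 7 * (fst a - fst b)) \<le> 14 * dist a b + 7 * dist a b"
        using fs[of a b] by linarith
    qed auto
    finally show ?thesis by simp
  qed
  have gd: "norm (g a - g b) \<le> 6 * dist a b" if "a \<in> K" "b \<in> K" for a b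
  proof -
    have "g a - g b = (7 * (fst a - fst b) + (snd a - snd b) + (Ln (1 + u a) - Ln (1 + u b))) / 5"
      by (simp add: g_def diff_divide_distrib add_divide_distrib algebra_simps)
    then have "norm (g a - g b) = norm (7 * (fst a - fst b) + (snd a - snd b) + (Ln (1 + u a) - Ln (1 + u b))) / 5"
      by (simp only: norm_divide norm_numeral)
    also have "\<dots> \<le> (norm (7 * (fst a - fst b)) + norm (snd a - snd b) + norm (Ln (1 + u a) - Ln (1 + u b))) / 5"
      by (intro divide_right_mono order_trans[OF norm_triangle_ineq] add_mono norm_triangle_ineq order_refl) auto
    also have "\<dots> \<le> (7 * dist a b + dist a b + 2 * (21/2 * dist a b)) / 5"
    proof (rule divide_right_mono)
      have "norm (7 * (fst a - fst b)) = 7 * norm (fst a - fst b)" by (simp only: norm_mult norm_numeral)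
      then show "norm (7 * (fst a - fst b)) + norm (snd a - snd b) + norm (Ln (1 + u a) - Ln (1 + u b))
          \<le> 7 * dist a b + dist a b + 2 * (21/2 * dist a b)"
        using fs[of a b] ud[OF that] norm_Ln_diff_le[OF un[OF that(1)] un[OF that(2)]] by linarith
    qed simp
    also have "\<dots> \<le> 6 * dist a b" by simp
    finally show ?thesis .
  qed
  have one_u: "1 + u w \<noteq> 0" if "w \<in> K" for w
  proof
    assume "1 + u w = 0"
    then have "u w = -1" by (simp add: add_eq_0_iff)
    then show False using un[OF that] by simp
  qed
  have g5: "exp (g w) ^ 5 = exp (7 * fst w + snd w) * (1 + u w)" if "w \<in> K" for w
  proof -
    have "exp (g w) ^ 5 = exp (5 * g w)" using exp_of_nat_mult[of 5 "g w"] by simp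
    also have "5 * g w = (7 * fst w + snd w) + Ln (1 + u w)" by (simp add: g_def)
    finally show ?thesis using one_u[OF that] by (simp add: exp_add)
  qed
  have Reg: "Re (g w) \<le> 1" if w: "w \<in> K" for w
  proof -
    have "Re (Ln (1 + u w)) \<le> norm (Ln (1 + u w) - Ln (1 + 0))" using complex_Re_le_cmod by simp
    also have "\<dots> \<le> 1" using norm_Ln_diff_le[OF un[OF w], of 0] un[OF w] by simp
    finally show ?thesis using K[OF w] by (simp add: g_def)
  qed
  have comp: "\<Phi> w $ 1 = - (of_real \<kappa> * exp (g w))" "\<Phi> w $ 2 = of_real \<epsilon> * exp (fst w)" "\<Phi> w $ 3 = of_real \<epsilon> * exp (snd w)" for w
    by (simp_all add: \<Phi>_def)
  have e3: "exp 1 \<le> (3::real)" by (rule exp_le)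
  show ?thesis
  proof (rule that[of \<Phi>])
    show "(20 * \<epsilon>)-lipschitz_on K \<Phi>"
    proof (rule lipschitz_onI)
      fix a b assume ab: "a \<in> K" "b \<in> K"
      have "\<Phi> a $ 1 - \<Phi> b $ 1 = - (of_real \<kappa> * (exp (g a) - exp (g b)))" by (simp add: comp algebra_simps)
      then have "dist (\<Phi> a $ 1) (\<Phi> b $ 1) = \<kappa> * norm (exp (g a) - exp (g b))"
        using \<kappa>(1) by (simp add: dist_norm norm_mult)
      also have "\<dots> \<le> \<epsilon> * (3 * (6 * dist a b))"
      proof (rule mult_mono[OF \<kappa>e])
        have "norm (exp (g a) - exp (g b)) \<le> exp 1 * norm (g a - g b)"
          using Reg ab by (intro norm_exp_diff_le) auto
        also have "\<dots> \<le> 3 * (6 * dist a b)" using e3 gd[OF ab] by (intro mult_mono) auto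
        finally show "norm (exp (g a) - exp (g b)) \<le> 3 * (6 * dist a b)" .
      qed (use \<epsilon> in auto)
      finally have d1: "dist (\<Phi> a $ 1) (\<Phi> b $ 1) \<le> 18 * \<epsilon> * dist a b" by simp
      have d2: "dist (\<Phi> a $ 2) (\<Phi> b $ 2) \<le> \<epsilon> * dist a b"
      proof -
        have "\<Phi> a $ 2 - \<Phi> b $ 2 = of_real \<epsilon> * (exp (fst a) - exp (fst b))" by (simp add: comp algebra_simps)
        then have "dist (\<Phi> a $ 2) (\<Phi> b $ 2) = \<epsilon> * norm (exp (fst a) - exp (fst b))"
          using \<epsilon> by (simp add: dist_norm norm_mult)
        also have "\<dots> \<le> \<epsilon> * (exp 0 * norm (fst a - fst b))"
          using K ab \<epsilon> by (intro mult_left_mono norm_exp_diff_le) auto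
        also have "\<dots> \<le> \<epsilon> * dist a b" using fs[of a b] \<epsilon> by simp
        finally show ?thesis .
      qed
      have d3: "dist (\<Phi> a $ 3) (\<Phi> b $ 3) \<le> \<epsilon> * dist a b"
      proof -
        have "\<Phi> a $ 3 - \<Phi> b $ 3 = of_real \<epsilon> * (exp (snd a) - exp (snd b))" by (simp add: comp algebra_simps)
        then have "dist (\<Phi> a $ 3) (\<Phi> b $ 3) = \<epsilon> * norm (exp (snd a) - exp (snd b))"
          using \<epsilon> by (simp add: dist_norm norm_mult)
        also have "\<dots> \<le> \<epsilon> * (exp 0 * norm (snd a - snd b))"
          using K ab \<epsilon> by (intro mult_left_mono norm_exp_diff_le) auto
        also have "\<dots> \<le> \<epsilon> * dist a b" using fs[of a b] \<epsilon> by simp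
        finally show ?thesis .
      qed
      show "dist (\<Phi> a) (\<Phi> b) \<le> 20 * \<epsilon> * dist a b"
        using dist_vec3_le[of "\<Phi> a" "\<Phi> b"] d1 d2 d3 by simp
    qed (use \<epsilon> in simp)
    have inX: "\<Phi> w \<in> Xt 0" if w: "w \<in> K" for w
    proof -
      let ?y = "exp (fst w)" and ?z = "exp (snd w)"
      have p: "exp (7 * fst w + snd w) = ?y ^ 7 * ?z"
        using exp_of_nat_mult[of 7 "fst w"] by (simp add: exp_add)
      have q: "exp (7 * fst w + snd w) * u w = of_real \<epsilon> ^ 7 * ?z ^ 15"
      proof -
        have "exp (7 * fst w + snd w) * exp (14 * snd w - 7 * fst w) = exp (15 * snd w)"
          by (simp add: exp_add[symmetric])
        also have "\<dots> = ?z ^ 15" using exp_of_nat_mult[of 15 "snd w"] by simp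
        finally show ?thesis by (simp add: u_def mult.left_commute)
      qed
      have "(of_real \<kappa> :: complex) ^ 5 = of_real (\<kappa> ^ 5)" by simp
      then have k5: "(of_real \<kappa> :: complex) ^ 5 = of_real \<epsilon> ^ 8" unfolding \<kappa>(2) by simp
      have "(\<Phi> w $ 1) ^ 5 = - (of_real \<kappa> ^ 5 * exp (g w) ^ 5)"
        unfolding comp by (simp add: power_minus_odd power_mult_distrib)
      also have "\<dots> = - (of_real \<epsilon> ^ 8 * (exp (7 * fst w + snd w) + exp (7 * fst w + snd w) * u w))"
        unfolding k5 g5[OF w] by (simp add: algebra_simps)
      also have "\<dots> = - ((of_real \<epsilon> * ?y) ^ 7 * (of_real \<epsilon> * ?z) + (of_real \<epsilon> * ?z) ^ 15)"
      proof -
        have e: "(of_real \<epsilon> :: complex) ^ 15 = of_real \<epsilon> ^ 8 * of_real \<epsilon> ^ 7"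
          "(of_real \<epsilon> :: complex) ^ 8 = of_real \<epsilon> ^ 7 * of_real \<epsilon>"
          by (simp_all add: power_add[symmetric] power_Suc2[symmetric] del: of_real_power power_Suc)
        show ?thesis unfolding q unfolding p power_mult_distrib e(1) unfolding e(2) by (simp add: algebra_simps)
      qed
      finally have "(\<Phi> w $ 1) ^ 5 + ((\<Phi> w $ 3) ^ 15 + (\<Phi> w $ 2) ^ 7 * \<Phi> w $ 3) = 0"
        unfolding comp(2,3) by simp
      then show ?thesis by (simp add: Xt_def add.assoc)
    qed
    show "\<Phi> ` K \<subseteq> Xt 0 \<inter> cball 0 (5 * \<epsilon>)"
    proof
      fix v assume "v \<in> \<Phi> ` K"
      then obtain w where w: "w \<in> K" "v = \<Phi> w" by blast
      have "norm (\<Phi> w $ 1) = \<kappa> * exp (Re (g w))" using \<kappa>(1) by (simp add: comp norm_mult)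
      also have "\<dots> \<le> \<epsilon> * 3" using \<kappa>e \<kappa>(1) \<epsilon> Reg[OF w(1)] e3
        by (intro mult_mono) (auto intro: order_trans[of _ "exp 1"])
      finally have "norm (\<Phi> w $ 1) \<le> 3 * \<epsilon>" by simp
      moreover have "norm (\<Phi> w $ 2) \<le> \<epsilon>" "norm (\<Phi> w $ 3) \<le> \<epsilon>"
        using K[OF w(1)] \<epsilon> by (auto simp: comp norm_mult mult_le_cancel_left1)
      ultimately have "norm v \<le> 5 * \<epsilon>" using norm_vec3_le[of v] w(2) by simp
      then show "v \<in> Xt 0 \<inter> cball 0 (5 * \<epsilon>)" using inX[OF w(1)] w(2) by simp
    qed
    show "Xt 0 \<inter> cball 0 \<epsilon> \<inter> {v. \<eta> * \<epsilon> \<le> norm (v$2) \<and> \<eta> * \<epsilon> \<le> norm (v$3)} \<subseteq> \<Phi> ` K"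
    proof
      fix v assume "v \<in> Xt 0 \<inter> cball 0 \<epsilon> \<inter> {v. \<eta> * \<epsilon> \<le> norm (v$2) \<and> \<eta> * \<epsilon> \<le> norm (v$3)}"
      then have v: "v \<in> Xt 0" "norm v \<le> \<epsilon>" "\<eta> * \<epsilon> \<le> norm (v$2)" "\<eta> * \<epsilon> \<le> norm (v$3)" by auto
      have log: "\<exists>c. ln \<eta> \<le> Re c \<and> Re c \<le> 0 \<and> - pi < Im c \<and> Im c \<le> pi \<and> v$i = of_real \<epsilon> * exp c"
        if "\<eta> * \<epsilon> \<le> norm (v$i)" for i
      proof -
        have le: "norm (v$i) \<le> \<epsilon>" using Finite_Cartesian_Product.norm_nth_le[of v i] v(2) by linarith
        have "0 < \<eta> * \<epsilon>" using \<eta> \<epsilon> by simp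
        then have nz: "v$i \<noteq> 0" using that by auto
        let ?q = "v$i / of_real \<epsilon>"
        have q: "?q \<noteq> 0" "norm ?q = norm (v$i) / \<epsilon>" using nz \<epsilon> by (auto simp: norm_divide)
        have "\<eta> \<le> norm ?q" "norm ?q \<le> 1" using that le \<epsilon> unfolding q(2) by (auto simp: field_simps)
        moreover have "0 < norm ?q" using q(1) by simp
        ultimately have "ln \<eta> \<le> ln (norm ?q)" "ln (norm ?q) \<le> 0"
          using \<eta> by (simp_all only: ln_le_cancel_iff ln_le_zero_iff)
        then show ?thesis using q(1) \<epsilon> mpi_less_Im_Ln[OF q(1)] Im_Ln_le_pi[OF q(1)]
          by (intro exI[of _ "Ln ?q"]) auto
      qed
      obtain c1 where c1: "ln \<eta> \<le> Re c1" "Re c1 \<le> 0" "- pi < Im c1" "Im c1 \<le> pi" "v$2 = of_real \<epsilon> * exp c1"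
        using log[OF v(3)] by blast
      obtain c2 where c2: "ln \<eta> \<le> Re c2" "Re c2 \<le> 0" "- pi < Im c2" "Im c2 \<le> pi" "v$3 = of_real \<epsilon> * exp c2"
        using log[OF v(4)] by blast
      \<comment> \<open>Adding \<open>2 * pi * j\<close> to the imaginary part of \<open>c2\<close>
        fixes \<open>y\<close>, \<open>z\<close> and \<open>u\<close> and multiplies
        \<open>x\<close> by a fifth root of unity. The upper end \<open>10 * pi\<close> leaves room
        for \<open>pi + 8 * pi\<close>.\<close>
      have cK: "(c1, c2 + 2 * of_nat j * of_real pi * \<i>) \<in> K" if "j < 5" for j
      proof -
        have "real j * pi \<le> 4 * pi" using that by (intro mult_right_mono) auto
        then have "Im c2 + 2 * real j * pi \<le> 10 * pi" using c2(4) pi_gt_zero by linarith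
        moreover have "- pi \<le> Im c2 + 2 * real j * pi" using c2(3) by (simp add: add_increasing2)
        ultimately show ?thesis using c1 c2 by (auto simp: K_def in_cbox_complex_iff)
      qed
      have c0K: "(c1, c2) \<in> K" using cK[of 0] by simp
      let ?x0 = "\<Phi> (c1, c2) $ 1"
      have x0: "?x0 \<noteq> 0" using \<kappa>(1) by (simp add: comp)
      have "(v$1)^5 = ?x0 ^ 5"
      proof -
        have "(v$1)^5 + ((v$3)^15 + (v$2)^7 * v$3) = 0" using v(1) by (simp add: Xt_def add.assoc)
        moreover have "?x0 ^ 5 + ((v$3)^15 + (v$2)^7 * v$3) = 0"
          using inX[OF c0K] c1(5) c2(5) by (simp add: Xt_def comp(2,3) add.assoc)
        ultimately show ?thesis by (metis add_right_cancel)
      qed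
      then have "(v$1 / ?x0) ^ 5 = 1" using x0 by (simp add: power_divide)
      then have "v$1 / ?x0 \<in> {z. z ^ 5 = 1}" by simp
      then obtain j where j: "j < 5" "v$1 / ?x0 = exp (2 * of_real pi * \<i> * of_nat j / of_nat 5)"
        using complex_roots_unity[of 5] by auto
      define w where "w = (c1, c2 + 2 * of_nat j * of_real pi * \<i>)"
      have per: "exp (z + of_nat k * (2 * of_real pi * \<i>)) = exp z" for z :: complex and k
      proof -
        have "exp (of_nat k * (2 * of_real pi * \<i>)) = (1::complex)"
          by (simp only: exp_of_nat_mult exp_two_pi_i power_one)
        then show ?thesis by (simp add: exp_add)
      qed
      have z: "exp (snd w) = exp c2" using per[of c2 j] by (simp add: w_def algebra_simps)
      have "14 * snd w - 7 * fst w = (14 * c2 - 7 * c1) + of_nat (14 * j) * (2 * of_real pi * \<i>)"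
        by (simp add: w_def algebra_simps)
      then have "exp (14 * snd w - 7 * fst w) = exp (14 * c2 - 7 * c1)" by (simp only: per)
      then have uw: "u w = u (c1, c2)" by (simp only: u_def fst_conv snd_conv)
      have "g w = g (c1, c2) + 2 * of_real pi * \<i> * of_nat j / of_nat 5"
        unfolding g_def uw by (simp add: w_def add_divide_distrib algebra_simps)
      then have "exp (g w) = exp (g (c1, c2)) * (v$1 / ?x0)" unfolding j(2) by (simp add: exp_add)
      then have "\<Phi> w $ 1 = ?x0 * (v$1 / ?x0)" by (simp add: comp)
      then have "\<Phi> w $ 1 = v$1" using x0 by simp
      moreover have "\<Phi> w $ 2 = v$2" "\<Phi> w $ 3 = v$3" using c1(5) c2(5) z by (simp_all add: comp(2,3) w_def)
      ultimately have "v = \<Phi> w" by (simp add: vec_eq_iff forall_3)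
      then show "v \<in> \<Phi> ` K" using cK[OF j(1)] by (simp add: w_def)
    qed
    fix a b assume ab: "a \<in> K" "b \<in> K" "dist a b \<le> 1"
    \<comment> \<open>The coordinates \<open>y\<close> and \<open>z\<close> alone give the
      expansion: \<open>exp (Re t) \<ge> \<eta>\<close> bounds the derivative from below, and
      closeness of \<open>s\<close> and \<open>t\<close> rules out a full period.\<close>
    have key: "norm (s - t) \<le> 2 / (\<eta> * \<epsilon>) * norm (of_real \<epsilon> * exp s - of_real \<epsilon> * exp t)"
      if "ln \<eta> \<le> Re t" "norm (s - t) \<le> 1" for s t :: complex
    proof -
      have "of_real \<epsilon> * exp s - of_real \<epsilon> * exp t = of_real \<epsilon> * (exp t * (exp (s - t) - 1))"
        by (simp add: algebra_simps exp_diff)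
      then have N: "norm (of_real \<epsilon> * exp s - of_real \<epsilon> * exp t) = \<epsilon> * (exp (Re t) * norm (exp (s - t) - 1))"
        using \<epsilon> by (simp add: norm_mult)
      have "\<eta> \<le> exp (Re t)" using that(1) \<eta> by (simp add: ln_le_cancel_iff[symmetric] del: ln_le_cancel_iff)
      then have "\<eta> * norm (exp (s - t) - 1) \<le> exp (Re t) * norm (exp (s - t) - 1)" by (intro mult_right_mono) auto
      moreover have "norm (s - t) \<le> 2 * norm (exp (s - t) - 1)" using that(2) by (rule norm_le_norm_exp_minus_one)
      then have "\<eta> * norm (s - t) \<le> \<eta> * (2 * norm (exp (s - t) - 1))" using \<eta> by (intro mult_left_mono) auto
      ultimately have "\<eta> * norm (s - t) \<le> 2 * (exp (Re t) * norm (exp (s - t) - 1))" by linarith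
      then have "norm (s - t) \<le> 2 * (exp (Re t) * norm (exp (s - t) - 1)) / \<eta>"
        using \<eta> by (simp add: pos_le_divide_eq mult.commute)
      also have "\<dots> = 2 / (\<eta> * \<epsilon>) * (\<epsilon> * (exp (Re t) * norm (exp (s - t) - 1)))" using \<eta> \<epsilon> by simp
      finally show ?thesis unfolding N .
    qed
    have "norm (fst a - fst b) \<le> 1" "norm (snd a - snd b) \<le> 1" using fs[of a b] ab(3) by linarith+
    then have k12: "norm (fst a - fst b) \<le> 2 / (\<eta> * \<epsilon>) * norm (\<Phi> a $ 2 - \<Phi> b $ 2)"
      "norm (snd a - snd b) \<le> 2 / (\<eta> * \<epsilon>) * norm (\<Phi> a $ 3 - \<Phi> b $ 3)"
      using key K[OF ab(2)] unfolding comp by blast+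
    have nb: "norm (\<Phi> a $ i - \<Phi> b $ i) \<le> dist (\<Phi> a) (\<Phi> b)" for i
      unfolding dist_norm vector_minus_component[symmetric] by (rule Finite_Cartesian_Product.norm_nth_le)
    have "dist a b \<le> norm (fst a - fst b) + norm (snd a - snd b)"
      by (metis dist_norm fst_diff norm_Pair_le prod.collapse snd_diff)
    also have "\<dots> \<le> 2 / (\<eta> * \<epsilon>) * dist (\<Phi> a) (\<Phi> b) + 2 / (\<eta> * \<epsilon>) * dist (\<Phi> a) (\<Phi> b)"
      using \<eta> \<epsilon> by (intro add_mono order_trans[OF k12(1) mult_left_mono[OF nb]]
          order_trans[OF k12(2) mult_left_mono[OF nb]]) auto
    also have "\<dots> = 4 / (\<eta> * \<epsilon>) * dist (\<Phi> a) (\<Phi> b)" by (simp add: field_simps)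
    finally show "dist a b \<le> 4 / (\<eta> * \<epsilon>) * dist (\<Phi> a) (\<Phi> b)" .
  qed
qed

lemma log_box:
  assumes \<eta>: "0 < \<eta>" "\<eta> < 1"
  defines "K \<equiv> cbox (Complex (ln \<eta>) (- pi)) (Complex 0 pi) \<times> cbox (Complex (ln \<eta>) (- pi)) (Complex 0 (10 * pi))"
  shows "compact K" "convex K" "0 < emeasure lborel K"
proof -
  show K: "compact K" unfolding K_def by (intro compact_Times compact_cbox)
  show "convex K" unfolding K_def by (intro convex_Times convex_box)
  define r where "r = min 1 (- ln \<eta> / 2)"
  have r: "0 < r" "r \<le> 1" "r \<le> - ln \<eta> / 2" using \<eta> by (auto simp: r_def)
  let ?c = "Complex (ln \<eta> / 2) 0"
  have "cball ?c r \<times> cball ?c r \<subseteq> K"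
  proof -
    have "ln \<eta> \<le> Re z \<and> Re z \<le> 0 \<and> - pi \<le> Im z \<and> Im z \<le> pi" if "z \<in> cball ?c r" for z
    proof -
      have "norm (?c - z) \<le> r" using that by (simp add: dist_norm)
      then have "\<bar>ln \<eta> / 2 - Re z\<bar> \<le> r" "\<bar>Im z\<bar> \<le> r"
        using abs_Re_le_cmod[of "?c - z"] abs_Im_le_cmod[of "?c - z"] by auto
      then show ?thesis using r pi_gt3 by linarith
    qed
    then show ?thesis unfolding K_def using pi_gt_zero by (force simp: in_cbox_complex_iff)
  qed
  then have "emeasure lborel (cball ?c r \<times> cball ?c r) \<le> emeasure lborel K"
    using K by (intro emeasure_mono) (auto simp: borel_compact)
  moreover have "0 < emeasure lborel (cball ?c r \<times> cball ?c r)"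
    using r unit_ball_vol_pos[of 2] by (subst emeasure_lborel_cball_Times) (auto intro!: mult_pos_pos zero_less_power)
  ultimately show "0 < emeasure lborel K" by (rule less_le_trans[rotated])
qed

text \<open>At one small scale both \<open>A\<close> and \<open>B\<close> have measure at least
  \<open>c * \<epsilon>^4\<close>, while the thin part and the image of the exceptional set
  \<open>M\<close> make up at most half of that. Each of them therefore contains a point
  \<open>\<Phi> a\<close> with \<open>a\<close> outside \<open>M\<close>. Two such points are joined
  in \<open>K - Z\<close>, and the image of the connecting set avoids \<open>Y\<close>.\<close>

lemma no_separating_set_X0: "\<not> has_separating_set TYPE(real^3) 4 (Xt 0) 0"
proof
  assume "has_separating_set TYPE(real^3) 4 (Xt 0) 0"
  then obtain Y \<epsilon>0 A B where e0: "0 < \<epsilon>0"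
    and AB: "A \<in> components ((cball 0 \<epsilon>0 \<inter> Xt 0) - Y)" "B \<in> components ((cball 0 \<epsilon>0 \<inter> Xt 0) - Y)" "A \<noteq> B"
    and Y: "upper_density 3 Y 0 = 0" and lA: "0 < lower_density 4 A 0" and lB: "0 < lower_density 4 B 0"
    unfolding has_separating_set_def separating_set_def by auto
  obtain cA where cA: "0 < cA" "\<forall>\<^sub>F \<epsilon> in at_right 0. ennreal (cA * \<epsilon> powr 4) \<le> hausdorff_measure 4 (A \<inter> cball 0 \<epsilon>)"
    by (rule lower_density_posD[OF lA]) auto
  obtain cB where cB: "0 < cB" "\<forall>\<^sub>F \<epsilon> in at_right 0. ennreal (cB * \<epsilon> powr 4) \<le> hausdorff_measure 4 (B \<inter> cball 0 \<epsilon>)"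
    by (rule lower_density_posD[OF lB]) auto
  define c where "c = min cA cB"
  have c: "0 < c" "c \<le> cA" "c \<le> cB" using cA(1) cB(1) by (auto simp: c_def)
  obtain C where C: "0 < C"
    "\<And>\<eta>. 0 < \<eta> \<Longrightarrow> \<eta> < 1 \<Longrightarrow> \<exists>\<epsilon>0>0. \<forall>\<epsilon>. 0 < \<epsilon> \<and> \<epsilon> < \<epsilon>0 \<longrightarrow>
       hausdorff_measure 4 (Xt 0 \<inter> cball 0 \<epsilon> \<inter> {v. norm (v$2) \<le> \<eta> * \<epsilon> \<or> norm (v$3) \<le> \<eta> * \<epsilon>})
         \<le> ennreal (C * \<eta>^2 * \<epsilon>^4)"
    by (rule X0_thin_part_area) (rule that, assumption+)
  \<comment> \<open>Makes \<open>C * \<eta>^2 \<le> c / 4\<close>, so that the thin part takes at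
    most a quarter of the guaranteed measure.\<close>
  define \<eta> where "\<eta> = min (1/2) (c / (4 * C))"
  have \<eta>: "0 < \<eta>" "\<eta> < 1" using c C by (auto simp: \<eta>_def)
  have "C * \<eta>^2 \<le> C * (\<eta> * 1)" unfolding power2_eq_square using \<eta> C by (intro mult_left_mono) auto
  also have "\<dots> \<le> C * (c / (4 * C))" using C by (intro mult_left_mono) (auto simp: \<eta>_def)
  finally have C\<eta>: "C * \<eta>^2 \<le> c / 4" using C(1) by simp
  obtain \<epsilon>1 where e1: "0 < \<epsilon>1" "\<And>\<epsilon>. 0 < \<epsilon> \<Longrightarrow> \<epsilon> < \<epsilon>1 \<Longrightarrow>
       hausdorff_measure 4 (Xt 0 \<inter> cball 0 \<epsilon> \<inter> {v. norm (v$2) \<le> \<eta> * \<epsilon> \<or> norm (v$3) \<le> \<eta> * \<epsilon>})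
         \<le> ennreal (C * \<eta>^2 * \<epsilon>^4)" using C(2)[OF \<eta>] by blast
  define K where "K = cbox (Complex (ln \<eta>) (- pi)) (Complex 0 pi) \<times> cbox (Complex (ln \<eta>) (- pi)) (Complex 0 (10 * pi))"
  have K: "compact K" "convex K" "0 < emeasure lborel K" using log_box[OF \<eta>] by (auto simp: K_def)
  \<comment> \<open>\<open>100 = 20 * 5\<close>: the image of a set of volume
    \<open>\<kappa>\<close> under the \<open>(20 * \<epsilon>)\<close>-Lipschitz map has measure at
    most \<open>c / 4 * \<epsilon>^4\<close>.\<close>
  define \<kappa> where "\<kappa> = c / (4 * (100 ^ 4))"
  have \<kappa>: "0 < \<kappa>" using c by (simp add: \<kappa>_def)
  obtain \<delta> where \<delta>: "0 < \<delta>"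
    "\<And>Z. hausdorff_measure (real (DIM(complex \<times> complex) - 1)) Z \<le> ennreal \<delta> \<Longrightarrow>
       \<exists>M. M \<in> sets lborel \<and> emeasure lborel M \<le> ennreal \<kappa> \<and>
         (\<forall>a\<in>K - M. \<forall>b\<in>K - M. \<exists>T. connected T \<and> a \<in> T \<and> b \<in> T \<and> T \<subseteq> K - Z)"
    by (rule generic_points_joined_avoiding_small_set[OF K _ \<kappa>]) (simp, rule that, assumption+)
  obtain F where F: "finite F" "K \<subseteq> (\<Union>k\<in>F. ball k (1/2))"
    using K(1) unfolding compact_eq_totally_bounded by (meson zero_less_divide_1_iff zero_less_numeral)
  define n where "n = card F + 1"
  \<comment> \<open>Pulling back multiplies the 3-measure by at most
    \<open>(4 / (\<eta> * \<epsilon>))^3\<close> per cell, and \<open>Y\<close> has at most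
    \<open>\<gamma> * (5 * \<epsilon>)^3\<close> in the relevant ball. The scale cancels and
    \<open>(20 / \<eta>)^3 * \<gamma> = \<delta> / n\<close> remains. The summand 1 in
    \<open>n\<close> avoids a division by zero.\<close>
  define \<gamma> where "\<gamma> = \<delta> / (real n * (20 / \<eta>) ^ 3)"
  have \<gamma>: "0 < \<gamma>" using \<delta> \<eta> by (simp add: \<gamma>_def n_def)
  obtain bY where bY: "0 < bY" "\<And>\<epsilon>. 0 < \<epsilon> \<Longrightarrow> \<epsilon> < bY \<Longrightarrow> hausdorff_measure 3 (Y \<inter> cball 0 \<epsilon>) \<le> ennreal (\<gamma> * \<epsilon> powr 3)"
    using upper_density_eq_0D[OF Y _ \<gamma>] unfolding eventually_at_right_field by auto
  obtain bA where bA: "0 < bA" "\<And>\<epsilon>. 0 < \<epsilon> \<Longrightarrow> \<epsilon> < bA \<Longrightarrow> ennreal (cA * \<epsilon> powr 4) \<le> hausdorff_measure 4 (A \<inter> cball 0 \<epsilon>)"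
    using cA(2) unfolding eventually_at_right_field by auto
  obtain bB where bB: "0 < bB" "\<And>\<epsilon>. 0 < \<epsilon> \<Longrightarrow> \<epsilon> < bB \<Longrightarrow> ennreal (cB * \<epsilon> powr 4) \<le> hausdorff_measure 4 (B \<inter> cball 0 \<epsilon>)"
    using cB(2) unfolding eventually_at_right_field by auto
  \<comment> \<open>The image of \<open>\<Phi>\<close> fills the ball of radius
    \<open>5 * \<epsilon>\<close> at most; hence the stronger demands relative to \<open>bY\<close>
    and \<open>\<epsilon>0\<close>.\<close>
  define \<epsilon> where "\<epsilon> = Min {\<eta> / 2, \<epsilon>1 / 2, bA / 2, bB / 2, bY / 10, \<epsilon>0 / 5}"
  have "\<epsilon> \<in> {\<eta> / 2, \<epsilon>1 / 2, bA / 2, bB / 2, bY / 10, \<epsilon>0 / 5}" unfolding \<epsilon>_def by (rule Min_in) auto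
  then have \<epsilon>: "0 < \<epsilon>" using \<eta> e1 bA bB bY e0 by auto
  have \<epsilon>le: "\<epsilon> \<le> \<eta> / 2" "\<epsilon> < \<epsilon>1" "\<epsilon> < bA" "\<epsilon> < bB" "5 * \<epsilon> < bY" "5 * \<epsilon> \<le> \<epsilon>0"
  proof -
    have "\<epsilon> \<le> x" if "x \<in> {\<eta> / 2, \<epsilon>1 / 2, bA / 2, bB / 2, bY / 10, \<epsilon>0 / 5}" for x
      unfolding \<epsilon>_def using that by (intro Min_le) auto
    from this[of "\<eta> / 2"] this[of "\<epsilon>1 / 2"] this[of "bA / 2"] this[of "bB / 2"] this[of "bY / 10"] this[of "\<epsilon>0 / 5"]
    have "\<epsilon> \<le> \<eta> / 2" "\<epsilon> \<le> \<epsilon>1 / 2" "\<epsilon> \<le> bA / 2" "\<epsilon> \<le> bB / 2" "\<epsilon> \<le> bY / 10" "\<epsilon> \<le> \<epsilon>0 / 5"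
      by simp_all
    then show "\<epsilon> \<le> \<eta> / 2" "\<epsilon> < \<epsilon>1" "\<epsilon> < bA" "\<epsilon> < bB" "5 * \<epsilon> < bY" "5 * \<epsilon> \<le> \<epsilon>0"
      using e1 bA bB bY by linarith+
  qed
  obtain \<Phi> where \<Phi>: "(20 * \<epsilon>)-lipschitz_on K \<Phi>"
    "\<Phi> ` K \<subseteq> Xt 0 \<inter> cball 0 (5 * \<epsilon>)"
    "Xt 0 \<inter> cball 0 \<epsilon> \<inter> {v. \<eta> * \<epsilon> \<le> norm (v$2) \<and> \<eta> * \<epsilon> \<le> norm (v$3)} \<subseteq> \<Phi> ` K"
    "\<And>a b. a \<in> K \<Longrightarrow> b \<in> K \<Longrightarrow> dist a b \<le> 1 \<Longrightarrow> dist a b \<le> 4 / (\<eta> * \<epsilon>) * dist (\<Phi> a) (\<Phi> b)"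
    using X0_log_parametrization[OF \<eta> \<epsilon> \<epsilon>le(1)] unfolding K_def by blast
  define Z where "Z = {w \<in> K. \<Phi> w \<in> Y}"
  \<comment> \<open>Within a ball of radius \<open>1/2\<close> any two points have distance at most
    1, the range in which \<open>\<Phi>\<close> is known to expand and so to be injective.\<close>
  have cell: "hausdorff_measure 3 (Z \<inter> ball k (1/2)) \<le> ennreal (\<delta> / real n)" for k
  proof -
    let ?W = "Z \<inter> ball k (1/2)" and ?L = "4 / (\<eta> * \<epsilon>)"
    have ex: "dist a b \<le> ?L * dist (\<Phi> a) (\<Phi> b)" if "a \<in> ?W" "b \<in> ?W" for a b
    proof -
      have "dist a b \<le> 1" using that dist_triangle[of a b k] by (auto simp: dist_commute)
      then show ?thesis using that by (intro \<Phi>(4)) (auto simp: Z_def)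
    qed
    have inj: "inj_on \<Phi> ?W"
    proof (rule inj_onI)
      fix a b assume "a \<in> ?W" "b \<in> ?W" "\<Phi> a = \<Phi> b"
      then show "a = b" using ex[of a b] by simp
    qed
    let ?g = "the_inv_into ?W \<Phi>"
    have "?L-lipschitz_on (\<Phi> ` ?W) ?g"
    proof (rule lipschitz_onI)
      fix x y assume "x \<in> \<Phi> ` ?W" "y \<in> \<Phi> ` ?W"
      then obtain a b where "a \<in> ?W" "b \<in> ?W" "x = \<Phi> a" "y = \<Phi> b" by blast
      then show "dist (?g x) (?g y) \<le> ?L * dist x y" using ex[of a b] inj by (simp add: the_inv_into_f_f)
    qed (use \<eta> \<epsilon> in simp)
    moreover have "?g ` (\<Phi> ` ?W) = ?W" using inj by (simp add: the_inv_into_onto)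
    ultimately have "hausdorff_measure 3 ?W \<le> ennreal (?L powr 3) * hausdorff_measure 3 (\<Phi> ` ?W)"
      using hausdorff_measure_lipschitz_image[of ?L "\<Phi> ` ?W" ?g 3] \<eta> \<epsilon> by simp
    also have "hausdorff_measure 3 (\<Phi> ` ?W) \<le> hausdorff_measure 3 (Y \<inter> cball 0 (5 * \<epsilon>))"
      using \<Phi>(2) by (intro hausdorff_measure_mono) (auto simp: Z_def)
    also have "\<dots> \<le> ennreal (\<gamma> * (5 * \<epsilon>) powr 3)" using \<epsilon> \<epsilon>le by (intro bY(2)) auto
    also have "ennreal (?L powr 3) * ennreal (\<gamma> * (5 * \<epsilon>) powr 3) = ennreal ((?L * (5 * \<epsilon>)) ^ 3 * \<gamma>)"
    proof -
      have "?L powr 3 = ?L ^ 3" "(5 * \<epsilon>) powr 3 = (5 * \<epsilon>) ^ 3" using \<eta> \<epsilon> by (simp_all add: powr_numeral)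
      then have "(?L * (5 * \<epsilon>)) ^ 3 * \<gamma> = ?L powr 3 * (\<gamma> * (5 * \<epsilon>) powr 3)"
        by (simp only: power_mult_distrib ac_simps)
      then show ?thesis by (simp only: ennreal_mult'[OF powr_ge_zero])
    qed
    also have "?L * (5 * \<epsilon>) = 20 / \<eta>" using \<eta> \<epsilon> by simp
    also have "(20 / \<eta>) ^ 3 * \<gamma> = \<delta> / real n" using \<eta> by (simp add: \<gamma>_def)
    finally show ?thesis by (simp add: mult_left_mono)
  qed
  have "hausdorff_measure 3 Z \<le> ennreal \<delta>"
  proof -
    have "Z \<subseteq> (\<Union>k\<in>F. Z \<inter> ball k (1/2))" using F(2) by (auto simp: Z_def)
    then have "hausdorff_measure 3 Z \<le> (\<Sum>k\<in>F. hausdorff_measure 3 (Z \<inter> ball k (1/2)))"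
      by (rule order_trans[OF hausdorff_measure_mono hausdorff_measure_finite_UN[OF F(1)]])
    also have "\<dots> \<le> (\<Sum>k\<in>F. ennreal (\<delta> / real n))" by (intro sum_mono cell)
    also have "\<dots> = ennreal (real (card F) * (\<delta> / real n))" using \<delta>(1) by (subst sum_ennreal) auto
    also have "\<dots> \<le> ennreal \<delta>" using \<delta>(1) by (intro ennreal_leI) (auto simp: n_def field_simps)
    finally show ?thesis .
  qed
  then have "hausdorff_measure (real (DIM(complex \<times> complex) - 1)) Z \<le> ennreal \<delta>" by simp
  from \<delta>(2)[OF this] obtain M where M: "M \<in> sets lborel" "emeasure lborel M \<le> ennreal \<kappa>"
    "\<And>a b. a \<in> K - M \<Longrightarrow> b \<in> K - M \<Longrightarrow> \<exists>T. connected T \<and> a \<in> T \<and> b \<in> T \<and> T \<subseteq> K - Z" by blast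
  have meet: "\<exists>a\<in>K - M. \<Phi> a \<in> W"
    if W: "W \<subseteq> Xt 0" "ennreal (c' * \<epsilon> powr 4) \<le> hausdorff_measure 4 (W \<inter> cball 0 \<epsilon>)" "c \<le> c'" for W c'
  proof (rule ccontr)
    assume neg: "\<not> ?thesis"
    let ?bad = "Xt 0 \<inter> cball 0 \<epsilon> \<inter> {v. norm (v$2) \<le> \<eta> * \<epsilon> \<or> norm (v$3) \<le> \<eta> * \<epsilon>}"
    have "W \<inter> cball 0 \<epsilon> \<subseteq> ?bad \<union> \<Phi> ` (K \<inter> M)"
    proof
      fix v assume v: "v \<in> W \<inter> cball 0 \<epsilon>"
      show "v \<in> ?bad \<union> \<Phi> ` (K \<inter> M)"
      proof (cases "v \<in> ?bad")
        case False
        then have "v \<in> Xt 0 \<inter> cball 0 \<epsilon> \<inter> {v. \<eta> * \<epsilon> \<le> norm (v$2) \<and> \<eta> * \<epsilon> \<le> norm (v$3)}"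
          using v W(1) by auto
        then obtain a where "a \<in> K" "v = \<Phi> a" using \<Phi>(3) by blast
        then show ?thesis using neg v by blast
      qed blast
    qed
    then have "hausdorff_measure 4 (W \<inter> cball 0 \<epsilon>) \<le> hausdorff_measure 4 ?bad + hausdorff_measure 4 (\<Phi> ` (K \<inter> M))"
      by (rule order_trans[OF hausdorff_measure_mono hausdorff_measure_Un])
    also have "hausdorff_measure 4 ?bad \<le> ennreal (c / 4 * \<epsilon>^4)"
      using e1(2)[OF \<epsilon> \<epsilon>le(2)] by (rule order_trans) (intro ennreal_leI mult_right_mono C\<eta>, simp)
    also have "hausdorff_measure 4 (\<Phi> ` (K \<inter> M)) \<le> ennreal (c / 4 * \<epsilon>^4)"
    proof -
      have "(20 * \<epsilon>)-lipschitz_on (K \<inter> M) \<Phi>" by (rule lipschitz_on_subset[OF \<Phi>(1)]) auto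
      then have "hausdorff_measure 4 (\<Phi> ` (K \<inter> M)) \<le> ennreal ((20 * \<epsilon>) powr 4) * hausdorff_measure 4 (K \<inter> M)"
        by (rule hausdorff_measure_lipschitz_image) (use \<epsilon> in auto)
      also have "hausdorff_measure 4 (K \<inter> M) \<le> ennreal (5 ^ 4) * emeasure lborel (K \<inter> M)"
        using hausdorff_measure_le_lborel[of "K \<inter> M"] M(1) K(1) by (simp add: borel_compact sets.Int)
      also have "emeasure lborel (K \<inter> M) \<le> emeasure lborel M" using M(1) by (intro emeasure_mono) auto
      also have "\<dots> \<le> ennreal \<kappa>" by (rule M(2))
      also have "ennreal ((20 * \<epsilon>) powr 4) * (ennreal (5 ^ 4) * ennreal \<kappa>) = ennreal (c / 4 * \<epsilon>^4)"
      proof -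
        have "(20 * \<epsilon>) powr 4 * (5 ^ 4 * \<kappa>) = c / 4 * \<epsilon>^4"
          using \<epsilon> by (simp add: powr_numeral power_mult_distrib \<kappa>_def)
        moreover have "ennreal ((20 * \<epsilon>) powr 4 * (5 ^ 4 * \<kappa>)) = ennreal ((20 * \<epsilon>) powr 4) * (ennreal (5 ^ 4) * ennreal \<kappa>)"
          by (subst ennreal_mult', simp, subst ennreal_mult', simp, rule refl)
        ultimately show ?thesis by (simp only:)
      qed
      finally show ?thesis by (simp add: mult_left_mono)
    qed
    finally have "hausdorff_measure 4 (W \<inter> cball 0 \<epsilon>) \<le> ennreal (c / 4 * \<epsilon>^4) + ennreal (c / 4 * \<epsilon>^4)"
      by (simp add: add_mono)
    also have "\<dots> = ennreal (c / 2 * \<epsilon>^4)" using c by (subst ennreal_plus[symmetric]) auto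
    finally have "ennreal (c' * \<epsilon> powr 4) \<le> ennreal (c / 2 * \<epsilon>^4)" using W(2) by (rule order_trans[rotated])
    then have "c' * \<epsilon>^4 \<le> c / 2 * \<epsilon>^4" using \<epsilon> c by (subst (asm) ennreal_le_iff) (auto simp: powr_numeral)
    then have "c' \<le> c / 2" using \<epsilon> by simp
    then show False using W(3) c by linarith
  qed
  have sub: "A \<subseteq> Xt 0" "B \<subseteq> Xt 0" using in_components_subset[OF AB(1)] in_components_subset[OF AB(2)] by auto
  obtain a where a: "a \<in> K - M" "\<Phi> a \<in> A" using meet[OF sub(1) bA(2)[OF \<epsilon> \<epsilon>le(3)] c(2)] by blast
  obtain b where b: "b \<in> K - M" "\<Phi> b \<in> B" using meet[OF sub(2) bB(2)[OF \<epsilon> \<epsilon>le(4)] c(3)] by blast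
  obtain T where T: "connected T" "a \<in> T" "b \<in> T" "T \<subseteq> K - Z" using M(3)[OF a(1) b(1)] by blast
  have cT: "connected (\<Phi> ` T)"
    by (rule connected_continuous_image[OF _ T(1)])
       (rule continuous_on_subset[OF lipschitz_on_continuous_on[OF \<Phi>(1)]], use T(4) in blast)
  have sT: "\<Phi> ` T \<subseteq> (cball 0 \<epsilon>0 \<inter> Xt 0) - Y"
    using T(4) \<Phi>(2) \<epsilon>le(6) by (fastforce simp: Z_def)
  have "\<Phi> ` T \<subseteq> A" using AB(1) cT sT a(2) T(2) by (intro components_maximal[of A]) auto
  then have "\<Phi> b \<in> A \<inter> B" using T(3) b(2) by blast
  then show False using components_nonoverlap[OF AB(1,2)] AB(3) by blast
qed

section \<open>Connectedness of the link\<close>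

text \<open>\<open>norm (poly p w)\<close> is the product of the distances from \<open>w\<close> to
  the \<open>n\<close> roots, so the smallest distance is at most its \<open>n\<close>-th
  root.\<close>

lemma monic_root_near:
  fixes p :: "complex poly"
  assumes lc: "lead_coeff p = 1" and deg: "degree p = n" "0 < n"
  obtains z where "poly p z = 0" "norm (w - z) ^ n \<le> norm (poly p w)"
proof -
  obtain root where root: "smult (lead_coeff p) (\<Prod>i<degree p. [:-root i, 1:]) = p"
    by (rule complex_poly_decompose')
  then have eq: "p = (\<Prod>i<n. [:-root i, 1:])" using lc deg(1) by simp
  have val: "poly p v = (\<Prod>i<n. v - root i)" for v
    unfolding eq by (simp add: poly_prod)
  define m where "m = Min ((\<lambda>i. norm (w - root i)) ` {..<n})"
  have "m \<in> (\<lambda>i. norm (w - root i)) ` {..<n}" unfolding m_def using deg(2) by (intro Min_in) auto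
  then obtain i where i: "i < n" "m = norm (w - root i)" by auto
  have le: "m \<le> norm (w - root j)" if "j < n" for j unfolding m_def using that by (intro Min_le) auto
  have "m ^ n = (\<Prod>j<n. m)" by simp
  also have "\<dots> \<le> (\<Prod>j<n. norm (w - root j))" using le i(2) by (intro prod_mono) auto
  also have "\<dots> = norm (poly p w)" unfolding val by (simp add: prod_norm)
  finally have "norm (w - root i) ^ n \<le> norm (poly p w)" unfolding i(2) .
  moreover have "poly p (root i) = 0" unfolding val using i(1) by (auto intro!: prod_zero)
  ultimately show ?thesis by (rule that[rotated])
qed

lemma card_roots_rsquarefree:
  fixes p :: "complex poly"
  assumes "rsquarefree p"
  shows "card {z. poly p z = 0} = degree p"
proof -
  have "p \<noteq> 0" using assms by (simp add: rsquarefree_def)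
  have "degree p = degree (smult (lead_coeff p) (\<Prod>z|poly p z = 0. [:-z, 1:]))"
    using complex_poly_decompose_rsquarefree[OF assms] by simp
  also have "\<dots> = degree (\<Prod>z|poly p z = 0. [:-z, 1:])" using \<open>p \<noteq> 0\<close> by simp
  also have "\<dots> = (\<Sum>z|poly p z = 0. degree [:-z, 1:])" by (rule degree_prod_eq_sum_degree) simp
  finally show ?thesis by simp
qed

text \<open>The value at the fixed point \<open>x0\<close> tends to 0 as the parameter approaches
  \<open>y0\<close>; the nearest root then has to approach \<open>x0\<close>.\<close>

lemma nearby_root:
  fixes p :: "'a::metric_space \<Rightarrow> complex poly"
  assumes lc: "\<And>y. lead_coeff (p y) = 1" and deg: "\<And>y. degree (p y) = n" and n: "0 < n"
    and cont: "\<And>x. continuous_on UNIV (\<lambda>y. poly (p y) x)"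
    and x0: "poly (p y0) x0 = 0" and e: "0 < e"
  shows "\<forall>\<^sub>F y in nhds y0. \<exists>x. poly (p y) x = 0 \<and> dist x0 x < e"
proof -
  have "continuous (at y0) (\<lambda>y. norm (poly (p y) x0))"
    using cont[of x0] by (intro continuous_norm) (simp add: continuous_on_eq_continuous_at)
  then have "((\<lambda>y. norm (poly (p y) x0)) \<longlongrightarrow> norm (poly (p y0) x0)) (nhds y0)"
    unfolding isCont_def by (rule tendsto_at_iff_tendsto_nhds[THEN iffD1])
  then have "\<forall>\<^sub>F y in nhds y0. norm (poly (p y) x0) < e ^ n"
    using e by (intro order_tendstoD) (auto simp: x0)
  then show ?thesis
  proof eventually_elim
    case (elim y)
    obtain x where x: "poly (p y) x = 0" "norm (x0 - x) ^ n \<le> norm (poly (p y) x0)"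
      by (rule monic_root_near[OF lc deg n])
    have "norm (x0 - x) ^ n < e ^ n" using x(2) elim by simp
    then have "norm (x0 - x) < e" using e by (simp add: power_less_imp_less_base)
    then show ?case using x(1) by (auto simp: dist_norm)
  qed
qed

text \<open>On the zero set of such a family the projection to the parameters is proper and open.\<close>

lemma monic_family_projection_surj:
  fixes p :: "complex \<Rightarrow> complex poly"
  assumes lc: "\<And>y. lead_coeff (p y) = 1" and deg: "\<And>y. degree (p y) = n" and n: "0 < n"
    and cont: "\<And>x. continuous_on UNIV (\<lambda>y. poly (p y) x)"
    and bnd: "\<And>R. \<exists>M. \<forall>y x. norm y \<le> R \<and> poly (p y) x = 0 \<longrightarrow> norm x \<le> M"
    and C: "closed C" "C \<noteq> {}" "closed C'" "C \<inter> C' = {}" "C \<union> C' = {(x, y). poly (p y) x = 0}"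
  shows "\<exists>x. (x, y) \<in> C"
proof -
  define E where "E = snd ` C"
  \<comment> \<open>A neighbourhood of \<open>(x0, y0)\<close> misses \<open>C'\<close>, so the root
    that continues \<open>x0\<close> over nearby parameters stays in \<open>C\<close>.\<close>
  have "open E"
  proof (subst open_subopen, intro ballI)
    fix y0 assume "y0 \<in> E"
    then obtain x0 where x0: "(x0, y0) \<in> C" by (auto simp: E_def)
    then have "(x0, y0) \<in> - C'" using C(4) by blast
    then obtain U V where UV: "open U" "open V" "(x0, y0) \<in> U \<times> V" "U \<times> V \<subseteq> - C'"
      using C(3) by (metis open_Compl open_prod_elim)
    then obtain e where e: "0 < e" "ball x0 e \<subseteq> U" by (auto simp: open_contains_ball)
    have z: "poly (p y0) x0 = 0" using x0 C(5) by auto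
    have "\<forall>\<^sub>F y in nhds y0. y \<in> V" using UV by (intro eventually_nhds_in_open) auto
    with nearby_root[OF lc deg n cont z e(1)] have "\<forall>\<^sub>F y in nhds y0. y \<in> E"
    proof eventually_elim
      case (elim y)
      then obtain x where x: "poly (p y) x = 0" "dist x0 x < e" by blast
      then have "x \<in> U" using e(2) by auto
      then have "(x, y) \<notin> C'" using elim(2) UV(4) by blast
      then have "(x, y) \<in> C" using x(1) C(5) by blast
      then show ?case by (force simp: E_def)
    qed
    then show "\<exists>T. open T \<and> y0 \<in> T \<and> T \<subseteq> E" by (auto simp: eventually_nhds)
  qed
  \<comment> \<open>Root bounds make the projection proper: over each disc, \<open>E\<close> is the
    image of a compact part of \<open>C\<close>.\<close>
  moreover have "closed E"
  proof -
    have cl: "closed (E \<inter> cball 0 R)" for R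
    proof -
      obtain M where M: "\<And>y x. norm y \<le> R \<Longrightarrow> poly (p y) x = 0 \<Longrightarrow> norm x \<le> M" using bnd[of R] by blast
      have "E \<inter> cball 0 R = snd ` (C \<inter> (cball 0 M \<times> cball 0 R))"
      proof
        show "E \<inter> cball 0 R \<subseteq> snd ` (C \<inter> (cball 0 M \<times> cball 0 R))"
        proof
          fix y assume y: "y \<in> E \<inter> cball 0 R"
          then obtain x where x: "(x, y) \<in> C" by (auto simp: E_def)
          then have "poly (p y) x = 0" using C(5) by blast
          then have "norm x \<le> M" using M[of y x] y by simp
          then have "(x, y) \<in> C \<inter> (cball 0 M \<times> cball 0 R)" using x y by simp
          then show "y \<in> snd ` (C \<inter> (cball 0 M \<times> cball 0 R))" by (rule rev_image_eqI) simp
        qed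
      qed (auto simp: E_def)
      moreover have "compact (C \<inter> (cball 0 M \<times> cball 0 R))"
        using C(1) by (intro closed_Int_compact compact_Times) auto
      ultimately show ?thesis
        by (simp add: compact_imp_closed compact_continuous_image continuous_on_snd continuous_on_id)
    qed
    show ?thesis
      unfolding closed_sequential_limits
    proof (intro allI impI, elim conjE)
      fix f l assume f: "\<forall>n. f n \<in> E" "f \<longlonglongrightarrow> l"
      have "bounded (range f)" using f(2) by (intro convergent_imp_bounded)
      then obtain R where "\<And>n. norm (f n) \<le> R" by (auto simp: bounded_iff)
      then have "\<forall>n. f n \<in> E \<inter> cball 0 R" using f(1) by auto
      then have "l \<in> E \<inter> cball 0 R" using f(2) cl[of R] unfolding closed_sequential_limits by blast
      then show "l \<in> E" by blast
    qed
  qed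
  ultimately have "E = UNIV" using clopen[of E] C(2) by (auto simp: E_def)
  then show ?thesis by (force simp: E_def)
qed

lemma norm_bound_of_power_ineq:
  fixes r :: real
  assumes "0 \<le> r" "0 \<le> a" "0 \<le> b" "r ^ Suc n \<le> a * r ^ n + b"
  shows "r \<le> 1 + a + b"
proof (cases "r \<le> 1")
  case False
  then have "1 \<le> r ^ n" by simp
  then have "b * 1 \<le> b * r ^ n" using assms by (intro mult_left_mono)
  then have "r * r ^ n \<le> (a + b) * r ^ n" using assms(4) by (simp add: algebra_simps)
  then have "r \<le> a + b" using False by simp
  then show ?thesis by simp
qed (use assms in simp)

section \<open>The plane section of the surface at z = 1\<close>

context
  fixes t :: complex
  assumes t: "t \<noteq> 0"
begin

text \<open>The section \<open>z = 1\<close> of \<open>Xt t\<close>, from which the weighted scaling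
  recovers all points with \<open>z \<noteq> 0\<close>.\<close>

definition slice_curve :: "(complex \<times> complex) set" where
  "slice_curve = {(x, y). x^5 + t * x * y^6 + y^7 + 1 = 0}"

text \<open>The equation of the section is monic both in \<open>y\<close>, with degree 7, and in
  \<open>x\<close>, with degree 5 (\<open>slice_x\<close>). Sheets are counted over
  \<open>x\<close>; the other projection serves to find points with \<open>y = 0\<close>.\<close>

definition slice_y :: "complex \<Rightarrow> complex poly" where
  "slice_y x = monom 1 7 + (monom (t * x) 6 + [:1 + x^5:])"

definition slice_x :: "complex \<Rightarrow> complex poly" where
  "slice_x y = monom 1 5 + [:1 + y^7, t * y^6:]"

lemma poly_slice_y: "poly (slice_y x) y = x^5 + t * x * y^6 + y^7 + 1"
  by (simp add: slice_y_def poly_monom)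

lemma poly_slice_x: "poly (slice_x y) x = x^5 + t * x * y^6 + y^7 + 1"
  by (simp add: slice_x_def poly_monom algebra_simps)

lemma degree_slice_y: "degree (slice_y x) = 7"
proof -
  have "degree (monom (t * x) 6 + [:1 + x^5:]) < 7"
    by (intro degree_add_less) (auto intro: le_less_trans[OF degree_monom_le])
  then show ?thesis unfolding slice_y_def by (subst degree_add_eq_left) (auto simp: degree_monom_eq)
qed

lemma degree_slice_x: "degree (slice_x x) = 5"
  unfolding slice_x_def by (subst degree_add_eq_left) (auto simp: degree_monom_eq)

lemma monic_slice_y: "lead_coeff (slice_y x) = 1"
  unfolding degree_slice_y by (simp add: slice_y_def coeff_pCons split: nat.split)

lemma monic_slice_x: "lead_coeff (slice_x x) = 1"
  unfolding degree_slice_x by (simp add: slice_x_def coeff_pCons split: nat.split)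

lemma slice_y_root_bound: "\<exists>M. \<forall>x y. norm x \<le> R \<and> poly (slice_y x) y = 0 \<longrightarrow> norm y \<le> M"
proof (intro exI[of _ "1 + norm t * \<bar>R\<bar> + (1 + \<bar>R\<bar>^5)"] allI impI)
  fix x y :: complex assume "norm x \<le> R \<and> poly (slice_y x) y = 0"
  then have x: "norm x \<le> \<bar>R\<bar>" and "y^7 = - (t * x * y^6 + (1 + x^5))"
    unfolding poly_slice_y by (auto simp: eq_neg_iff_add_eq_0 algebra_simps)
  then have "norm y ^ 7 = norm (t * x * y^6 + (1 + x^5))" by (metis norm_minus_cancel norm_power)
  also have "\<dots> \<le> norm (t * x * y^6) + (norm (1::complex) + norm (x^5))"
    by (intro order_trans[OF norm_triangle_ineq] add_left_mono norm_triangle_ineq)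
  also have "\<dots> \<le> norm t * \<bar>R\<bar> * norm y ^ 6 + (1 + \<bar>R\<bar>^5)"
    using x by (auto simp: norm_mult norm_power intro!: add_mono mult_right_mono mult_left_mono power_mono)
  finally show "norm y \<le> 1 + norm t * \<bar>R\<bar> + (1 + \<bar>R\<bar>^5)"
    by (intro norm_bound_of_power_ineq[where n = 6]) (auto simp: eval_nat_numeral)
qed

lemma slice_x_root_bound: "\<exists>M. \<forall>y x. norm y \<le> R \<and> poly (slice_x y) x = 0 \<longrightarrow> norm x \<le> M"
proof (intro exI[of _ "1 + norm t * \<bar>R\<bar>^6 + (1 + \<bar>R\<bar>^7)"] allI impI)
  fix y x :: complex assume "norm y \<le> R \<and> poly (slice_x y) x = 0"
  then have y: "norm y \<le> \<bar>R\<bar>" and "x^5 = - (t * x * y^6 + (1 + y^7))"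
    unfolding poly_slice_x by (auto simp: eq_neg_iff_add_eq_0 algebra_simps)
  then have "norm x ^ 5 = norm (t * x * y^6 + (1 + y^7))" by (metis norm_minus_cancel norm_power)
  also have "\<dots> \<le> norm (t * x * y^6) + (norm (1::complex) + norm (y^7))"
    by (intro order_trans[OF norm_triangle_ineq] add_left_mono norm_triangle_ineq)
  also have "\<dots> = norm t * norm y ^ 6 * norm x + (1 + norm y ^ 7)"
    by (simp add: norm_mult norm_power)
  also have "\<dots> \<le> norm t * \<bar>R\<bar>^6 * norm x + (1 + \<bar>R\<bar>^7)"
    using y by (intro add_mono mult_right_mono mult_left_mono power_mono order_refl) auto
  finally have le: "norm x ^ 5 \<le> norm t * \<bar>R\<bar>^6 * norm x + (1 + \<bar>R\<bar>^7)" .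
  show "norm x \<le> 1 + norm t * \<bar>R\<bar>^6 + (1 + \<bar>R\<bar>^7)"
  proof (cases "norm x \<le> 1")
    case False
    then have "norm x ^ 1 \<le> norm x ^ 4" by (intro power_increasing) auto
    then have "norm t * \<bar>R\<bar>^6 * norm x \<le> norm t * \<bar>R\<bar>^6 * norm x ^ 4"
      by (intro mult_left_mono) auto
    then have "norm x ^ Suc 4 \<le> norm t * \<bar>R\<bar>^6 * norm x ^ 4 + (1 + \<bar>R\<bar>^7)" using le by simp
    then show ?thesis by (intro norm_bound_of_power_ineq[where n = 4]) auto
  next
    case True
    then show ?thesis by (smt (verit) norm_ge_zero mult_nonneg_nonneg zero_le_power abs_ge_zero)
  qed
qed

text \<open>Only \<open>C\<close> has to be nonempty; a disconnection of the curve yields such a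
  pair in either order.\<close>

definition clopen_part :: "(complex \<times> complex) set \<Rightarrow> (complex \<times> complex) set \<Rightarrow> bool" where
  "clopen_part C C' \<longleftrightarrow> closed C \<and> C \<noteq> {} \<and> closed C' \<and> C \<inter> C' = {} \<and> C \<union> C' = slice_curve"

text \<open>Will be applied at \<open>y = 0\<close>: every part contains some \<open>(a, 0)\<close>,
  necessarily with \<open>a^5 = -1\<close>.\<close>

lemma clopen_part_surj: "clopen_part C C' \<Longrightarrow> \<exists>x. (x, y) \<in> C"
proof (rule monic_family_projection_surj[OF monic_slice_x degree_slice_x _ _ slice_x_root_bound])
  assume p: "clopen_part C C'"
  show "closed C" "C \<noteq> {}" "closed C'" "C \<inter> C' = {}" using p by (simp_all add: clopen_part_def)
  show "C \<union> C' = {(x, y). poly (slice_x y) x = 0}" using p by (simp add: clopen_part_def slice_curve_def poly_slice_x)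
qed (auto simp: poly_slice_x intro!: continuous_intros)

definition fibre :: "(complex \<times> complex) set \<Rightarrow> complex \<Rightarrow> complex set" where
  "fibre C x = {y. (x, y) \<in> C}"

lemma clopen_part_fibre:
  assumes "clopen_part C C'"
  shows "fibre C x \<union> fibre C' x = {y. poly (slice_y x) y = 0}" "fibre C x \<inter> fibre C' x = {}"
    "finite (fibre C x)" "finite (fibre C' x)"
proof -
  show un: "fibre C x \<union> fibre C' x = {y. poly (slice_y x) y = 0}"
  proof -
    have "fibre C x \<union> fibre C' x = fibre slice_curve x" using assms by (auto simp: clopen_part_def fibre_def)
    then show ?thesis by (simp add: fibre_def slice_curve_def poly_slice_y)
  qed
  show "fibre C x \<inter> fibre C' x = {}" using assms by (auto simp: clopen_part_def fibre_def)
  have "slice_y x \<noteq> 0" using monic_slice_y[of x] by auto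
  then have "finite {y. poly (slice_y x) y = 0}" by (rule poly_roots_finite)
  then show "finite (fibre C x)" "finite (fibre C' x)" unfolding un[symmetric] by auto
qed

definition branch_set :: "complex set" where
  "branch_set = {x. \<exists>y. poly (slice_y x) y = 0 \<and> poly (pderiv (slice_y x)) y = 0}"

text \<open>The derivative in \<open>y\<close> factors as \<open>y^5 * (7 * y + 6 * t * x)\<close>.
  Either \<open>y = 0\<close> and \<open>x^5 + 1 = 0\<close>, or \<open>y = - (6/7) * t * x\<close>,
  and substitution gives \<open>c * x^7 + x^5 + 1 = 0\<close>. Both polynomials are nonzero because
  they take the value 1 at 0.\<close>

lemma finite_branch_set: "finite branch_set"
proof -
  define c where "c = (6/7)^6 * t^7 / 7"
  let ?P = "monom 1 5 + [:1:] :: complex poly" and ?W = "monom c 7 + (monom 1 5 + [:1:]) :: complex poly"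
  have nz: "?P \<noteq> 0" "?W \<noteq> 0"
  proof -
    have "poly ?P 0 = 1" "poly ?W 0 = 1" by (simp_all add: poly_monom)
    then show "?P \<noteq> 0" "?W \<noteq> 0" by (metis poly_0 zero_neq_one)+
  qed
  have "branch_set \<subseteq> {x. poly ?P x = 0} \<union> {x. poly ?W x = 0}"
  proof
    fix x assume "x \<in> branch_set"
    then obtain y where y: "poly (slice_y x) y = 0" "poly (pderiv (slice_y x)) y = 0" by (auto simp: branch_set_def)
    have "poly (pderiv (slice_y x)) y = 7 * y^6 + 6 * (t * x) * y^5"
      by (simp add: slice_y_def pderiv_add pderiv_monom poly_monom pderiv_pCons)
    also have "\<dots> = y^5 * (7 * y + 6 * t * x)" by (simp add: eval_nat_numeral algebra_simps)
    finally have "y = 0 \<or> 7 * y + 6 * t * x = 0" using y(2) by simp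
    then show "x \<in> {x. poly ?P x = 0} \<union> {x. poly ?W x = 0}"
    proof
      assume "y = 0"
      then show ?thesis using y(1) by (simp add: poly_slice_y poly_monom)
    next
      assume "7 * y + 6 * t * x = 0"
      then have "7 * y = - (6 * t * x)" by (simp add: eq_neg_iff_add_eq_0)
      then have "y = - (6 / 7) * (t * x)" by (simp add: field_simps)
      then have "y^6 = (6/7)^6 * (t * x)^6" "y + t * x = t * x / 7"
        by (simp_all add: power_mult_distrib power_divide)
      then have "y^6 * (y + t * x) = (6/7)^6 * (t * x)^6 * (t * x / 7)" by (simp only:)
      also have "\<dots> = c * x^7" by (simp add: c_def power_mult_distrib eval_nat_numeral)
      finally have "c * x^7 + (x^5 + 1) = y^6 * (y + t * x) + (x^5 + 1)" by simp
      also have "\<dots> = poly (slice_y x) y" by (simp add: poly_slice_y algebra_simps eval_nat_numeral)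
      finally show ?thesis using y(1) by (simp add: poly_monom)
    qed
  qed
  then show ?thesis by (rule finite_subset) (intro finite_UnI poly_roots_finite nz)
qed

lemma card_fibre_sum:
  assumes "clopen_part C C'"
  shows "card (fibre C x) + card (fibre C' x) \<le> 7"
    and "x \<notin> branch_set \<Longrightarrow> card (fibre C x) + card (fibre C' x) = 7"
proof -
  note P = clopen_part_fibre[OF assms, of x]
  have eq: "card (fibre C x) + card (fibre C' x) = card {y. poly (slice_y x) y = 0}"
    unfolding P(1)[symmetric] using P by (intro card_Un_disjoint[symmetric]) auto
  have "slice_y x \<noteq> 0" using monic_slice_y[of x] by auto
  then show "card (fibre C x) + card (fibre C' x) \<le> 7"
    unfolding eq degree_slice_y[of x, symmetric] by (rule card_poly_roots_bound)
  assume "x \<notin> branch_set"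
  then have "rsquarefree (slice_y x)" unfolding rsquarefree_roots branch_set_def by blast
  then show "card (fibre C x) + card (fibre C' x) = 7"
    unfolding eq degree_slice_y[of x, symmetric] by (rule card_roots_rsquarefree)
qed

text \<open>Every point of the fibre over \<open>x1\<close> continues to a root over nearby
  \<open>x\<close> in the same part, so neither count can drop. Their sum is already 7 at
  \<open>x1\<close> and never exceeds 7, so neither can grow.\<close>

lemma card_fibre_locally_constant:
  assumes part: "clopen_part C C'" and x1: "x1 \<notin> branch_set"
  shows "\<forall>\<^sub>F x in nhds x1. card (fibre C x) = card (fibre C x1)"
proof -
  note P = clopen_part_fibre[OF part, of x1]
  let ?R = "fibre C x1 \<union> fibre C' x1"
  have fin: "finite ?R" using P(3,4) by (rule finite_UnI)
  \<comment> \<open>The part that does not contain \<open>(x1, y)\<close>; staying off this closed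
    set keeps the continued root in the part of \<open>y\<close>.\<close>
  define S where "S y = (if y \<in> fibre C x1 then C' else C)" for y
  have S: "closed (S y)" "y \<in> ?R \<Longrightarrow> (x1, y) \<notin> S y" for y
    using part P(2) by (auto simp: S_def clopen_part_def fibre_def)
  \<comment> \<open>Radii of at most half the distance to the other roots keep the continued roots
    distinct.\<close>
  define Q where "Q y e U \<longleftrightarrow> 0 < e \<and> open U \<and> x1 \<in> U \<and> U \<times> ball y e \<subseteq> - S y \<and>
      (\<forall>y'\<in>?R. y' \<noteq> y \<longrightarrow> 2 * e \<le> dist y y')" for y e U
  have "\<exists>e U. Q y e U" if y: "y \<in> ?R" for y
  proof -
    obtain U V where UV: "open U" "open V" "(x1, y) \<in> U \<times> V" "U \<times> V \<subseteq> - S y"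
      using S y by (metis ComplI open_Compl open_prod_elim)
    obtain e1 where e1: "0 < e1" "ball y e1 \<subseteq> V" using UV by (auto simp: open_contains_ball)
    obtain d where d: "0 < d" "\<forall>y'\<in>?R. y' \<noteq> y \<longrightarrow> d \<le> dist y y'" using finite_set_avoid[OF fin] by blast
    have "U \<times> ball y (min e1 (d/2)) \<subseteq> - S y" using UV(4) e1(2) by force
    moreover have "\<forall>y'\<in>?R. y' \<noteq> y \<longrightarrow> 2 * min e1 (d/2) \<le> dist y y'" using d(2) by force
    ultimately show ?thesis using e1 d UV unfolding Q_def
      by (intro exI[of _ "min e1 (d/2)"] exI[of _ U]) auto
  qed
  then obtain e U where "\<And>y. y \<in> ?R \<Longrightarrow> Q y (e y) (U y)" by metis
  then have eU: "\<And>y. y \<in> ?R \<Longrightarrow> 0 < e y" "\<And>y. y \<in> ?R \<Longrightarrow> open (U y)"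
     "\<And>y. y \<in> ?R \<Longrightarrow> x1 \<in> U y" "\<And>y. y \<in> ?R \<Longrightarrow> U y \<times> ball y (e y) \<subseteq> - S y"
     "\<And>y y'. y \<in> ?R \<Longrightarrow> y' \<in> ?R \<Longrightarrow> y' \<noteq> y \<Longrightarrow> 2 * e y \<le> dist y y'"
    unfolding Q_def by blast+
  have "\<forall>\<^sub>F x in nhds x1. (\<exists>z. poly (slice_y x) z = 0 \<and> dist y z < e y) \<and> x \<in> U y" if y: "y \<in> ?R" for y
  proof (rule eventually_conj)
    show "\<forall>\<^sub>F x in nhds x1. \<exists>z. poly (slice_y x) z = 0 \<and> dist y z < e y"
      using P(1) y by (intro nearby_root[OF monic_slice_y degree_slice_y _ _ _ eU(1)])
        (auto simp: poly_slice_y intro!: continuous_intros)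
    show "\<forall>\<^sub>F x in nhds x1. x \<in> U y" using eU y by (intro eventually_nhds_in_open) auto
  qed
  then have "\<forall>\<^sub>F x in nhds x1. \<forall>y\<in>?R. (\<exists>z. poly (slice_y x) z = 0 \<and> dist y z < e y) \<and> x \<in> U y"
    by (intro eventually_ball_finite fin) blast
  then show ?thesis
  proof eventually_elim
    case (elim x)
    then obtain f where f: "\<And>y. y \<in> ?R \<Longrightarrow> poly (slice_y x) (f y) = 0 \<and> dist y (f y) < e y"
      by metis
    have xU: "x \<in> U y" if "y \<in> ?R" for y using elim that by blast
    have inj: "inj_on f ?R"
    proof (rule inj_onI, rule ccontr)
      fix y y' assume y: "y \<in> ?R" "y' \<in> ?R" "f y = f y'" "y \<noteq> y'"
      have "dist y y' \<le> dist y (f y) + dist y' (f y')" using y(3) dist_triangle2[of y y' "f y"] by simp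
      also have "\<dots> < e y + e y'"
        using conjunct2[OF f[OF y(1)]] conjunct2[OF f[OF y(2)]] by (rule add_strict_mono)
      also have "\<dots> \<le> dist y y'" using eU(5)[OF y(1,2)] eU(5)[OF y(2,1)] y(4) by (simp add: dist_commute)
      finally show False by simp
    qed
    have root: "f y \<in> fibre C x \<union> fibre C' x" "(x, f y) \<notin> S y" if "y \<in> ?R" for y
    proof -
      show "f y \<in> fibre C x \<union> fibre C' x" using f[OF that] clopen_part_fibre(1)[OF part, of x] by blast
      have "(x, f y) \<in> U y \<times> ball y (e y)" using f[OF that] xU[OF that] by simp
      then show "(x, f y) \<notin> S y" using eU(4)[OF that] by blast
    qed
    have "f ` fibre C x1 \<subseteq> fibre C x" using root by (force simp: S_def fibre_def)
    then have c1: "card (fibre C x1) \<le> card (fibre C x)"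
      using clopen_part_fibre(3)[OF part] inj by (metis card_inj_on_le inj_on_subset Un_upper1)
    have "f ` fibre C' x1 \<subseteq> fibre C' x"
    proof
      fix z assume "z \<in> f ` fibre C' x1"
      then obtain y where y: "y \<in> fibre C' x1" "z = f y" by blast
      then have "S y = C" using P(2) by (auto simp: S_def)
      then show "z \<in> fibre C' x" using root[of y] y by (auto simp: fibre_def)
    qed
    then have "card (fibre C' x1) \<le> card (fibre C' x)"
      using clopen_part_fibre(4)[OF part] inj by (metis card_inj_on_le inj_on_subset Un_upper2)
    then show ?case using c1 card_fibre_sum(1)[OF part, of x] card_fibre_sum(2)[OF part x1] by linarith
  qed
qed

lemma card_fibre_constant:
  assumes "clopen_part C C'" "x \<notin> branch_set" "x' \<notin> branch_set"
  shows "card (fibre C x) = card (fibre C x')"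
proof (rule connected_local_const[of "- branch_set"])
  have "connected (UNIV - branch_set)"
    by (rule connected_open_delete_finite) (auto simp: finite_branch_set)
  then show "connected (- branch_set)" by (simp add: Compl_eq_Diff_UNIV)
  show "\<forall>a\<in>- branch_set. \<forall>\<^sub>F b in at a within - branch_set. card (fibre C a) = card (fibre C b)"
  proof
    fix a assume "a \<in> - branch_set"
    then have "\<forall>\<^sub>F x in nhds a. card (fibre C x) = card (fibre C a)"
      by (intro card_fibre_locally_constant[OF assms(1)]) auto
    then show "\<forall>\<^sub>F b in at a within - branch_set. card (fibre C a) = card (fibre C b)"
      by (auto simp: eventually_at_filter elim!: eventually_mono)
  qed
qed (use assms in auto)

text \<open>Over a fifth root \<open>b\<close> of \<open>-1\<close> six of the seven sheets meet in \<open>(b, 0)\<close>; hence a part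
  that misses this point has only one sheet near \<open>b\<close>.\<close>

lemma card_fibre_le_1:
  assumes part: "clopen_part C C'" and b: "(b, 0) \<in> C'"
  shows "\<forall>\<^sub>F x in nhds b. card (fibre C x) \<le> 1"
proof -
  have "(b, 0) \<in> slice_curve" using b part by (auto simp: clopen_part_def)
  then have b5: "b^5 = -1" by (simp add: slice_curve_def eq_neg_iff_add_eq_0)
  then have b0: "b \<noteq> 0" by auto
  \<comment> \<open>The divided difference of the equation in \<open>y\<close>. For two roots over
    the same \<open>x\<close> it vanishes as soon as they differ; on the diagonal it is the
    derivative.\<close>
  define q where "q x y z = power_quot 7 y z + t * x * power_quot 6 y z" for x y z
  have q: "poly (slice_y x) y - poly (slice_y x) z = q x y z * (y - z)" for x y z
  proof -
    have "q x y z * (y - z) = power_quot 7 y z * (y - z) + t * x * (power_quot 6 y z * (y - z))"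
      by (simp add: q_def algebra_simps)
    also have "\<dots> = poly (slice_y x) y - poly (slice_y x) z"
      unfolding poly_slice_y power_quot[symmetric] by (simp add: algebra_simps)
    finally show ?thesis ..
  qed
  obtain M where M: "\<And>x y. norm x \<le> norm b + 1 \<Longrightarrow> poly (slice_y x) y = 0 \<Longrightarrow> norm y \<le> M"
    using slice_y_root_bound by blast
  \<comment> \<open>Two distinct points of \<open>C\<close> over an \<open>x\<close> near
    \<open>b\<close> would give an element of \<open>B\<close>. As \<open>B\<close> is compact, its
    projection is closed, and it suffices that \<open>b\<close> is not in it.\<close>
  define B where "B = {w. (fst w, fst (snd w)) \<in> C} \<inter> {w. (fst w, snd (snd w)) \<in> C} \<inter>
     {w. q (fst w) (fst (snd w)) (snd (snd w)) = 0} \<inter> (cball b 1 \<times> (cball 0 M \<times> cball 0 M))"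
  have cC: "closed C" using part by (simp add: clopen_part_def)
  have "closed {w :: complex \<times> complex \<times> complex. (fst w, fst (snd w)) \<in> C}"
    using closed_vimage[OF cC, of "\<lambda>w :: complex \<times> complex \<times> complex. (fst w, fst (snd w))"]
    by (simp add: vimage_def continuous_intros)
  moreover have "closed {w :: complex \<times> complex \<times> complex. (fst w, snd (snd w)) \<in> C}"
    using closed_vimage[OF cC, of "\<lambda>w :: complex \<times> complex \<times> complex. (fst w, snd (snd w))"]
    by (simp add: vimage_def continuous_intros)
  moreover have "closed {w :: complex \<times> complex \<times> complex. q (fst w) (fst (snd w)) (snd (snd w)) = 0}"
    unfolding q_def power_quot_def by (intro closed_Collect_eq continuous_intros)
  ultimately have "compact B" unfolding B_def
    by (intro closed_Int_compact closed_Int compact_Times compact_cball)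
  then have "compact (fst ` B)" by (rule compact_continuous_image[rotated]) (intro continuous_intros)
  then have op: "open (- (fst ` B))" by (simp add: compact_imp_closed open_Compl)
  have "b \<notin> fst ` B"
  proof
    assume "b \<in> fst ` B"
    then obtain y z where yz: "(b, y) \<in> C" "(b, z) \<in> C" "q b y z = 0" by (auto simp: B_def)
    have only: "y = - (t * b)" if "(b, y) \<in> C" for y
    proof -
      have "y \<noteq> 0" using that b part by (auto simp: clopen_part_def)
      have "(b, y) \<in> slice_curve" using that part by (auto simp: clopen_part_def)
      then have "b^5 + t * b * y^6 + y^7 + 1 = 0" by (simp add: slice_curve_def)
      then have "y^6 * (y + t * b) = 0" using b5 by (simp add: algebra_simps eval_nat_numeral)
      then show ?thesis using \<open>y \<noteq> 0\<close> by (simp add: eq_neg_iff_add_eq_0)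
    qed
    let ?u = "t * b"
    \<comment> \<open>The only point of \<open>C\<close> over \<open>b\<close> is
      \<open>- (t * b)\<close>, a simple root: the derivative there equals \<open>(t * b)^6\<close>,
      which is nonzero.\<close>
    have "q b (- ?u) (- ?u) = 7 * ?u^6 - ?u * (6 * ?u^5)"
      unfolding q_def power_quot_diag by simp
    also have "\<dots> = ?u^6" by (simp add: eval_nat_numeral)
    finally have "?u^6 = 0" using yz(3) only[OF yz(1)] only[OF yz(2)] by simp
    then show False using t b0 by simp
  qed
  then have "\<forall>\<^sub>F x in nhds b. x \<in> - (fst ` B) \<inter> ball b 1"
    using op by (intro eventually_nhds_in_open) auto
  then show ?thesis
  proof eventually_elim
    case (elim x)
    then have dx: "dist b x \<le> 1" by simp
    then have nx: "norm x \<le> norm b + 1" using norm_triangle_ineq2[of x b] by (simp add: dist_norm norm_minus_commute)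
    have "y = z" if "y \<in> fibre C x" "z \<in> fibre C x" for y z
    proof (rule ccontr)
      assume "y \<noteq> z"
      have r: "poly (slice_y x) y = 0" "poly (slice_y x) z = 0" using that clopen_part_fibre(1)[OF part, of x] by auto
      then have "q x y z = 0" using q[of x y z] \<open>y \<noteq> z\<close> by simp
      then have "(x, y, z) \<in> B" using that dx M[OF nx r(1)] M[OF nx r(2)] by (simp add: B_def fibre_def)
      then show False using elim by force
    qed
    then show ?case using clopen_part_fibre(3)[OF part, of x] by (simp add: card_le_Suc0_iff_eq)
  qed
qed

lemma ex_card_fibre_le_1:
  assumes part: "clopen_part C C'" and b: "(b, 0) \<in> C'"
  shows "\<exists>x. x \<notin> branch_set \<and> card (fibre C x) \<le> 1"
proof -
  have "\<forall>\<^sub>F x in at b. card (fibre C x) \<le> 1"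
    using card_fibre_le_1[OF assms] by (auto simp: eventually_at_filter elim: eventually_mono)
  moreover have "\<forall>\<^sub>F x in at b. x \<notin> branch_set"
    using islimpt_iff_eventually[of b branch_set] finite_branch_set by (simp add: islimpt_finite)
  ultimately have "\<forall>\<^sub>F x in at b. x \<notin> branch_set \<and> card (fibre C x) \<le> 1" by eventually_elim simp
  then show ?thesis using eventually_happens'[of "at b"] by (auto simp: trivial_limit_at)
qed

lemma closed_slice_curve: "closed slice_curve"
proof -
  have "slice_curve = {w. fst w ^ 5 + t * fst w * snd w ^ 6 + snd w ^ 7 + 1 = 0}" by (auto simp: slice_curve_def)
  then show ?thesis by (simp only:) (intro closed_Collect_eq continuous_intros)
qed

text \<open>If the curve split into \<open>A\<close> and \<open>B\<close>, each would contain a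
  point \<open>(a, 0)\<close> and thereby leave the other at most one sheet. The sheet numbers are
  constant off the branch set and add up to 7, whereas this allows at most 2.\<close>

lemma connected_slice_curve: "connected slice_curve"
  unfolding connected_closed_set[OF closed_slice_curve]
proof
  assume "\<exists>A B. closed A \<and> closed B \<and> A \<noteq> {} \<and> B \<noteq> {} \<and> A \<union> B = slice_curve \<and> A \<inter> B = {}"
  then obtain A B where p: "clopen_part A B" "clopen_part B A" by (auto simp: clopen_part_def Un_commute Int_commute)
  obtain a where a: "(a, 0) \<in> A" using clopen_part_surj[OF p(1)] by blast
  obtain b where b: "(b, 0) \<in> B" using clopen_part_surj[OF p(2)] by blast
  obtain x where x: "x \<notin> branch_set" "card (fibre B x) \<le> 1" using ex_card_fibre_le_1[OF p(2) a] by blast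
  obtain x' where x': "x' \<notin> branch_set" "card (fibre A x') \<le> 1" using ex_card_fibre_le_1[OF p(1) b] by blast
  show False
    using card_fibre_sum(2)[OF p(1) x(1)] card_fibre_constant[OF p(1) x(1) x'(1)] x(2) x'(2) by linarith
qed

end

section \<open>Weighted scaling and the link\<close>

text \<open>With weights 3, 2, 1 for \<open>x\<close>, \<open>y\<close>, \<open>z\<close> all four
  monomials have weight 15; for \<open>t * x * y^6\<close> this is \<open>3 + 12\<close>, so every
  surface of the family is invariant.\<close>

lemma Xt_weighted_scaling:
  "vector [s^3 * v$1, s^2 * v$2, s * v$3] \<in> Xt t \<longleftrightarrow> s = 0 \<or> v \<in> Xt t"
proof -
  have "(s^3 * v$1)^5 + (s * v$3)^15 + (s^2 * v$2)^7 * (s * v$3) + t * (s^3 * v$1) * (s^2 * v$2)^6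
     = s^15 * ((v$1)^5 + (v$3)^15 + (v$2)^7 * v$3 + t * v$1 * (v$2)^6)"
    by (simp add: power_mult_distrib power_mult[symmetric] distrib_left mult.left_commute mult.assoc
        power_add[symmetric] flip: power_Suc2 power_Suc power_add)
  then show ?thesis by (simp add: Xt_def)
qed

lemma continuous_on_vector3:
  fixes a b c :: "'a::topological_space \<Rightarrow> complex"
  assumes "continuous_on S a" "continuous_on S b" "continuous_on S c"
  shows "continuous_on S (\<lambda>x. vector [a x, b x, c x] :: complex^3)"
proof -
  have eq: "(\<lambda>x. vector [a x, b x, c x] :: complex^3) =
      (\<lambda>x. \<chi> i. if i = 1 then a x else if i = 2 then b x else c x)"
    by (simp add: fun_eq_iff vec_eq_iff forall_3)
  show ?thesis unfolding eq
  proof (rule continuous_on_vec_lambda)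
    fix i :: 3
    show "continuous_on S (\<lambda>x. if i = 1 then a x else if i = 2 then b x else c x)"
      using assms by (cases "i = 1"; cases "i = 2") simp_all
  qed
qed

text \<open>The points with \<open>z \<noteq> 0\<close> are the image of the punctured plane times
  the plane section. The remaining nonzero points lie in its closure, and a set between a connected
  set and its closure is connected.\<close>

lemma connected_Xt_minus_0:
  assumes t: "t \<noteq> 0"
  shows "connected (Xt t - {0})"
proof -
  let ?f = "\<lambda>w. vector [fst w ^ 3 * fst (snd w), fst w ^ 2 * snd (snd w), fst w] :: complex^3"
  let ?D = "(- {0}) \<times> slice_curve t"
  have "continuous_on ?D ?f" by (intro continuous_on_vector3 continuous_intros)
  then have conn: "connected (?f ` ?D)"
    by (rule connected_continuous_image) (intro connected_Times connected_slice_curve t connected_punctured_universe, simp)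
  have in_slice: "(x, y) \<in> slice_curve t \<longleftrightarrow> vector [x, y, 1] \<in> Xt t" for x y
    by (simp add: slice_curve_def[OF t] Xt_def algebra_simps)
  have im: "v \<in> ?f ` ?D \<longleftrightarrow> v \<in> Xt t \<and> v$3 \<noteq> 0" for v
  proof
    assume "v \<in> ?f ` ?D"
    then obtain w where w: "w \<in> ?D" "v = ?f w" by blast
    then show "v \<in> Xt t \<and> v$3 \<noteq> 0"
      using Xt_weighted_scaling[of "fst w" "vector [fst (snd w), snd (snd w), 1]" t]
        in_slice[of "fst (snd w)" "snd (snd w)"] by (auto simp: mem_Times_iff)
  next
    assume v: "v \<in> Xt t \<and> v$3 \<noteq> 0"
    let ?s = "v$3" and ?x = "v$1 / (v$3)^3" and ?y = "v$2 / (v$3)^2"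
    have eq: "vector [?s^3 * ?x, ?s^2 * ?y, ?s] = v" using v by (simp add: vec_eq_iff forall_3)
    then have "vector [?x, ?y, 1] \<in> Xt t"
      using Xt_weighted_scaling[of ?s "vector [?x, ?y, 1]" t] v by simp
    then have "(?s, ?x, ?y) \<in> ?D" using v in_slice by simp
    then show "v \<in> ?f ` ?D" by (rule rev_image_eqI) (simp only: fst_conv snd_conv eq)
  qed
  show ?thesis
  proof (rule connected_intermediate_closure[OF conn])
    show "?f ` ?D \<subseteq> Xt t - {0}"
    proof
      fix v assume "v \<in> ?f ` ?D"
      then show "v \<in> Xt t - {0}" unfolding im by auto
    qed
    show "Xt t - {0} \<subseteq> closure (?f ` ?D)"
    proof
      fix v assume "v \<in> Xt t - {0}"
      then have vX: "v \<in> Xt t" by simp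
      show "v \<in> closure (?f ` ?D)"
      proof (cases "v$3 = 0")
        case False
        then have "v \<in> ?f ` ?D" unfolding im using vX by simp
        then show ?thesis by (rule subsetD[OF closure_subset])
      next
        case True
        \<comment> \<open>For fixed \<open>y = v$2\<close> the equation is a monic quintic in
          \<open>x\<close> that varies continuously with \<open>z\<close>; a small nonzero
          \<open>z\<close> therefore has a solution near \<open>v\<close>.\<close>
        define p where "p z = monom 1 5 + [:z^15 + (v$2)^7 * z, t * (v$2)^6:]" for z :: complex
        have pp: "poly (p z) x = x^5 + z^15 + (v$2)^7 * z + t * x * (v$2)^6" for z x
          by (simp add: p_def poly_monom algebra_simps)
        have deg: "degree (p z) = 5" for z
          unfolding p_def by (subst degree_add_eq_left) (auto simp: degree_monom_eq)
        have lc: "lead_coeff (p z) = 1" for z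
          unfolding deg by (simp add: p_def coeff_pCons split: nat.split)
        have cont: "continuous_on UNIV (\<lambda>z. poly (p z) x)" for x
          unfolding pp by (intro continuous_intros)
        have z0: "poly (p 0) (v$1) = 0" using vX True by (simp add: pp Xt_def)
        show ?thesis
          unfolding closure_approachable
        proof (intro allI impI)
          fix e :: real assume e: "0 < e"
          have "\<forall>\<^sub>F z in nhds 0. \<exists>x. poly (p z) x = 0 \<and> dist (v$1) x < e / 2"
            using e by (intro nearby_root[OF lc deg _ cont z0]) auto
          moreover have "\<forall>\<^sub>F z in nhds (0::complex). z \<in> ball 0 (e / 2)"
            using e by (intro eventually_nhds_in_open) auto
          ultimately have "\<forall>\<^sub>F z in nhds 0. \<exists>x. poly (p z) x = 0 \<and> dist (v$1) x < e / 2 \<and> norm z < e / 2"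
            by eventually_elim auto
          then have "\<forall>\<^sub>F z in at 0. z \<noteq> 0 \<and> (\<exists>x. poly (p z) x = 0 \<and> dist (v$1) x < e / 2 \<and> norm z < e / 2)"
            by (auto simp: eventually_at_filter elim: eventually_mono)
          from eventually_happens'[OF at_neq_bot this] obtain z x where zx: "z \<noteq> 0" "poly (p z) x = 0" "dist (v$1) x < e / 2" "norm z < e / 2" by blast
          let ?w = "vector [x, v$2, z] :: complex^3"
          have "?w \<in> Xt t" using zx(2) by (simp add: pp Xt_def)
          then have "?w \<in> ?f ` ?D" unfolding im using zx(1) by simp
          moreover have "dist ?w v < e"
            using dist_vec3_le[of ?w v] zx(3,4) True by (simp add: dist_commute)
          ultimately show "\<exists>w\<in>?f ` ?D. dist w v < e" by blast
        qed
      qed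
    qed
  qed
qed

lemma norm_vec3_sq: "norm (v :: complex^3) ^ 2 = norm (v$1) ^ 2 + norm (v$2) ^ 2 + norm (v$3) ^ 2"
  by (simp add: norm_vec_def L2_set_def sum_3)

text \<open>Pushing along the weighted scaling maps the connected set \<open>X\<^sub>t - {0}\<close> onto each link.\<close>

lemma connected_link_Xt:
  assumes t: "t \<noteq> 0"
  shows "connected_link (Xt t) 0"
proof -
  have "connected (Xt t \<inter> sphere 0 \<epsilon>)" if e: "0 < \<epsilon>" for \<epsilon> :: real
  proof -
    \<comment> \<open>The squared norm of the scaled point \<open>T r v\<close>. It increases
      strictly in \<open>r \<ge> 0\<close> for \<open>v \<noteq> 0\<close>, so each orbit meets the
      sphere exactly once.\<close>
    define F where "F r v = r^6 * norm (v$1)^2 + r^4 * norm (v$2)^2 + r^2 * norm (v$3)^2" for r :: real and v :: "complex^3"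
    define T where "T r v = (vector [of_real r ^ 3 * v$1, of_real r ^ 2 * v$2, of_real r * v$3] :: complex^3)" for r :: real and v :: "complex^3"
    have FT: "norm (T r v) ^ 2 = F r v" for r v
      by (simp add: norm_vec3_sq T_def F_def norm_mult norm_power power_mult_distrib flip: power_mult)
    have mono: "F r v < F s v" if rs: "0 \<le> r" "r < s" "v \<noteq> 0" for r s v
    proof -
      have le: "r^6 \<le> s^6" "r^4 \<le> s^4" "r^2 \<le> s^2" using rs by (intro power_mono; simp)+
      have lt: "r^6 < s^6" "r^4 < s^4" "r^2 < s^2" using rs by (intro power_strict_mono; simp)+
      have "v$1 \<noteq> 0 \<or> v$2 \<noteq> 0 \<or> v$3 \<noteq> 0" using rs(3) by (auto simp: vec_eq_iff forall_3)
      then show ?thesis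
      proof (elim disjE)
        assume "v$1 \<noteq> 0"
        then show ?thesis unfolding F_def using le lt
          by (intro add_less_le_mono mult_strict_right_mono mult_right_mono) auto
      next
        assume "v$2 \<noteq> 0"
        then show ?thesis unfolding F_def using le lt
          by (intro add_less_le_mono add_le_less_mono mult_strict_right_mono mult_right_mono) auto
      next
        assume "v$3 \<noteq> 0"
        then show ?thesis unfolding F_def using le lt
          by (intro add_le_less_mono add_mono mult_strict_right_mono mult_right_mono) auto
      qed
    qed
    have ex: "\<exists>r>0. F r v = \<epsilon>^2" if v: "v \<noteq> 0" for v
    proof -
      \<comment> \<open>For \<open>M \<ge> 1\<close> every power of \<open>M\<close> in
        \<open>F\<close> is at least \<open>M^2\<close>, hence
        \<open>F M v \<ge> (M * norm v)^2 \<ge> \<epsilon>^2\<close>.\<close>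
      define M where "M = max 1 (\<epsilon> / norm v)"
      have M: "1 \<le> M" "\<epsilon> \<le> M * norm v" using v e by (auto simp: M_def field_simps max_def)
      have "\<epsilon>^2 \<le> (M * norm v)^2" using M e by (intro power_mono) auto
      also have "\<dots> = M^2 * norm (v$1)^2 + M^2 * norm (v$2)^2 + M^2 * norm (v$3)^2"
        by (simp add: power_mult_distrib norm_vec3_sq distrib_left)
      also have "\<dots> \<le> F M v" unfolding F_def using M(1)
        by (intro add_mono mult_right_mono power_increasing order_refl) auto
      finally have "\<epsilon>^2 \<le> F M v" .
      moreover have "F 0 v \<le> \<epsilon>^2" by (simp add: F_def)
      moreover have "continuous_on {0..M} (\<lambda>r. F r v)" unfolding F_def by (intro continuous_intros)
      ultimately obtain r where r: "0 \<le> r" "F r v = \<epsilon>^2"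
        using IVT'[of "\<lambda>r. F r v" 0 "\<epsilon>^2" M] M(1) by auto
      moreover have "r \<noteq> 0" using r(2) e by (auto simp: F_def)
      ultimately show ?thesis by (intro exI[of _ r]) auto
    qed
    define \<rho> where "\<rho> v = (SOME r. 0 < r \<and> F r v = \<epsilon>^2)" for v
    have \<rho>: "0 < \<rho> v" "F (\<rho> v) v = \<epsilon>^2" if "v \<noteq> 0" for v
      using someI_ex[of "\<lambda>r. 0 < r \<and> F r v = \<epsilon>^2"] ex[OF that] unfolding \<rho>_def by auto
    have contF: "continuous_on UNIV (F r)" for r unfolding F_def by (intro continuous_intros)
    \<comment> \<open>Monotonicity turns comparisons of \<open>\<rho>\<close> with a constant into
      strict inequalities for \<open>F c\<close>, which are open conditions; this yields continuity
      of \<open>\<rho>\<close>.\<close>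
    have less1: "\<rho> v < c \<longleftrightarrow> \<epsilon>^2 < F c v" and less2: "c < \<rho> v \<longleftrightarrow> F c v < \<epsilon>^2" if "v \<noteq> 0" "0 < c" for v c
      using mono[of c "\<rho> v" v] mono[of "\<rho> v" c v] \<rho>[OF that(1)] that
      by (cases "\<rho> v" c rule: linorder_cases; auto)+
    have cont\<rho>: "continuous_on (Xt t - {0}) \<rho>"
      unfolding continuous_on_def
    proof (intro ballI order_tendstoI)
      fix v c assume v: "v \<in> Xt t - {0}" and c: "c < \<rho> v"
      show "\<forall>\<^sub>F w in at v within Xt t - {0}. c < \<rho> w"
      proof (cases "0 < c")
        case True
        have "open {w. F c w < \<epsilon>^2}" by (intro open_Collect_less contF continuous_on_const)
        moreover have "v \<in> {w. F c w < \<epsilon>^2}" using less2[of v c] v c True by simp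
        ultimately have "\<forall>\<^sub>F w in nhds v. w \<in> {w. F c w < \<epsilon>^2}" by (rule eventually_nhds_in_open)
        then show ?thesis using less2[OF _ True]
          by (auto simp: eventually_at_filter elim!: eventually_mono)
      next
        case False
        then have "c < \<rho> w" if "w \<noteq> 0" for w using \<rho>(1)[OF that] by simp
        then show ?thesis by (auto simp: eventually_at_filter)
      qed
    next
      fix v c assume v: "v \<in> Xt t - {0}" and c: "\<rho> v < c"
      then have c0: "0 < c" using \<rho>(1)[of v] by simp
      have "open {w. \<epsilon>^2 < F c w}" by (intro open_Collect_less contF continuous_on_const)
      moreover have "v \<in> {w. \<epsilon>^2 < F c w}" using less1[of v c] v c c0 by simp
      ultimately have "\<forall>\<^sub>F w in nhds v. w \<in> {w. \<epsilon>^2 < F c w}" by (rule eventually_nhds_in_open)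
      then show "\<forall>\<^sub>F w in at v within Xt t - {0}. \<rho> w < c" using less1[OF _ c0]
        by (auto simp: eventually_at_filter elim!: eventually_mono)
    qed
    have img: "(\<lambda>v. T (\<rho> v) v) ` (Xt t - {0}) = Xt t \<inter> sphere 0 \<epsilon>"
    proof (intro equalityI subsetI)
      fix w assume "w \<in> (\<lambda>v. T (\<rho> v) v) ` (Xt t - {0})"
      then obtain v where v: "v \<in> Xt t" "v \<noteq> 0" "w = T (\<rho> v) v" by auto
      have "norm w ^ 2 = \<epsilon>^2" using \<rho>(2)[OF v(2)] unfolding v(3) FT .
      then have "norm w = \<epsilon>" using e by (simp add: power2_eq_iff_nonneg)
      moreover have "w \<in> Xt t" unfolding v(3) T_def using Xt_weighted_scaling[of "of_real (\<rho> v)" v t] v(1) by blast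
      ultimately show "w \<in> Xt t \<inter> sphere 0 \<epsilon>" by simp
    next
      fix w assume w: "w \<in> Xt t \<inter> sphere 0 \<epsilon>"
      then have w0: "w \<noteq> 0" using e by auto
      have "F 1 w = \<epsilon>^2" using w by (simp add: F_def norm_vec3_sq[symmetric])
      then have "\<rho> w = 1" using less1[OF w0, of 1] less2[OF w0, of 1] by force
      then have "w = T (\<rho> w) w" by (simp add: T_def vec_eq_iff forall_3)
      then show "w \<in> (\<lambda>v. T (\<rho> v) v) ` (Xt t - {0})" using w w0 by blast
    qed
    have "continuous_on (Xt t - {0}) (\<lambda>v. T (\<rho> v) v)"
      unfolding T_def by (intro continuous_on_vector3 continuous_intros cont\<rho>)
    from connected_continuous_image[OF this connected_Xt_minus_0[OF t]] show ?thesis unfolding img .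
  qed
  then show ?thesis unfolding connected_link_def
    using eventually_at_right_less[of "0::real"] by (auto elim: eventually_mono)
qed

section \<open>The separating set for nonzero t\<close>

lemma norm_power_quot_le: "norm u \<le> 1 \<Longrightarrow> norm w \<le> 1 \<Longrightarrow> norm (power_quot n u w) \<le> of_nat n"
proof -
  assume uw: "norm u \<le> 1" "norm w \<le> 1"
  have "norm (power_quot n u w) \<le> (\<Sum>i<n. norm (w ^ (n - Suc i) * u ^ i))"
    unfolding power_quot_def by (rule norm_sum)
  also have "\<dots> \<le> (\<Sum>i<n. 1)"
    using uw by (intro sum_mono) (simp add: norm_mult norm_power mult_le_one power_le_one)
  finally show ?thesis by simp
qed

lemma quintic_branch:
  fixes t \<tau> :: complex
  assumes root: "\<tau>^5 + t * \<tau> = 0" and simple: "5 * \<tau>^4 + t \<noteq> 0"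
  obtains a0 where "0 < a0"
    "\<And>a. 0 < a \<Longrightarrow> a \<le> a0 \<Longrightarrow> \<exists>\<rho>0>0. \<forall>\<rho>. 0 < \<rho> \<and> \<rho> \<le> \<rho>0 \<longrightarrow>
      (\<exists>h L. L-lipschitz_on (cball 0 \<rho>) h \<and>
        (\<forall>\<zeta>. norm \<zeta> \<le> \<rho> \<longrightarrow> norm (h \<zeta> - \<tau>) < a \<and> h \<zeta> ^ 5 + t * h \<zeta> = - (\<zeta> + \<zeta>^15) \<and>
          (\<forall>h'. norm (h' - \<tau>) \<le> a \<and> h' ^ 5 + t * h' = - (\<zeta> + \<zeta>^15) \<longrightarrow> h' = h \<zeta>)))"
proof -
  define m where "m = norm (5 * \<tau>^4 + t)"
  have m: "0 < m" using simple by (simp add: m_def)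
  define k where "k z = power_quot 5 (fst z) (snd z) + t" for z
  have "continuous_on UNIV k" unfolding k_def power_quot_def by (intro continuous_intros)
  then have "open {z. m / 2 < norm (k z)}" by (intro open_Collect_less continuous_intros) auto
  moreover have "(\<tau>, \<tau>) \<in> {z. m / 2 < norm (k z)}" using m by (simp add: k_def power_quot_diag m_def)
  ultimately obtain U V where UV: "open U" "open V" "(\<tau>, \<tau>) \<in> U \<times> V" "U \<times> V \<subseteq> {z. m / 2 < norm (k z)}"
    by (rule open_prod_elim)
  then have "open (U \<inter> V)" "\<tau> \<in> U \<inter> V" by auto
  then obtain a0 where a0: "0 < a0" "cball \<tau> a0 \<subseteq> U \<inter> V"
    unfolding open_contains_cball by blast
  have psi: "u^5 + t * u - (w^5 + t * w) = k (u, w) * (u - w)" for u w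
  proof -
    have "k (u, w) * (u - w) = power_quot 5 u w * (u - w) + t * (u - w)" by (simp add: k_def distrib_right)
    then show ?thesis unfolding power_quot[symmetric] by (simp add: right_diff_distrib)
  qed
  have lower: "m / 2 * norm (u - w) \<le> norm (u^5 + t * u - (w^5 + t * w))"
    if "norm (u - \<tau>) \<le> a0" "norm (w - \<tau>) \<le> a0" for u w
  proof -
    have "(u, w) \<in> U \<times> V" using that a0(2) by (auto simp: dist_norm norm_minus_commute subset_iff)
    then have "m / 2 < norm (k (u, w))" using UV(4) by blast
    then show ?thesis unfolding psi norm_mult by (intro mult_right_mono) auto
  qed
  show ?thesis
  proof (rule that[OF a0(1)])
    fix a :: real assume a: "0 < a" "a \<le> a0"
    show "\<exists>\<rho>0>0. \<forall>\<rho>. 0 < \<rho> \<and> \<rho> \<le> \<rho>0 \<longrightarrow>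
      (\<exists>h L. L-lipschitz_on (cball 0 \<rho>) h \<and>
        (\<forall>\<zeta>. norm \<zeta> \<le> \<rho> \<longrightarrow> norm (h \<zeta> - \<tau>) < a \<and> h \<zeta> ^ 5 + t * h \<zeta> = - (\<zeta> + \<zeta>^15) \<and>
          (\<forall>h'. norm (h' - \<tau>) \<le> a \<and> h' ^ 5 + t * h' = - (\<zeta> + \<zeta>^15) \<longrightarrow> h' = h \<zeta>)))"
    \<comment> \<open>At \<open>\<tau>\<close> the perturbed quintic has modulus at most
      \<open>2 * norm \<zeta> \<le> a^5 / 2\<close>, which forces a root at distance less than
      \<open>a\<close>.\<close>
    proof (intro exI[of _ "min 1 (a^5 / 4)"] conjI allI impI)
      show "0 < min 1 (a^5 / 4)" using a by simp
      fix \<rho> assume \<rho>: "0 < \<rho> \<and> \<rho> \<le> min 1 (a^5 / 4)"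
      have phi: "norm (\<zeta> + \<zeta>^15 - (\<xi> + \<xi>^15)) \<le> 16 * norm (\<zeta> - \<xi>)"
        if "norm \<zeta> \<le> \<rho>" "norm \<xi> \<le> \<rho>" for \<zeta> \<xi> :: complex
      proof -
        have "\<zeta> + \<zeta>^15 - (\<xi> + \<xi>^15) = (\<zeta> - \<xi>) + power_quot 15 \<zeta> \<xi> * (\<zeta> - \<xi>)"
          unfolding power_quot[symmetric] by simp
        then have "norm (\<zeta> + \<zeta>^15 - (\<xi> + \<xi>^15)) \<le> norm (\<zeta> - \<xi>) + norm (power_quot 15 \<zeta> \<xi>) * norm (\<zeta> - \<xi>)"
          by (metis norm_mult norm_triangle_ineq)
        also have "norm (power_quot 15 \<zeta> \<xi>) * norm (\<zeta> - \<xi>) \<le> 15 * norm (\<zeta> - \<xi>)"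
          using norm_power_quot_le[of \<zeta> \<xi> 15] that \<rho> by (intro mult_right_mono) auto
        finally show ?thesis by simp
      qed
      have ex: "\<exists>h. norm (h - \<tau>) < a \<and> h^5 + t * h = - (\<zeta> + \<zeta>^15)" if z: "norm \<zeta> \<le> \<rho>" for \<zeta>
      proof -
        let ?p = "monom 1 5 + [:\<zeta> + \<zeta>^15, t:]"
        have val: "poly ?p x = x^5 + t * x + (\<zeta> + \<zeta>^15)" for x by (simp add: poly_monom algebra_simps)
        have deg: "degree ?p = 5" by (subst degree_add_eq_left) (auto simp: degree_monom_eq)
        have lc: "lead_coeff ?p = 1" unfolding deg by (simp add: coeff_pCons split: nat.split)
        obtain h where h: "poly ?p h = 0" "norm (\<tau> - h) ^ 5 \<le> norm (poly ?p \<tau>)"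
          by (rule monic_root_near[OF lc deg]) auto
        have "norm (poly ?p \<tau>) = norm (\<zeta> + \<zeta>^15)" unfolding val root by simp
        also have "\<dots> \<le> norm \<zeta> + norm \<zeta> ^ 15" by (metis norm_power norm_triangle_ineq)
        also have "norm \<zeta> ^ 15 \<le> norm \<zeta> ^ 1" using z \<rho> by (intro power_decreasing) auto
        also have "norm \<zeta> + norm \<zeta> ^ 1 < a^5"
        proof -
          have "norm \<zeta> \<le> a^5 / 4" "0 < a^5" using z \<rho> a by auto
          then show ?thesis unfolding power_one_right by linarith
        qed
        finally have "norm (\<tau> - h) ^ 5 < a^5" using h(2) by simp
        then have "norm (\<tau> - h) < a" using a by (simp add: power_less_imp_less_base)
        then show ?thesis using h(1) unfolding val
          by (intro exI[of _ h]) (simp only: norm_minus_commute eq_neg_iff_add_eq_0)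
      qed
      define h where "h \<zeta> = (SOME h. norm (h - \<tau>) < a \<and> h^5 + t * h = - (\<zeta> + \<zeta>^15))" for \<zeta>
      have h: "norm (h \<zeta> - \<tau>) < a" "h \<zeta> ^ 5 + t * h \<zeta> = - (\<zeta> + \<zeta>^15)" if "norm \<zeta> \<le> \<rho>" for \<zeta>
        using someI_ex[OF ex[OF that]] unfolding h_def by auto
      have uniq: "h' = h \<zeta>" if "norm \<zeta> \<le> \<rho>" "norm (h' - \<tau>) \<le> a" "h' ^ 5 + t * h' = - (\<zeta> + \<zeta>^15)" for \<zeta> h'
      proof -
        have "m / 2 * norm (h' - h \<zeta>) \<le> norm (h'^5 + t * h' - (h \<zeta> ^ 5 + t * h \<zeta>))"
          using that h[OF that(1)] a by (intro lower) auto
        also have "\<dots> = 0" using that(3) h(2)[OF that(1)] by simp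
        finally show ?thesis using m by (simp add: mult_le_0_iff)
      qed
      have "(32 / m)-lipschitz_on (cball 0 \<rho>) h"
      proof (rule lipschitz_onI)
        fix \<zeta> \<xi> :: complex assume "\<zeta> \<in> cball 0 \<rho>" "\<xi> \<in> cball 0 \<rho>"
        then have n: "norm \<zeta> \<le> \<rho>" "norm \<xi> \<le> \<rho>" by auto
        have "m / 2 * norm (h \<zeta> - h \<xi>) \<le> norm (h \<zeta> ^ 5 + t * h \<zeta> - (h \<xi> ^ 5 + t * h \<xi>))"
          using h(1)[OF n(1)] h(1)[OF n(2)] a by (intro lower) auto
        also have "\<dots> = norm (\<xi> + \<xi>^15 - (\<zeta> + \<zeta>^15))" unfolding h(2)[OF n(1)] h(2)[OF n(2)]
          by (rule arg_cong[of _ _ norm]) (simp add: algebra_simps)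
        also have "\<dots> \<le> 16 * norm (\<zeta> - \<xi>)" using phi[OF n(2,1)] by (simp add: norm_minus_commute)
        finally show "dist (h \<zeta>) (h \<xi>) \<le> 32 / m * dist \<zeta> \<xi>" using m by (simp add: dist_norm field_simps)
      qed (use m in simp)
      then show "\<exists>h L. L-lipschitz_on (cball 0 \<rho>) h \<and>
        (\<forall>\<zeta>. norm \<zeta> \<le> \<rho> \<longrightarrow> norm (h \<zeta> - \<tau>) < a \<and> h \<zeta> ^ 5 + t * h \<zeta> = - (\<zeta> + \<zeta>^15) \<and>
          (\<forall>h'. norm (h' - \<tau>) \<le> a \<and> h' ^ 5 + t * h' = - (\<zeta> + \<zeta>^15) \<longrightarrow> h' = h \<zeta>))"
        using h uniq by blast
    qed
  qed
qed

text \<open>The chart of a sheet over \<open>y \<noteq> 0\<close>: putting \<open>y = s\<^sup>2\<close>, \<open>z = s \<zeta>\<close>, \<open>x = s\<^sup>3 h\<close> turns the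
  equation of \<open>X\<^sub>t\<close> into \<open>h\<^sup>5 + t h = - (\<zeta> + \<zeta>\<^sup>1\<^sup>5)\<close>.\<close>

definition sheet :: "(complex \<Rightarrow> complex) \<Rightarrow> complex \<times> complex \<Rightarrow> complex^3" where
  "sheet h w = vector [fst w ^ 3 * h (snd w), fst w ^ 2, fst w * snd w]"

lemma sheet_nth [simp]:
  "sheet h w $ 1 = fst w ^ 3 * h (snd w)" "sheet h w $ 2 = fst w ^ 2" "sheet h w $ 3 = fst w * snd w"
  by (simp_all add: sheet_def)

lemma sheet_in_Xt:
  assumes "h (snd w) ^ 5 + t * h (snd w) = - (snd w + snd w ^ 15)"
  shows "sheet h w \<in> Xt t"
proof -
  have "h (snd w) ^ 5 + snd w ^ 15 + snd w + t * h (snd w) = (h (snd w) ^ 5 + t * h (snd w)) + (snd w + snd w ^ 15)"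
    by (simp add: algebra_simps)
  then have "vector [h (snd w), 1, snd w] \<in> Xt t" unfolding assms by (simp add: Xt_def)
  then show ?thesis
    using Xt_weighted_scaling[of "fst w" "vector [h (snd w), 1, snd w]" t] by (simp add: sheet_def)
qed

text \<open>Changing the sign of the square root \<open>s\<close> changes only the signs of
  \<open>h\<close> and \<open>\<zeta>\<close>, so their moduli are functions of the point. The last
  equations turn bounds on them into inequalities between the moduli of the coordinates, free of
  roots.\<close>

lemma Xt_sheet_coordinates:
  assumes v: "v \<in> Xt t" "v$2 \<noteq> 0" and s: "s^2 = v$2"
  defines "h \<equiv> v$1 / s^3" and "\<zeta> \<equiv> v$3 / s"
  shows "s \<noteq> 0" "v$1 = s^3 * h" "v$3 = s * \<zeta>" "h^5 + t * h = - (\<zeta> + \<zeta>^15)"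
    "norm s ^ 2 = norm (v$2)" "norm (v$1) ^ 2 = norm h ^ 2 * norm (v$2) ^ 3" "norm (v$3) ^ 2 = norm \<zeta> ^ 2 * norm (v$2)"
proof -
  show s0: "s \<noteq> 0" using s v(2) by auto
  show e: "v$1 = s^3 * h" "v$3 = s * \<zeta>" using s0 by (simp_all add: h_def \<zeta>_def)
  show ns: "norm s ^ 2 = norm (v$2)" using s by (metis norm_power)
  have "norm (v$1) ^ 2 = norm h ^ 2 * (norm s ^ 2) ^ 3"
    unfolding e by (simp add: norm_mult norm_power power_mult_distrib flip: power_mult)
  then show "norm (v$1) ^ 2 = norm h ^ 2 * norm (v$2) ^ 3" unfolding ns .
  have "norm (v$3) ^ 2 = norm \<zeta> ^ 2 * norm s ^ 2"
    unfolding e by (simp add: norm_mult power_mult_distrib)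
  then show "norm (v$3) ^ 2 = norm \<zeta> ^ 2 * norm (v$2)" unfolding ns .
  have "v = vector [s^3 * h, s^2 * 1, s * \<zeta>]" using e s by (simp add: vec_eq_iff forall_3)
  then have "vector [h, 1, \<zeta>] \<in> Xt t" using Xt_weighted_scaling[of s "vector [h, 1, \<zeta>]" t] v(1) s0 by simp
  then have "h^5 + t * h + (\<zeta> + \<zeta>^15) = 0" by (simp add: Xt_def algebra_simps)
  then show "h^5 + t * h = - (\<zeta> + \<zeta>^15)" by (simp only: eq_neg_iff_add_eq_0)
qed

lemma norm_sheet_le:
  assumes "norm (fst w) \<le> 1" "norm (h (snd w)) \<le> H"
  shows "norm (sheet h w) \<le> (H + 1) * norm (fst w ^ 2) + norm (fst w * snd w)"
proof -
  have "norm (fst w ^ 3 * h (snd w)) = norm (fst w) ^ 3 * norm (h (snd w))" by (simp add: norm_mult norm_power)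
  also have "\<dots> \<le> norm (fst w) ^ 2 * H"
    using assms by (intro mult_mono power_decreasing) auto
  finally show ?thesis using norm_vec3_le[of "sheet h w"] by (simp add: algebra_simps norm_power)
qed

text \<open>The shadow of the sheet in the \<open>(y, z)\<close>-plane contains, at scale
  \<open>\<epsilon>\<close>, a product of two discs of radius proportional to
  \<open>\<epsilon>\<close>, and projecting does not increase measure beyond a constant
  factor.\<close>

lemma sheet_lower_density:
  assumes H: "\<And>\<zeta>. norm \<zeta> < \<rho> \<Longrightarrow> norm (h \<zeta>) \<le> H" "0 \<le> H" and \<rho>: "0 < \<rho>" and \<kappa>: "0 < \<kappa>" "\<kappa> \<le> 1"
    and W: "sheet h ` ((ball 0 \<kappa> - {0}) \<times> ball 0 \<rho>) \<subseteq> W"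
  shows "0 < lower_density 4 W 0"
proof -
  define c where "c = 1 / (H + 2)"
  have c: "0 < c" using H(2) by (simp add: c_def)
  define U where "U = unit_ball_vol 2 ^ 2"
  have U: "0 < U" unfolding U_def by (intro zero_less_power unit_ball_vol_pos) simp
  \<comment> \<open>For \<open>\<epsilon> < b\<close>, \<open>d = c * \<epsilon>\<close> is below
    \<open>\<kappa>^2\<close>, which keeps the square root of \<open>y\<close> inside the chart, and
    below \<open>\<rho>^2 / 4\<close>, which controls \<open>\<zeta>\<close>.\<close>
  define b where "b = min (\<kappa>^2 / c) (\<rho>^2 / (4 * c))"
  have b: "0 < b" using \<kappa> c \<rho> by (simp add: b_def)
  show ?thesis
  proof (rule lower_density_posI)
    \<comment> \<open>\<open>16\<close> comes from the disc of radius \<open>d / 4\<close>;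
      \<open>256 = 2^4 * 2^4\<close> from the comparison with Lebesgue measure and the 2-Lipschitz
      projection.\<close>
    show "0 < U * c^4 / (16 * 256)" using U c by simp
    show "\<forall>\<^sub>F \<epsilon> in at_right 0. ennreal (U * c^4 / (16 * 256) * \<epsilon> powr 4) \<le> hausdorff_measure 4 (W \<inter> cball 0 \<epsilon>)"
      unfolding eventually_at_right_field
    proof (intro exI[of _ b] conjI allI impI b)
      fix \<epsilon> :: real assume e: "0 < \<epsilon>" "\<epsilon> < b"
      define d where "d = c * \<epsilon>"
      have d: "0 < d" "d < \<kappa>^2" "4 * d < \<rho>^2"
        using e c by (auto simp: d_def b_def field_simps)
      let ?\<pi> = "\<lambda>v :: complex^3. (v$2, v$3)"
      \<comment> \<open>The off-centre disc has \<open>d / 2 \<le> norm y \<le> d\<close>, so that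
        \<open>norm z \<le> d\<close> implies
        \<open>norm (z / s) ^ 2 \<le> 2 * d < \<rho>^2\<close>.\<close>
      let ?B = "cball (of_real (3/4 * d)) (d / 4) \<times> cball 0 d :: (complex \<times> complex) set"
      have sub: "?B \<subseteq> ?\<pi> ` (W \<inter> cball 0 \<epsilon>)"
      proof
        fix p assume "p \<in> ?B"
        then obtain y z where p: "p = (y, z)" "dist (of_real (3/4 * d)) y \<le> d / 4" "norm z \<le> d" by auto
        have n1: "norm (of_real (3/4 * d) :: complex) = 3/4 * d" using d by (simp only: norm_of_real)
        have "norm y \<le> 3/4 * d + d / 4" "3/4 * d - d / 4 \<le> norm y"
          using p(2) n1 norm_triangle_ineq2[of y "of_real (3/4 * d)"] norm_triangle_ineq2[of "of_real (3/4 * d)" y]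
          by (auto simp: dist_norm norm_minus_commute)
        then have y: "norm y \<le> d" "d / 2 \<le> norm y" by auto
        define s where "s = csqrt y"
        have s: "s^2 = y" "norm s ^ 2 = norm y" unfolding s_def by (simp_all flip: norm_power)
        have s0: "s \<noteq> 0" using s y d by auto
        have "norm s ^ 2 < \<kappa>^2" using s y d by simp
        then have sk: "norm s < \<kappa>" by (rule power_less_imp_less_base) (use \<kappa> in simp)
        have "norm (z / s) ^ 2 = norm z ^ 2 / norm y" by (simp add: norm_divide power_divide s(2))
        also have "\<dots> \<le> d^2 / (d / 2)" using p(3) y d by (intro frac_le power_mono) auto
        also have "\<dots> = 2 * d" using d by (simp add: power2_eq_square)
        also have "\<dots> < \<rho>^2" using d by simp
        finally have z: "norm (z / s) < \<rho>" using \<rho> by (simp add: power_less_imp_less_base)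
        let ?v = "sheet h (s, z / s)"
        have "?v \<in> W" using W sk s0 z by (intro subsetD[OF W] imageI) simp
        moreover have "norm ?v \<le> \<epsilon>"
        proof -
          have "norm ?v \<le> (H + 1) * norm y + norm z"
            using norm_sheet_le[of "(s, z / s)" h H] sk \<kappa> H(1)[OF z] s(1) s0 by simp
          also have "\<dots> \<le> (H + 1) * d + d" using y p(3) H(2) by (intro add_mono mult_left_mono) auto
          also have "\<dots> = (H + 2) * c * \<epsilon>" by (simp add: d_def algebra_simps)
          also have "\<dots> = \<epsilon>" using H(2) by (simp add: c_def)
          finally show ?thesis .
        qed
        moreover have "?\<pi> ?v = p" using s(1) s0 p(1) by simp
        ultimately show "p \<in> ?\<pi> ` (W \<inter> cball 0 \<epsilon>)" by (intro image_eqI[of _ _ ?v]) auto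
      qed
      have lip: "2-lipschitz_on (W \<inter> cball 0 \<epsilon>) ?\<pi>"
      proof (rule lipschitz_onI)
        fix v w :: "complex^3"
        have nb: "norm (v $ i - w $ i) \<le> dist v w" for i
          unfolding dist_norm vector_minus_component[symmetric] by (rule Finite_Cartesian_Product.norm_nth_le)
        have "dist (?\<pi> v) (?\<pi> w) \<le> norm (v$2 - w$2) + norm (v$3 - w$3)"
          by (simp add: dist_norm norm_Pair_le)
        then show "dist (?\<pi> v) (?\<pi> w) \<le> 2 * dist v w" using nb[of 2] nb[of 3] by linarith
      qed simp
      have "ennreal (U * (d / 4)^2 * d^2) = emeasure lborel ?B"
        unfolding U_def using d by (subst emeasure_lborel_cball_Times) auto
      also have "\<dots> \<le> ennreal (2 ^ 4) * hausdorff_measure 4 ?B"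
        using emeasure_lborel_le_hausdorff[of ?B] by simp
      also have "hausdorff_measure 4 ?B \<le> hausdorff_measure 4 (?\<pi> ` (W \<inter> cball 0 \<epsilon>))"
        by (rule hausdorff_measure_mono[OF sub])
      also have "\<dots> \<le> ennreal (2 powr 4) * hausdorff_measure 4 (W \<inter> cball 0 \<epsilon>)"
        by (rule hausdorff_measure_lipschitz_image[OF lip]) auto
      finally have "ennreal (U * (d / 4)^2 * d^2) \<le> ennreal (2 ^ 4) * (ennreal (2 powr 4) * hausdorff_measure 4 (W \<inter> cball 0 \<epsilon>))"
        by (simp add: mult_left_mono)
      also have "\<dots> = ennreal 256 * hausdorff_measure 4 (W \<inter> cball 0 \<epsilon>)"
        by (simp add: mult.assoc[symmetric] ennreal_mult'[symmetric] powr_numeral)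
      finally have le: "ennreal (1/256) * ennreal (U * (d / 4)^2 * d^2) \<le> ennreal (1/256) * (ennreal 256 * hausdorff_measure 4 (W \<inter> cball 0 \<epsilon>))"
        by (rule mult_left_mono) simp
      have "U * c^4 / (16 * 256) * \<epsilon> powr 4 = 1/256 * (U * (d / 4)^2 * d^2)"
        using e by (simp add: d_def powr_numeral power_mult_distrib power_divide eval_nat_numeral)
      then have "ennreal (U * c^4 / (16 * 256) * \<epsilon> powr 4) = ennreal (1/256) * ennreal (U * (d / 4)^2 * d^2)"
        by (simp only: ennreal_mult'[of "1/256"] zero_le_divide_1_iff zero_le_numeral)
      also note le
      also have "ennreal (1/256) * (ennreal 256 * hausdorff_measure 4 (W \<inter> cball 0 \<epsilon>)) = hausdorff_measure 4 (W \<inter> cball 0 \<epsilon>)"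
        by (subst mult.assoc[symmetric], subst ennreal_mult'[symmetric]) simp_all
      finally show "ennreal (U * c^4 / (16 * 256) * \<epsilon> powr 4) \<le> hausdorff_measure 4 (W \<inter> cball 0 \<epsilon>)" .
    qed
  qed simp
qed

section \<open>The wall and its measure\<close>

lemma norm_cis_diff_le: "norm (cis a - cis b) \<le> \<bar>a - b\<bar>"
proof -
  have "norm (exp (\<i> * of_real a) - exp (\<i> * of_real b)) \<le> exp 0 * norm (\<i> * of_real a - \<i> * of_real b)"
    by (rule norm_exp_diff_le) auto
  also have "norm (\<i> * of_real a - \<i> * of_real b) = \<bar>a - b\<bar>"
    by (simp flip: right_diff_distrib of_real_diff add: norm_mult)
  finally show ?thesis by (simp add: cis_conv_exp)
qed

lemma norm_mult_diff_le:
  fixes a b c d :: complex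
  shows "norm (a * b - c * d) \<le> norm (a - c) * norm b + norm c * norm (b - d)"
proof -
  have "a * b - c * d = (a - c) * b + c * (b - d)" by (simp add: algebra_simps)
  then show ?thesis by (metis norm_mult norm_triangle_ineq)
qed

lemma cis_Arg2pi: "of_real (norm z) * cis (Arg2pi z) = z"
  unfolding cis_conv_exp by (rule Arg2pi_eq[symmetric])

lemma emeasure_lborel_cbox_vec3:
  fixes a b :: "real^3"
  assumes "\<And>i. a$i \<le> b$i"
  shows "emeasure lborel (cbox a b) = ennreal ((b$1 - a$1) * (b$2 - a$2) * (b$3 - a$3))"
proof -
  have "cbox a b \<noteq> {}" using assms by (simp add: interval_ne_empty_cart)
  then have "measure lborel (cbox a b) = (\<Prod>i\<in>UNIV. b$i - a$i)" by (rule content_cbox_cart)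
  also have "\<dots> = (b$1 - a$1) * (b$2 - a$2) * (b$3 - a$3)" unfolding UNIV_3 by simp
  finally have "measure lborel (cbox a b) = (b$1 - a$1) * (b$2 - a$2) * (b$3 - a$3)" .
  then show ?thesis using emeasure_lborel_cbox_finite[of a b]
    by (subst emeasure_eq_ennreal_measure) auto
qed

text \<open>The wall \<open>|z|\<^sup>2 = \<rho>\<^sup>2 |y|\<close> of the sheet \<open>h\<close>, with \<open>s = r e\<^sup>i\<^sup>\<phi>\<close> and \<open>\<zeta> = \<rho> e\<^sup>i\<^sup>(\<^sup>\<alpha>\<^sup>-\<^sup>\<phi>\<^sup>)\<close>. In the coordinates
  \<open>(r, \<sigma> \<alpha>, \<sigma>\<^sup>2 \<phi>)\<close> the part \<open>r \<le> \<sigma>\<close> is a Lipschitz image, with a constant independent of \<open>\<sigma>\<close>,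
  of a box of volume \<open>O(\<sigma>\<^sup>4)\<close>; this is why its three-dimensional density at the origin vanishes.\<close>

definition wall :: "(complex \<Rightarrow> complex) \<Rightarrow> real \<Rightarrow> real \<Rightarrow> real \<Rightarrow> real \<Rightarrow> complex^3" where
  "wall h \<rho> r \<alpha> \<phi> = sheet h (of_real r * cis \<phi>, of_real \<rho> * cis (\<alpha> - \<phi>))"

lemma wall_nth:
  "wall h \<rho> r \<alpha> \<phi> $ 1 = of_real r ^ 3 * (cis \<phi> ^ 3 * h (of_real \<rho> * cis (\<alpha> - \<phi>)))"
  "wall h \<rho> r \<alpha> \<phi> $ 2 = of_real r ^ 2 * cis \<phi> ^ 2"
  "wall h \<rho> r \<alpha> \<phi> $ 3 = of_real (r * \<rho>) * cis \<alpha>"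
proof -
  show "wall h \<rho> r \<alpha> \<phi> $ 1 = of_real r ^ 3 * (cis \<phi> ^ 3 * h (of_real \<rho> * cis (\<alpha> - \<phi>)))"
    "wall h \<rho> r \<alpha> \<phi> $ 2 = of_real r ^ 2 * cis \<phi> ^ 2"
    by (simp_all add: wall_def power_mult_distrib mult.assoc)
  have "wall h \<rho> r \<alpha> \<phi> $ 3 = of_real (r * \<rho>) * (cis \<phi> * cis (\<alpha> - \<phi>))" by (simp add: wall_def)
  also have "cis \<phi> * cis (\<alpha> - \<phi>) = cis \<alpha>" by (simp add: cis_mult)
  finally show "wall h \<rho> r \<alpha> \<phi> $ 3 = of_real (r * \<rho>) * cis \<alpha>" .
qed

definition wall_box :: "real \<Rightarrow> (real^3) set" where
  "wall_box \<sigma> = cbox 0 (vector [\<sigma>, 2 * pi * \<sigma>, 2 * pi * \<sigma>^2])"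

definition wall_chart :: "(complex \<Rightarrow> complex) \<Rightarrow> real \<Rightarrow> real \<Rightarrow> real^3 \<Rightarrow> complex^3" where
  "wall_chart h \<rho> \<sigma> w = wall h \<rho> (w$1) (w$2 / \<sigma>) (w$3 / \<sigma>^2)"

text \<open>The angle \<open>\<phi>\<close> moves only \<open>x\<close> and \<open>y\<close>, of
  sizes \<open>r^3\<close> and \<open>r^2\<close>, because
  \<open>z = r * \<rho> * cis \<alpha>\<close> does not involve it; dividing by
  \<open>\<sigma>^2\<close> is thus compensated. The angle \<open>\<alpha>\<close> moves
  \<open>z\<close> and \<open>x\<close>, of sizes \<open>r\<close> and \<open>r^3\<close>, which
  compensates \<open>\<sigma>\<close>.\<close>

lemma wall_chart_lipschitz:
  assumes lip: "L-lipschitz_on (cball 0 \<rho>) h" and a: "\<And>\<zeta>. norm \<zeta> \<le> \<rho> \<Longrightarrow> norm (h \<zeta>) \<le> a" and \<rho>: "0 < \<rho>"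
  obtains C where "0 < C" "\<And>\<sigma>. 0 < \<sigma> \<Longrightarrow> \<sigma> \<le> 1 \<Longrightarrow> C-lipschitz_on (wall_box \<sigma>) (wall_chart h \<rho> \<sigma>)"
proof -
  have L: "0 \<le> L" using lip by (rule lipschitz_on_nonneg)
  have a0: "0 \<le> a" by (rule order_trans[OF norm_ge_zero a[of 0]]) (use \<rho> in simp)
  define C1 where "C1 = 3 * a + L * \<rho>"
  have C1: "0 \<le> C1" "3 * a \<le> C1" "L * \<rho> \<le> C1" using a0 L \<rho> by (auto simp: C1_def)
  define C where "C = 3 * (C1 + 2 + \<rho>)"
  have C: "0 < C" using C1 \<rho> by (simp add: C_def)
  show ?thesis
  proof (rule that[OF C])
    fix \<sigma> :: real assume \<sigma>: "0 < \<sigma>" "\<sigma> \<le> 1"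
    show "C-lipschitz_on (wall_box \<sigma>) (wall_chart h \<rho> \<sigma>)"
    proof (rule lipschitz_onI)
      fix v w assume vw: "v \<in> wall_box \<sigma>" "w \<in> wall_box \<sigma>"
      define r \<alpha> \<phi> where "r = v$1" and "\<alpha> = v$2 / \<sigma>" and "\<phi> = v$3 / \<sigma>^2"
      define r' \<alpha>' \<phi>' where "r' = w$1" and "\<alpha>' = w$2 / \<sigma>" and "\<phi>' = w$3 / \<sigma>^2"
      define d1 d2 d3 where "d1 = \<bar>v$1 - w$1\<bar>" and "d2 = \<bar>v$2 - w$2\<bar>" and "d3 = \<bar>v$3 - w$3\<bar>"
      have d: "0 \<le> d1" "0 \<le> d2" "0 \<le> d3" by (auto simp: d1_def d2_def d3_def)
      have r: "0 \<le> r" "r \<le> \<sigma>" "0 \<le> r'" "r' \<le> \<sigma>"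
        using vw by (auto simp: wall_box_def mem_box_cart r_def r'_def forall_3)
      have dr: "\<bar>r - r'\<bar> = d1" by (simp add: r_def r'_def d1_def)
      have da: "\<sigma> * \<bar>\<alpha> - \<alpha>'\<bar> = d2" using \<sigma> by (simp add: \<alpha>_def \<alpha>'_def d2_def abs_divide flip: diff_divide_distrib)
      have dp: "\<sigma>^2 * \<bar>\<phi> - \<phi>'\<bar> = d3" using \<sigma> by (simp add: \<phi>_def \<phi>'_def d3_def abs_divide flip: diff_divide_distrib)
      have s3: "\<sigma>^3 * \<bar>\<alpha> - \<alpha>'\<bar> \<le> d2" "\<sigma>^3 * \<bar>\<phi> - \<phi>'\<bar> \<le> d3"
      proof -
        have "\<sigma>^3 \<le> \<sigma>^1" "\<sigma>^3 \<le> \<sigma>^2" using \<sigma> by (intro power_decreasing; simp)+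
        then show "\<sigma>^3 * \<bar>\<alpha> - \<alpha>'\<bar> \<le> d2" "\<sigma>^3 * \<bar>\<phi> - \<phi>'\<bar> \<le> d3"
          unfolding da[symmetric] dp[symmetric] by (auto intro!: mult_right_mono)
      qed
      have cisp: "norm (cis \<phi> ^ n - cis \<phi>' ^ n) \<le> of_nat n * \<bar>\<phi> - \<phi>'\<bar>" for n
        using norm_cis_diff_le[of "of_nat n * \<phi>" "of_nat n * \<phi>'"]
        by (simp add: Complex.DeMoivre abs_mult flip: right_diff_distrib)
      have rp: "norm (of_real r ^ n - of_real r' ^ n :: complex) \<le> of_nat n * d1" for n
      proof -
        have "norm (of_real r ^ n - of_real r' ^ n :: complex) = norm (power_quot n (of_real r) (of_real r')) * \<bar>r - r'\<bar>"
          unfolding power_quot by (simp add: norm_mult flip: of_real_diff)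
        also have "\<dots> \<le> of_nat n * \<bar>r - r'\<bar>"
          using r \<sigma> by (intro mult_right_mono norm_power_quot_le) auto
        finally show ?thesis unfolding dr .
      qed
      have rs: "norm (of_real r' ^ n :: complex) \<le> \<sigma> ^ n" for n
        using r by (simp add: norm_power power_mono)
      let ?z = "of_real \<rho> * cis (\<alpha> - \<phi>)" and ?z' = "of_real \<rho> * cis (\<alpha>' - \<phi>')"
      have nz: "norm ?z \<le> \<rho>" "norm ?z' \<le> \<rho>" using \<rho> by (auto simp: norm_mult)
      have hd: "norm (h ?z - h ?z') \<le> L * \<rho> * (\<bar>\<alpha> - \<alpha>'\<bar> + \<bar>\<phi> - \<phi>'\<bar>)"
      proof -
        have "norm (h ?z - h ?z') \<le> L * norm (?z - ?z')"
          using lipschitz_onD[OF lip, of ?z ?z'] nz by (simp add: dist_norm)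
        also have "norm (?z - ?z') = \<rho> * norm (cis (\<alpha> - \<phi>) - cis (\<alpha>' - \<phi>'))"
          using \<rho> by (simp add: norm_mult flip: right_diff_distrib)
        also have "\<dots> \<le> \<rho> * (\<bar>\<alpha> - \<alpha>'\<bar> + \<bar>\<phi> - \<phi>'\<bar>)"
          using \<rho> by (intro mult_left_mono order_trans[OF norm_cis_diff_le]) auto
        finally show ?thesis using L by (simp add: mult_left_mono mult.assoc)
      qed
      have n1: "dist (wall_chart h \<rho> \<sigma> v $ 1) (wall_chart h \<rho> \<sigma> w $ 1) \<le> C1 * (d1 + d2 + d3)"
      proof -
        have g: "norm (cis \<phi> ^ 3 * h ?z - cis \<phi>' ^ 3 * h ?z') \<le> C1 * \<bar>\<phi> - \<phi>'\<bar> + L * \<rho> * \<bar>\<alpha> - \<alpha>'\<bar>"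
        proof -
          have "norm (cis \<phi> ^ 3 * h ?z - cis \<phi>' ^ 3 * h ?z')
              \<le> norm (cis \<phi> ^ 3 - cis \<phi>' ^ 3) * norm (h ?z) + norm (cis \<phi>' ^ 3) * norm (h ?z - h ?z')"
            by (rule norm_mult_diff_le)
          also have "\<dots> \<le> (3 * \<bar>\<phi> - \<phi>'\<bar>) * a + 1 * (L * \<rho> * (\<bar>\<alpha> - \<alpha>'\<bar> + \<bar>\<phi> - \<phi>'\<bar>))"
            using cisp[of 3] a[OF nz(1)] hd by (intro add_mono mult_mono) (auto simp: norm_power)
          finally show ?thesis by (simp add: C1_def algebra_simps)
        qed
        have "dist (wall_chart h \<rho> \<sigma> v $ 1) (wall_chart h \<rho> \<sigma> w $ 1)
            = norm (of_real r ^ 3 * (cis \<phi> ^ 3 * h ?z) - of_real r' ^ 3 * (cis \<phi>' ^ 3 * h ?z'))"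
          by (simp only: wall_chart_def wall_nth dist_norm r_def r'_def \<alpha>_def \<alpha>'_def \<phi>_def \<phi>'_def)
        also have "\<dots> \<le> norm (of_real r ^ 3 - of_real r' ^ 3 :: complex) * norm (cis \<phi> ^ 3 * h ?z)
            + norm (of_real r' ^ 3 :: complex) * norm (cis \<phi> ^ 3 * h ?z - cis \<phi>' ^ 3 * h ?z')"
          by (rule norm_mult_diff_le)
        also have "\<dots> \<le> (3 * d1) * a + \<sigma>^3 * (C1 * \<bar>\<phi> - \<phi>'\<bar> + L * \<rho> * \<bar>\<alpha> - \<alpha>'\<bar>)"
          using rp[of 3] rs[of 3] g a[OF nz(1)] \<sigma> d(1) by (intro add_mono mult_mono) (auto simp: norm_mult norm_power)
        also have "\<dots> = 3 * a * d1 + (C1 * (\<sigma>^3 * \<bar>\<phi> - \<phi>'\<bar>) + L * \<rho> * (\<sigma>^3 * \<bar>\<alpha> - \<alpha>'\<bar>))"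
          by (simp add: algebra_simps)
        also have "\<dots> \<le> C1 * d1 + (C1 * d3 + C1 * d2)"
          using C1 s3 d \<sigma> L \<rho> by (intro add_mono mult_mono) auto
        finally show ?thesis by (simp add: algebra_simps)
      qed
      have n2: "dist (wall_chart h \<rho> \<sigma> v $ 2) (wall_chart h \<rho> \<sigma> w $ 2) \<le> 2 * (d1 + d2 + d3)"
      proof -
        have "dist (wall_chart h \<rho> \<sigma> v $ 2) (wall_chart h \<rho> \<sigma> w $ 2)
            = norm (of_real r ^ 2 * cis \<phi> ^ 2 - of_real r' ^ 2 * cis \<phi>' ^ 2)"
          by (simp only: wall_chart_def wall_nth dist_norm r_def r'_def \<phi>_def \<phi>'_def)
        also have "\<dots> \<le> norm (of_real r ^ 2 - of_real r' ^ 2 :: complex) * norm (cis \<phi> ^ 2)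
            + norm (of_real r' ^ 2 :: complex) * norm (cis \<phi> ^ 2 - cis \<phi>' ^ 2)"
          by (rule norm_mult_diff_le)
        also have "\<dots> \<le> (2 * d1) * 1 + \<sigma>^2 * (2 * \<bar>\<phi> - \<phi>'\<bar>)"
          using rp[of 2] rs[of 2] cisp[of 2] \<sigma> d(1) by (intro add_mono mult_mono) (auto simp: norm_power)
        also have "\<dots> = 2 * d1 + 2 * d3" by (simp flip: dp)
        finally show ?thesis using d by simp
      qed
      have n3: "dist (wall_chart h \<rho> \<sigma> v $ 3) (wall_chart h \<rho> \<sigma> w $ 3) \<le> \<rho> * (d1 + d2 + d3)"
      proof -
        have "dist (wall_chart h \<rho> \<sigma> v $ 3) (wall_chart h \<rho> \<sigma> w $ 3)
            = norm (of_real (r * \<rho>) * cis \<alpha> - of_real (r' * \<rho>) * cis \<alpha>')"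
          by (simp only: wall_chart_def wall_nth dist_norm r_def r'_def \<alpha>_def \<alpha>'_def)
        also have "\<dots> \<le> norm (of_real (r * \<rho>) - of_real (r' * \<rho>) :: complex) * norm (cis \<alpha>)
            + norm (of_real (r' * \<rho>) :: complex) * norm (cis \<alpha> - cis \<alpha>')"
          by (rule norm_mult_diff_le)
        also have "norm (of_real (r * \<rho>) - of_real (r' * \<rho>) :: complex) = d1 * \<rho>"
          using \<rho> by (simp only: norm_of_real flip: of_real_diff left_diff_distrib) (simp add: abs_mult dr)
        also have "norm (of_real (r' * \<rho>) :: complex) * norm (cis \<alpha> - cis \<alpha>') \<le> (\<sigma> * \<rho>) * \<bar>\<alpha> - \<alpha>'\<bar>"
          using r \<rho> by (intro mult_mono norm_cis_diff_le) (auto simp: norm_mult)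
        also have "d1 * \<rho> * norm (cis \<alpha>) + (\<sigma> * \<rho>) * \<bar>\<alpha> - \<alpha>'\<bar> = \<rho> * (d1 + d2)"
          by (simp add: algebra_simps flip: da)
        also have "\<dots> \<le> \<rho> * (d1 + d2 + d3)" using d \<rho> by (intro mult_left_mono) auto
        finally show ?thesis by (simp only: add_left_mono)
      qed
      have dd: "d1 \<le> dist v w" "d2 \<le> dist v w" "d3 \<le> dist v w"
        unfolding d1_def d2_def d3_def using dist_vec_nth_le[of v _ w] by (auto simp: dist_real_def)
      have "dist (wall_chart h \<rho> \<sigma> v) (wall_chart h \<rho> \<sigma> w) \<le> (C1 + 2 + \<rho>) * (d1 + d2 + d3)"
        using dist_vec3_le[of "wall_chart h \<rho> \<sigma> v" "wall_chart h \<rho> \<sigma> w"] n1 n2 n3 by (simp add: algebra_simps)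
      also have "\<dots> \<le> (C1 + 2 + \<rho>) * (3 * dist v w)" using dd C1 \<rho> by (intro mult_left_mono) auto
      finally show "dist (wall_chart h \<rho> \<sigma> v) (wall_chart h \<rho> \<sigma> w) \<le> C * dist v w" by (simp only: C_def ac_simps)
    qed (use C in simp)
  qed
qed

text \<open>With \<open>\<sigma> = 1\<close> this is the part \<open>norm y \<le> 1\<close>, which
  includes the whole wall inside the unit ball.\<close>

definition wall_set :: "(complex \<Rightarrow> complex) \<Rightarrow> real \<Rightarrow> (complex^3) set" where
  "wall_set h \<rho> = wall_chart h \<rho> 1 ` wall_box 1"

lemma hausdorff_measure_wall_chart:
  assumes C: "C-lipschitz_on (wall_box \<sigma>) (wall_chart h \<rho> \<sigma>)" "0 < C" and \<sigma>: "0 < \<sigma>"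
  shows "hausdorff_measure 3 (wall_chart h \<rho> \<sigma> ` wall_box \<sigma>) \<le> ennreal ((5 * C)^3 * (4 * pi^2) * \<sigma>^4)"
proof -
  have "hausdorff_measure 3 (wall_chart h \<rho> \<sigma> ` wall_box \<sigma>) \<le> ennreal (C powr 3) * hausdorff_measure 3 (wall_box \<sigma>)"
    by (rule hausdorff_measure_lipschitz_image[OF C]) simp
  also have "hausdorff_measure 3 (wall_box \<sigma>) \<le> ennreal (5 ^ 3) * emeasure lborel (wall_box \<sigma>)"
    using hausdorff_measure_le_lborel[of "wall_box \<sigma>"] by (simp add: wall_box_def)
  also have "emeasure lborel (wall_box \<sigma>) = ennreal (\<sigma> * (2 * pi * \<sigma>) * (2 * pi * \<sigma>^2))"
    unfolding wall_box_def
  proof (subst emeasure_lborel_cbox_vec3)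
    fix i :: 3 show "(0 :: real^3) $ i \<le> vector [\<sigma>, 2 * pi * \<sigma>, 2 * pi * \<sigma>^2] $ i"
      using \<sigma> exhaust_3[of i] by auto
  qed simp
  also have "ennreal (C powr 3) * (ennreal (5 ^ 3) * ennreal (\<sigma> * (2 * pi * \<sigma>) * (2 * pi * \<sigma>^2)))
     = ennreal (C powr 3 * (5 ^ 3 * (\<sigma> * (2 * pi * \<sigma>) * (2 * pi * \<sigma>^2))))"
    by (subst ennreal_mult', simp, subst ennreal_mult', simp, rule refl)
  also have "C powr 3 * (5 ^ 3 * (\<sigma> * (2 * pi * \<sigma>) * (2 * pi * \<sigma>^2))) = (5 * C)^3 * (4 * pi^2) * \<sigma>^4"
    using C(2) by (simp add: powr_numeral power_mult_distrib eval_nat_numeral)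
  finally show ?thesis by (simp add: mult_left_mono)
qed

lemma wall_setE:
  assumes "v \<in> wall_set h \<rho>"
  obtains r \<alpha> \<phi> where "v = wall h \<rho> r \<alpha> \<phi>" "0 \<le> r" "r \<le> 1" "0 \<le> \<alpha>" "\<alpha> \<le> 2 * pi" "0 \<le> \<phi>" "\<phi> \<le> 2 * pi"
proof -
  obtain w where w: "w \<in> wall_box 1" "v = wall_chart h \<rho> 1 w" using assms by (auto simp: wall_set_def)
  show ?thesis
    by (rule that[of "w$1" "w$2" "w$3"]) (use w in \<open>auto simp: wall_box_def mem_box_cart forall_3 wall_chart_def\<close>)
qed

lemma wall_in_chart:
  assumes "0 \<le> r" "r \<le> \<sigma>" "0 \<le> \<alpha>" "\<alpha> \<le> 2 * pi" "0 \<le> \<phi>" "\<phi> \<le> 2 * pi" "0 < \<sigma>"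
  shows "wall h \<rho> r \<alpha> \<phi> \<in> wall_chart h \<rho> \<sigma> ` wall_box \<sigma>"
proof (rule image_eqI)
  let ?w = "vector [r, \<sigma> * \<alpha>, \<sigma>^2 * \<phi>] :: real^3"
  show "wall h \<rho> r \<alpha> \<phi> = wall_chart h \<rho> \<sigma> ?w" using assms by (simp add: wall_chart_def)
  show "?w \<in> wall_box \<sigma>" using assms
    by (auto simp: wall_box_def mem_box_cart forall_3 mult.commute intro!: mult_left_mono)
qed

text \<open>Since \<open>norm z = r * \<rho>\<close> on the wall, the ball of radius
  \<open>\<epsilon>\<close> sees only \<open>r \<le> \<epsilon> / \<rho>\<close>. The resulting
  bound \<open>D * \<epsilon>^4\<close> is smaller than any multiple of \<open>\<epsilon>^3\<close>
  in the limit.\<close>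

lemma wall_set_upper_density:
  assumes lip: "L-lipschitz_on (cball 0 \<rho>) h" and a: "\<And>\<zeta>. norm \<zeta> \<le> \<rho> \<Longrightarrow> norm (h \<zeta>) \<le> a" and \<rho>: "0 < \<rho>"
  shows "upper_density 3 (wall_set h \<rho>) 0 = 0"
proof (rule upper_density_eq_0I)
  fix c :: real assume c: "0 < c"
  obtain C where C: "0 < C" "\<And>\<sigma>. 0 < \<sigma> \<Longrightarrow> \<sigma> \<le> 1 \<Longrightarrow> C-lipschitz_on (wall_box \<sigma>) (wall_chart h \<rho> \<sigma>)"
    using wall_chart_lipschitz[OF lip a \<rho>] by metis
  define D where "D = (5 * C)^3 * (4 * pi^2) / \<rho>^4"
  have D: "0 < D" using C \<rho> by (simp add: D_def)
  show "\<forall>\<^sub>F \<epsilon> in at_right 0. hausdorff_measure 3 (wall_set h \<rho> \<inter> cball 0 \<epsilon>) \<le> ennreal (c * \<epsilon> powr 3)"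
    unfolding eventually_at_right_field
  proof (intro exI[of _ "min \<rho> (c / D)"] conjI allI impI)
    show "0 < min \<rho> (c / D)" using \<rho> c D by simp
    fix \<epsilon> assume e: "0 < \<epsilon>" "\<epsilon> < min \<rho> (c / D)"
    define \<sigma> where "\<sigma> = \<epsilon> / \<rho>"
    have \<sigma>: "0 < \<sigma>" "\<sigma> \<le> 1" using e \<rho> by (auto simp: \<sigma>_def)
    have "wall_set h \<rho> \<inter> cball 0 \<epsilon> \<subseteq> wall_chart h \<rho> \<sigma> ` wall_box \<sigma>"
    proof
      fix v assume v: "v \<in> wall_set h \<rho> \<inter> cball 0 \<epsilon>"
      then obtain r \<alpha> \<phi> where w: "v = wall h \<rho> r \<alpha> \<phi>" "0 \<le> r" "r \<le> 1" "0 \<le> \<alpha>" "\<alpha> \<le> 2 * pi" "0 \<le> \<phi>" "\<phi> \<le> 2 * pi"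
        by (auto elim: wall_setE)
      have "norm (v$3) \<le> \<epsilon>" using v Finite_Cartesian_Product.norm_nth_le[of v 3] by auto
      then have "r * \<rho> \<le> \<epsilon>" using w(2) \<rho> unfolding w(1) wall_nth by (simp add: norm_mult)
      then have "r \<le> \<sigma>" using \<rho> by (simp add: \<sigma>_def field_simps)
      then show "v \<in> wall_chart h \<rho> \<sigma> ` wall_box \<sigma>" unfolding w(1) using w \<sigma> by (intro wall_in_chart) auto
    qed
    then have "hausdorff_measure 3 (wall_set h \<rho> \<inter> cball 0 \<epsilon>) \<le> hausdorff_measure 3 (wall_chart h \<rho> \<sigma> ` wall_box \<sigma>)"
      by (rule hausdorff_measure_mono)
    also have "\<dots> \<le> ennreal ((5 * C)^3 * (4 * pi^2) * \<sigma>^4)"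
      by (rule hausdorff_measure_wall_chart[OF C(2)[OF \<sigma>] C(1) \<sigma>(1)])
    also have "(5 * C)^3 * (4 * pi^2) * \<sigma>^4 = D * \<epsilon> * \<epsilon>^3"
      by (simp add: D_def \<sigma>_def power_divide eval_nat_numeral)
    also have "ennreal (D * \<epsilon> * \<epsilon>^3) \<le> ennreal (c * \<epsilon> powr 3)"
      using e D by (intro ennreal_leI) (auto simp: powr_numeral field_simps intro!: mult_right_mono)
    finally show "hausdorff_measure 3 (wall_set h \<rho> \<inter> cball 0 \<epsilon>) \<le> ennreal (c * \<epsilon> powr 3)" .
  qed
qed simp

text \<open>Rectifiability includes dimension exactly 3, so the wall must not be null. Its shadow
  under \<open>(Re z, Im z, Re y)\<close> contains a box.\<close>

lemma wall_set_positive_measure: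
  assumes \<rho>: "0 < \<rho>"
  shows "hausdorff_measure 3 (wall_set h \<rho>) \<noteq> 0"
proof
  assume Y0: "hausdorff_measure 3 (wall_set h \<rho>) = 0"
  let ?q = "\<lambda>v :: complex^3. vector [Re (v$3), Im (v$3), Re (v$2)] :: real^3"
  \<comment> \<open>Over this square, \<open>r^2 = norm z ^ 2 / \<rho>^2\<close> lies between
    \<open>1/2\<close> and \<open>18/25\<close>. Hence
    \<open>0 \<le> p$3 \<le> 1/2 \<le> r^2\<close>, and \<open>r^2 * cos (2 * \<phi>) = p$3\<close>
    can be solved with \<open>r \<le> 1\<close>.\<close>
  let ?R = "cbox (vector [\<rho> / 2, \<rho> / 2, 0]) (vector [3 / 5 * \<rho>, 3 / 5 * \<rho>, 1 / 2]) :: (real^3) set"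
  have lip: "3-lipschitz_on (wall_set h \<rho>) ?q"
  proof (rule lipschitz_onI)
    fix v w :: "complex^3"
    have nb: "norm (v $ i - w $ i) \<le> dist v w" for i
      unfolding dist_norm vector_minus_component[symmetric] by (rule Finite_Cartesian_Product.norm_nth_le)
    have "dist (?q v) (?q w) \<le> (\<Sum>i\<in>UNIV. \<bar>(?q v - ?q w) $ i\<bar>)"
      unfolding dist_norm by (rule norm_le_l1_cart)
    also have "\<dots> = \<bar>Re (v$3 - w$3)\<bar> + \<bar>Im (v$3 - w$3)\<bar> + \<bar>Re (v$2 - w$2)\<bar>" by (simp add: sum_3)
    also have "\<dots> \<le> 3 * dist v w"
      using nb[of 3] nb[of 2] abs_Re_le_cmod[of "v$3 - w$3"] abs_Im_le_cmod[of "v$3 - w$3"] abs_Re_le_cmod[of "v$2 - w$2"]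
      by linarith
    finally show "dist (?q v) (?q w) \<le> 3 * dist v w" .
  qed simp
  have sub: "?R \<subseteq> ?q ` wall_set h \<rho>"
  proof
    fix p assume "p \<in> ?R"
    then have p: "\<rho> / 2 \<le> p$1" "p$1 \<le> 3 / 5 * \<rho>" "\<rho> / 2 \<le> p$2" "p$2 \<le> 3 / 5 * \<rho>" "0 \<le> p$3" "p$3 \<le> 1 / 2"
      by (auto simp: mem_box_cart forall_3)
    define z where "z = Complex (p$1) (p$2)"
    define r where "r = norm z / \<rho>"
    have nz: "norm z ^ 2 = (p$1)^2 + (p$2)^2" by (simp add: z_def cmod_power2)
    have sq: "(\<rho> / 2)^2 \<le> (p$1)^2" "(\<rho> / 2)^2 \<le> (p$2)^2" "(p$1)^2 \<le> (3 / 5 * \<rho>)^2" "(p$2)^2 \<le> (3 / 5 * \<rho>)^2"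
      using p \<rho> by (intro power_mono; simp)+
    have r2: "r^2 = norm z ^ 2 / \<rho>^2" by (simp add: r_def power_divide)
    have "1 / 2 * \<rho>^2 \<le> norm z ^ 2" using sq(1,2) unfolding nz by (simp add: power_divide)
    moreover have "norm z ^ 2 \<le> 1 * \<rho>^2"
    proof -
      have "(3 / 5 * \<rho>)^2 = 9/25 * \<rho>^2" by (simp add: power_mult_distrib power_divide)
      moreover have "0 \<le> \<rho>^2" by simp
      ultimately show ?thesis using sq(3,4) unfolding nz by linarith
    qed
    ultimately have r2b: "1 / 2 \<le> r^2" "r^2 \<le> 1" unfolding r2 using \<rho> by (simp_all add: pos_le_divide_eq pos_divide_le_eq)
    have r0: "0 \<le> r" "r \<le> 1"
    proof -
      show "0 \<le> r" using \<rho> by (simp add: r_def)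
      show "r \<le> 1" by (rule power2_le_imp_le) (use r2b(2) in simp_all)
    qed
    define \<phi> where "\<phi> = arccos (p$3 / r^2) / 2"
    have q: "0 \<le> p$3 / r^2" "p$3 / r^2 \<le> 1"
      using p(5,6) r2b by (auto simp: divide_le_eq)
    have ph: "0 \<le> \<phi>" "\<phi> \<le> 2 * pi"
      using arccos_lbound[of "p$3 / r^2"] arccos_ubound[of "p$3 / r^2"] q pi_gt_zero by (auto simp: \<phi>_def)
    have cos: "cos (2 * \<phi>) = p$3 / r^2" using q by (simp add: \<phi>_def cos_arccos)
    let ?v = "wall h \<rho> r (Arg2pi z) \<phi>"
    have v3: "?v $ 3 = z" unfolding wall_nth using \<rho> cis_Arg2pi[of z] by (simp add: r_def)
    have "?v $ 2 = of_real (r^2) * cis (2 * \<phi>)" unfolding wall_nth by (simp add: Complex.DeMoivre)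
    then have "Re (?v $ 2) = r^2 * cos (2 * \<phi>)" by simp
    then have v2: "Re (?v $ 2) = p$3" unfolding cos using r2b by auto
    have "?q ?v = p" using v2 v3 by (simp add: vec_eq_iff forall_3 z_def)
    moreover have "?v \<in> wall_set h \<rho>" unfolding wall_set_def
      using r0 ph Arg2pi_ge_0[of z] Arg2pi_lt_2pi[of z] by (intro wall_in_chart) auto
    then have "?q ?v \<in> ?q ` wall_set h \<rho>" by (rule imageI)
    ultimately show "p \<in> ?q ` wall_set h \<rho>" by (simp only:)
  qed
  have "emeasure lborel ?R \<le> ennreal (2 ^ 3) * hausdorff_measure 3 ?R"
    using emeasure_lborel_le_hausdorff[of ?R] by simp
  also have "hausdorff_measure 3 ?R \<le> hausdorff_measure 3 (?q ` wall_set h \<rho>)"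
    by (rule hausdorff_measure_mono[OF sub])
  also have "\<dots> \<le> ennreal (3 powr 3) * hausdorff_measure 3 (wall_set h \<rho>)"
    by (rule hausdorff_measure_lipschitz_image[OF lip]) auto
  finally have "emeasure lborel ?R \<le> 0" unfolding Y0 by (simp add: mult_left_mono)
  moreover have "emeasure lborel ?R = ennreal ((3 / 5 * \<rho> - \<rho> / 2) * (3 / 5 * \<rho> - \<rho> / 2) * (1 / 2 - 0))"
  proof (subst emeasure_lborel_cbox_vec3)
    fix i :: 3 show "(vector [\<rho> / 2, \<rho> / 2, 0] :: real^3) $ i \<le> vector [3 / 5 * \<rho>, 3 / 5 * \<rho>, 1 / 2] $ i"
      using \<rho> exhaust_3[of i] by auto
  qed simp
  ultimately have "ennreal ((3 / 5 * \<rho> - \<rho> / 2) * (3 / 5 * \<rho> - \<rho> / 2) * (1 / 2 - 0)) \<le> 0" by (simp only:)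
  then have "(3 / 5 * \<rho> - \<rho> / 2) * (3 / 5 * \<rho> - \<rho> / 2) * (1 / 2 - 0) \<le> 0"
    by (simp only: le_zero_eq ennreal_eq_0_iff)
  moreover have "0 < (3 / 5 * \<rho> - \<rho> / 2) * (3 / 5 * \<rho> - \<rho> / 2) * (1 / 2 - 0)" using \<rho> by simp
  ultimately show False by linarith
qed

text \<open>One Lipschitz chart covers the wall. As its 3-measure is finite and nonzero, the
  exponents with measure 0 are exactly those above 3, and their infimum is 3.\<close>

lemma rectifiable_wall_set:
  assumes lip: "L-lipschitz_on (cball 0 \<rho>) h" and a: "\<And>\<zeta>. norm \<zeta> \<le> \<rho> \<Longrightarrow> norm (h \<zeta>) \<le> a" and \<rho>: "0 < \<rho>"
  shows "rectifiable_set TYPE(real^3) (wall_set h \<rho>)"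
proof -
  obtain C where C: "0 < C" "\<And>\<sigma>. 0 < \<sigma> \<Longrightarrow> \<sigma> \<le> 1 \<Longrightarrow> C-lipschitz_on (wall_box \<sigma>) (wall_chart h \<rho> \<sigma>)"
    using wall_chart_lipschitz[OF lip a \<rho>] by metis
  have C1: "C-lipschitz_on (wall_box 1) (wall_chart h \<rho> 1)" by (rule C(2)) auto
  let ?Y = "wall_set h \<rho>"
  have fin: "hausdorff_measure 3 ?Y < \<infinity>"
    using hausdorff_measure_wall_chart[OF C1 C(1)] unfolding wall_set_def by (auto simp: less_top[symmetric] top_unique)
  have pos: "hausdorff_measure 3 ?Y \<noteq> 0" by (rule wall_set_positive_measure[OF \<rho>])
  have "hausdorff_measure s ?Y = 0 \<longleftrightarrow> 3 < s" if s: "0 \<le> s" for s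
  proof
    assume z: "hausdorff_measure s ?Y = 0"
    show "3 < s"
    proof (rule ccontr)
      assume "\<not> 3 < s"
      then consider "s = 3" | "s < 3" by linarith
      then show False
      proof cases
        case 1 then show False using z pos by simp
      next
        case 2 then show False using hausdorff_measure_eq_0_of_finite[of s ?Y 3] z s pos by simp
      qed
    qed
  next
    assume "3 < s" then show "hausdorff_measure s ?Y = 0"
      using hausdorff_measure_eq_0_of_finite[OF fin] by simp
  qed
  then have "{s. s \<ge> 0 \<and> hausdorff_measure s ?Y = 0} = {3<..}" by auto
  then have dim: "hausdorff_dimension ?Y = 3" unfolding hausdorff_dimension_def by simp
  have "?Y - (\<Union>i::nat. wall_chart h \<rho> 1 ` wall_box 1) = {}" by (simp add: wall_set_def)
  then have "hausdorff_measure (real DIM(real^3)) (?Y - (\<Union>i::nat. wall_chart h \<rho> 1 ` wall_box 1)) = 0"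
    by (simp only: hausdorff_measure_empty)
  moreover have "\<forall>i::nat. \<exists>L. L-lipschitz_on (wall_box 1) (wall_chart h \<rho> 1)" using C1 by blast
  moreover have "hausdorff_dimension ?Y = real DIM(real^3)" by (simp add: dim)
  ultimately show ?thesis unfolding rectifiable_set_def
    by (intro conjI exI[of _ "\<lambda>_::nat. wall_box 1"] exI[of _ "\<lambda>_::nat. wall_chart h \<rho> 1"])
qed

lemma wall_set_subset_Xt:
  assumes "\<And>\<zeta>. norm \<zeta> \<le> \<rho> \<Longrightarrow> h \<zeta> ^ 5 + t * h \<zeta> = - (\<zeta> + \<zeta>^15)" "0 < \<rho>"
  shows "wall_set h \<rho> \<subseteq> Xt t"
proof
  fix v assume "v \<in> wall_set h \<rho>"
  then obtain r \<alpha> \<phi> where "v = wall h \<rho> r \<alpha> \<phi>" by (rule wall_setE)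
  then show "v \<in> Xt t" unfolding wall_def
    using assms by (simp only:) (rule sheet_in_Xt, simp add: norm_mult)
qed

lemma wall_set_norms:
  assumes "v \<in> wall_set h \<rho>" and a: "\<And>\<zeta>. norm \<zeta> \<le> \<rho> \<Longrightarrow> norm (h \<zeta>) \<le> a" and \<rho>: "0 < \<rho>"
  shows "norm (v$3) ^ 2 = \<rho>^2 * norm (v$2)" "norm (v$1) ^ 2 \<le> a^2 * norm (v$2) ^ 3"
proof -
  obtain r \<alpha> \<phi> where v: "v = wall h \<rho> r \<alpha> \<phi>" "0 \<le> r" using assms(1) by (auto elim: wall_setE)
  have n2: "norm (v$2) = r^2" unfolding v(1) wall_nth using v(2) by (simp add: norm_mult norm_power)
  have "norm (v$3) = r * \<rho>" unfolding v(1) wall_nth using v(2) \<rho> by (simp add: norm_mult)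
  then show "norm (v$3) ^ 2 = \<rho>^2 * norm (v$2)" unfolding n2 by (simp add: power_mult_distrib)
  have "norm (h (of_real \<rho> * cis (\<alpha> - \<phi>))) \<le> a" using \<rho> by (intro a) (simp add: norm_mult)
  then have "norm (v$1) \<le> r^3 * a" unfolding v(1) wall_nth using v(2)
    by (simp add: norm_mult norm_power mult_left_mono)
  then have "norm (v$1) ^ 2 \<le> (r^3 * a)^2" by (intro power_mono) auto
  then show "norm (v$1) ^ 2 \<le> a^2 * norm (v$2) ^ 3" unfolding n2
    by (simp add: power_mult_distrib mult.commute flip: power_mult)
qed

text \<open>The arguments of \<open>s\<close> and of \<open>v$3\<close> serve as the angles
  \<open>\<phi>\<close> and \<open>\<alpha>\<close> of the wall.\<close>

lemma in_wall_setI: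
  assumes v2: "v$2 = s^2" "s \<noteq> 0" "norm (v$2) \<le> 1" and v13: "v$1 = s^3 * h \<zeta>" "v$3 = s * \<zeta>" and \<zeta>: "norm \<zeta> = \<rho>" and \<rho>: "0 < \<rho>"
  shows "v \<in> wall_set h \<rho>"
proof -
  define r where "r = norm s"
  have "r^2 \<le> 1^2" using v2 by (simp add: r_def norm_power)
  then have r: "0 \<le> r" "r \<le> 1" by (auto simp: r_def power2_le_imp_le intro: power2_le_imp_le)
  define \<phi> \<alpha> where "\<phi> = Arg2pi s" and "\<alpha> = Arg2pi (v$3)"
  have s: "of_real r * cis \<phi> = s" by (simp add: r_def \<phi>_def cis_Arg2pi)
  have n3: "norm (v$3) = r * \<rho>" unfolding v13(2) using \<zeta> by (simp add: norm_mult r_def)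
  have "s * (of_real \<rho> * cis (\<alpha> - \<phi>)) = of_real (r * \<rho>) * cis \<alpha>"
    using wall_nth(3)[of h \<rho> r \<alpha> \<phi>] unfolding wall_def by (simp add: s)
  also have "\<dots> = v$3" using cis_Arg2pi[of "v$3"] unfolding n3 \<alpha>_def .
  finally have z: "of_real \<rho> * cis (\<alpha> - \<phi>) = \<zeta>" unfolding v13(2) using v2(2) by simp
  have "v = wall h \<rho> r \<alpha> \<phi>" unfolding wall_def s z
    using v2(1) v13 by (simp add: vec_eq_iff forall_3)
  moreover have "wall h \<rho> r \<alpha> \<phi> \<in> wall_set h \<rho>" unfolding wall_set_def
    by (rule wall_in_chart)
      (use r in \<open>auto simp: \<phi>_def \<alpha>_def Arg2pi_ge_0 intro: less_imp_le[OF Arg2pi_lt_2pi]\<close>)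
  ultimately show ?thesis by simp
qed

text \<open>Within the unit ball, the boundary of the region \<open>|z|^2 < \<rho>^2 |y|\<close>,
  \<open>|x|^2 < a^2 |y|^3\<close> meets the surface only in \<open>Y\<close>: the branch
  \<open>h0\<close> excludes \<open>|h| = a\<close>, and \<open>|\<zeta>| = \<rho>\<close> is the
  wall. One component lies inside and contains a piece of the sheet of \<open>h0\<close>; another
  lies outside and contains a piece of the sheet of a nonzero root.\<close>

lemma has_separating_set_Xt:
  assumes t: "t \<noteq> 0"
  shows "has_separating_set TYPE(real^3) 4 (Xt t) 0"
proof -
  \<comment> \<open>A fourth root of \<open>- t\<close>, hence a nonzero root of
    \<open>h^5 + t * h\<close>; it is simple because
    \<open>5 * \<tau>^4 + t = - 4 * t\<close>.\<close>
  define \<tau> where "\<tau> = csqrt (csqrt (- t))"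
  have "\<tau>^4 = (\<tau>^2)^2" by (simp flip: power_mult)
  then have \<tau>4: "\<tau>^4 = - t" by (simp add: \<tau>_def)
  have \<tau>0: "\<tau> \<noteq> 0" using t by (simp add: \<tau>_def)
  have "\<tau>^5 + t * \<tau> = (\<tau>^4 + t) * \<tau>" by (simp add: eval_nat_numeral algebra_simps)
  then have r1: "\<tau>^5 + t * \<tau> = 0" by (simp add: \<tau>4)
  have s1: "5 * \<tau>^4 + t \<noteq> 0" unfolding \<tau>4 using t by simp
  define good where "good \<tau> a \<rho> h L \<longleftrightarrow> L-lipschitz_on (cball 0 \<rho>) h \<and>
        (\<forall>\<zeta>. norm \<zeta> \<le> \<rho> \<longrightarrow> norm (h \<zeta> - \<tau>) < a \<and> h \<zeta> ^ 5 + t * h \<zeta> = - (\<zeta> + \<zeta>^15) \<and>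
          (\<forall>h'. norm (h' - \<tau>) \<le> a \<and> h' ^ 5 + t * h' = - (\<zeta> + \<zeta>^15) \<longrightarrow> h' = h \<zeta>))" for \<tau> a \<rho> h L
  have branch: "\<exists>a0>0. \<forall>a. 0 < a \<and> a \<le> a0 \<longrightarrow> (\<exists>\<rho>0>0. \<forall>\<rho>. 0 < \<rho> \<and> \<rho> \<le> \<rho>0 \<longrightarrow> (\<exists>h L. good \<tau> a \<rho> h L))"
    if root: "\<tau>^5 + t * \<tau> = 0" "5 * \<tau>^4 + t \<noteq> 0" for \<tau>
    by (rule quintic_branch[OF root]) (unfold good_def, blast)
  obtain a0 where a0: "0 < a0" "\<And>a. 0 < a \<Longrightarrow> a \<le> a0 \<Longrightarrow> \<exists>\<rho>0>0. \<forall>\<rho>. 0 < \<rho> \<and> \<rho> \<le> \<rho>0 \<longrightarrow> (\<exists>h L. good 0 a \<rho> h L)"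
    using branch[of 0] t by auto
  obtain a1 where a1: "0 < a1" "\<And>a. 0 < a \<Longrightarrow> a \<le> a1 \<Longrightarrow> \<exists>\<rho>0>0. \<forall>\<rho>. 0 < \<rho> \<and> \<rho> \<le> \<rho>0 \<longrightarrow> (\<exists>h L. good \<tau> a \<rho> h L)"
    using branch[OF r1 s1] by auto
  \<comment> \<open>With \<open>3 * a \<le> norm \<tau>\<close> the values of the second branch have
    modulus above \<open>2 * a\<close> and stay clear of the disc of the first.\<close>
  define a where "a = min (min a0 a1) (norm \<tau> / 3)"
  have a: "0 < a" "a \<le> a0" "a \<le> a1" "3 * a \<le> norm \<tau>" using a0 a1 \<tau>0 by (auto simp: a_def)
  obtain \<rho>0 where \<rho>0: "0 < \<rho>0" "\<And>\<rho>. 0 < \<rho> \<Longrightarrow> \<rho> \<le> \<rho>0 \<Longrightarrow> \<exists>h L. good 0 a \<rho> h L" using a0(2)[OF a(1,2)] by auto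
  obtain \<rho>1 where \<rho>1: "0 < \<rho>1" "\<And>\<rho>. 0 < \<rho> \<Longrightarrow> \<rho> \<le> \<rho>1 \<Longrightarrow> \<exists>h L. good \<tau> a \<rho> h L" using a1(2)[OF a(1,3)] by auto
  define \<rho> where "\<rho> = min \<rho>0 \<rho>1"
  have \<rho>: "0 < \<rho>" "\<rho> \<le> \<rho>0" "\<rho> \<le> \<rho>1" using \<rho>0 \<rho>1 by (auto simp: \<rho>_def)
  obtain h0 L0 where "good 0 a \<rho> h0 L0" using \<rho>0(2)[OF \<rho>(1,2)] by blast
  then have h0: "L0-lipschitz_on (cball 0 \<rho>) h0" "\<And>\<zeta>. norm \<zeta> \<le> \<rho> \<Longrightarrow> norm (h0 \<zeta>) < a"
    "\<And>\<zeta>. norm \<zeta> \<le> \<rho> \<Longrightarrow> h0 \<zeta> ^ 5 + t * h0 \<zeta> = - (\<zeta> + \<zeta>^15)"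
    "\<And>\<zeta> h'. norm \<zeta> \<le> \<rho> \<Longrightarrow> norm h' \<le> a \<Longrightarrow> h' ^ 5 + t * h' = - (\<zeta> + \<zeta>^15) \<Longrightarrow> h' = h0 \<zeta>"
    unfolding good_def by auto
  obtain h1 L1 where "good \<tau> a \<rho> h1 L1" using \<rho>1(2)[OF \<rho>(1,3)] by blast
  then have h1: "L1-lipschitz_on (cball 0 \<rho>) h1" "\<And>\<zeta>. norm \<zeta> \<le> \<rho> \<Longrightarrow> norm (h1 \<zeta> - \<tau>) < a"
    "\<And>\<zeta>. norm \<zeta> \<le> \<rho> \<Longrightarrow> h1 \<zeta> ^ 5 + t * h1 \<zeta> = - (\<zeta> + \<zeta>^15)"
    unfolding good_def by auto
  have h1n: "a < norm (h1 \<zeta>)" "norm (h1 \<zeta>) \<le> norm \<tau> + a" if "norm \<zeta> \<le> \<rho>" for \<zeta>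
    using h1(2)[OF that] norm_triangle_ineq2[of \<tau> "h1 \<zeta>"] norm_triangle_ineq2[of "h1 \<zeta>" \<tau>] a(1,4)
    by (auto simp: norm_minus_commute)
  define Y where "Y = wall_set h0 \<rho>"
  have h0a: "norm (h0 \<zeta>) \<le> a" if "norm \<zeta> \<le> \<rho>" for \<zeta> using h0(2)[OF that] by simp
  define H where "H = norm \<tau> + a"
  have H: "0 \<le> H" "\<And>\<zeta>. norm \<zeta> < \<rho> \<Longrightarrow> norm (h0 \<zeta>) \<le> H" "\<And>\<zeta>. norm \<zeta> < \<rho> \<Longrightarrow> norm (h1 \<zeta>) \<le> H"
  proof -
    show "0 \<le> H" using a by (simp add: H_def)
    fix \<zeta> :: complex assume z: "norm \<zeta> < \<rho>"
    show "norm (h0 \<zeta>) \<le> H" using h0a[of \<zeta>] z by (simp add: H_def add_increasing)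
    show "norm (h1 \<zeta>) \<le> H" using h1n(2)[of \<zeta>] z by (simp add: H_def)
  qed
  \<comment> \<open>Makes the bound \<open>(H + 1) * \<kappa> + \<kappa> * \<rho>\<close> for the
    norm on both sheets equal to 1, the radius of the ball to be separated.\<close>
  define \<kappa> where "\<kappa> = 1 / (H + 1 + \<rho>)"
  have \<kappa>: "0 < \<kappa>" "\<kappa> \<le> 1" using H(1) \<rho>(1) by (auto simp: \<kappa>_def)
  \<comment> \<open>Removing \<open>s = 0\<close> keeps \<open>y\<close> nonzero; a punctured disc
    in the plane is still connected.\<close>
  define D where "D = (ball (0::complex) \<kappa> - {0}) \<times> ball (0::complex) \<rho>"
  have cD: "connected D" unfolding D_def
    by (intro connected_Times connected_punctured_ball connected_ball) simp
  define S where "S = (cball 0 1 \<inter> Xt t) - Y"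
  \<comment> \<open>\<open>O2\<close> is the complement of the region with non-strict inequalities.
    So \<open>O1\<close> and \<open>O2\<close> are open and disjoint, and only the boundary remains
    to be examined on the surface.\<close>
  define O1 where "O1 = {v :: complex^3. norm (v$3) ^ 2 < \<rho>^2 * norm (v$2)} \<inter> {v. norm (v$1) ^ 2 < a^2 * norm (v$2) ^ 3}"
  define O2 where "O2 = - ({v :: complex^3. norm (v$3) ^ 2 \<le> \<rho>^2 * norm (v$2)} \<inter> {v. norm (v$1) ^ 2 \<le> a^2 * norm (v$2) ^ 3})"
  have op: "open O1" "open O2" unfolding O1_def O2_def
    by (intro open_Int open_Compl closed_Int open_Collect_less closed_Collect_le continuous_intros)+
  have sheetD: "sheet h w \<in> cball 0 1 \<inter> Xt t" "norm (sheet h w $ 3) ^ 2 < \<rho>^2 * norm (sheet h w $ 2)"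
    "norm (sheet h w $ 1) ^ 2 = norm (h (snd w)) ^ 2 * norm (sheet h w $ 2) ^ 3" "0 < norm (sheet h w $ 2) ^ 3"
    if w: "w \<in> D" and hH: "\<And>\<zeta>. norm \<zeta> < \<rho> \<Longrightarrow> norm (h \<zeta>) \<le> H"
      and eq: "\<And>\<zeta>. norm \<zeta> \<le> \<rho> \<Longrightarrow> h \<zeta> ^ 5 + t * h \<zeta> = - (\<zeta> + \<zeta>^15)" for h w
  proof -
    have w': "fst w \<noteq> 0" "norm (fst w) \<le> \<kappa>" "norm (snd w) < \<rho>" using w by (auto simp: D_def)
    have "norm (sheet h w) \<le> (H + 1) * norm (fst w ^ 2) + norm (fst w * snd w)"
      using w' \<kappa> hH by (intro norm_sheet_le) auto
    also have "\<dots> \<le> (H + 1) * \<kappa> + \<kappa> * \<rho>"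
    proof (intro add_mono mult_left_mono)
      have "norm (fst w ^ 2) = norm (fst w) ^ 2" by (simp add: norm_power)
      also have "\<dots> \<le> norm (fst w) ^ 1" using w' \<kappa> by (intro power_decreasing) auto
      finally show "norm (fst w ^ 2) \<le> \<kappa>" using w' by simp
      show "norm (fst w * snd w) \<le> \<kappa> * \<rho>" using w' \<kappa> by (simp add: norm_mult mult_mono)
    qed (use H in simp)
    also have "\<dots> = (H + 1 + \<rho>) * \<kappa>" by (simp add: algebra_simps)
    also have "\<dots> = 1"
    proof -
      have "H + 1 + \<rho> \<noteq> 0" using H(1) \<rho>(1) by linarith
      then show ?thesis by (simp add: \<kappa>_def)
    qed
    finally have "norm (sheet h w) \<le> 1" .
    then show "sheet h w \<in> cball 0 1 \<inter> Xt t" using sheet_in_Xt[of h w t] eq w'(3) by simp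
    have "norm (snd w) ^ 2 < \<rho>^2" using w'(3) by (intro power_strict_mono) auto
    then show "norm (sheet h w $ 3) ^ 2 < \<rho>^2 * norm (sheet h w $ 2)"
      using w'(1) by (simp add: norm_mult norm_power power_mult_distrib mult.commute)
    show "norm (sheet h w $ 1) ^ 2 = norm (h (snd w)) ^ 2 * norm (sheet h w $ 2) ^ 3"
      by (simp add: norm_mult norm_power power_mult_distrib mult.commute flip: power_mult)
    show "0 < norm (sheet h w $ 2) ^ 3" using w'(1) by simp
  qed
  have S0: "sheet h0 ` D \<subseteq> S \<inter> O1"
  proof
    fix v assume "v \<in> sheet h0 ` D"
    then obtain w where w: "w \<in> D" "v = sheet h0 w" by blast
    have sd: "v \<in> cball 0 1 \<inter> Xt t" "norm (v$3) ^ 2 < \<rho>^2 * norm (v$2)"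
      "norm (v$1) ^ 2 = norm (h0 (snd w)) ^ 2 * norm (v$2) ^ 3" "0 < norm (v$2) ^ 3"
      unfolding w(2) by (rule sheetD[OF w(1)], erule H(2), erule h0(3))+
    have "v \<notin> Y" using wall_set_norms(1)[OF _ h0a \<rho>(1), of v] sd(2) unfolding Y_def by auto
    moreover have "norm (h0 (snd w)) ^ 2 < a ^ 2"
      using h0(2)[of "snd w"] w(1) by (intro power_strict_mono) (auto simp: D_def)
    then have "norm (v$1) ^ 2 < a^2 * norm (v$2) ^ 3" unfolding sd(3) using sd(4) by (intro mult_strict_right_mono)
    ultimately show "v \<in> S \<inter> O1" using sd by (simp add: S_def O1_def)
  qed
  have S1: "sheet h1 ` D \<subseteq> S \<inter> O2"
  proof
    fix v assume "v \<in> sheet h1 ` D"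
    then obtain w where w: "w \<in> D" "v = sheet h1 w" by blast
    have sd: "v \<in> cball 0 1 \<inter> Xt t" "norm (v$3) ^ 2 < \<rho>^2 * norm (v$2)"
      "norm (v$1) ^ 2 = norm (h1 (snd w)) ^ 2 * norm (v$2) ^ 3" "0 < norm (v$2) ^ 3"
      unfolding w(2) by (rule sheetD[OF w(1)], erule H(3), erule h1(3))+
    have "a ^ 2 < norm (h1 (snd w)) ^ 2"
      using h1n(1)[of "snd w"] w(1) a(1) by (intro power_strict_mono) (auto simp: D_def)
    then have gt: "a^2 * norm (v$2) ^ 3 < norm (v$1) ^ 2" unfolding sd(3) using sd(4) by (intro mult_strict_right_mono)
    then have "v \<notin> Y" using wall_set_norms(2)[OF _ h0a \<rho>(1), of v] unfolding Y_def by auto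
    then show "v \<in> S \<inter> O2" using sd gt by (simp add: S_def O2_def)
  qed
  have zeroY: "0 \<in> Y"
  proof -
    have "wall h0 \<rho> 0 0 0 = 0" by (simp add: vec_eq_iff forall_3 wall_nth)
    moreover have "wall h0 \<rho> 0 0 0 \<in> Y" unfolding Y_def wall_set_def by (rule wall_in_chart) auto
    ultimately show ?thesis by simp
  qed
  have cover: "S \<subseteq> O1 \<union> O2"
  proof
    fix v assume v: "v \<in> S"
    show "v \<in> O1 \<union> O2"
    proof (cases "v \<in> O2")
      case False
      then have le: "norm (v$3) ^ 2 \<le> \<rho>^2 * norm (v$2)" "norm (v$1) ^ 2 \<le> a^2 * norm (v$2) ^ 3" by (auto simp: O2_def)
      have vX: "v \<in> Xt t" "norm v \<le> 1" "v \<notin> Y" using v by (auto simp: S_def)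
      \<comment> \<open>At \<open>y = 0\<close> the two inequalities leave only the origin, which
        belongs to \<open>Y\<close>.\<close>
      have v2: "v$2 \<noteq> 0"
      proof
        assume "v$2 = 0"
        then have "v = 0" using le by (simp add: vec_eq_iff forall_3)
        then show False using vX(3) zeroY by simp
      qed
      define s where "s = csqrt (v$2)"
      have s: "s^2 = v$2" by (simp add: s_def)
      note sc = Xt_sheet_coordinates[OF vX(1) v2 s]
      let ?h = "v$1 / s^3" and ?z = "v$3 / s"
      have p: "0 < norm (v$2)" "0 < norm (v$2) ^ 3" using v2 by auto
      have "norm ?z ^ 2 \<le> \<rho>^2" using le(1) p(1) unfolding sc(7) by simp
      then have z: "norm ?z \<le> \<rho>" by (rule power2_le_imp_le) (use \<rho> in simp)
      have "norm ?h ^ 2 \<le> a^2" using le(2) p(2) unfolding sc(6) by simp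
      then have "norm ?h \<le> a" by (rule power2_le_imp_le) (use a in simp)
      \<comment> \<open>Uniqueness in the closed disc identifies the point as one of the sheet of
        \<open>h0\<close>, and the strict bound on \<open>h0\<close> then improves the inequality
        for \<open>x\<close> to a strict one.\<close>
      then have hh: "?h = h0 ?z" using h0(4)[OF z _ sc(4)] by blast
      then have "norm ?h < a" using h0(2)[OF z] by simp
      then have "norm ?h ^ 2 < a^2" by (intro power_strict_mono) auto
      then have lt1: "norm (v$1) ^ 2 < a^2 * norm (v$2) ^ 3" unfolding sc(6) using p(2) by (intro mult_strict_right_mono)
      have "norm ?z \<noteq> \<rho>"
      proof
        assume "norm ?z = \<rho>"
        moreover have "norm (v$2) \<le> 1" using vX(2) Finite_Cartesian_Product.norm_nth_le[of v 2] by linarith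
        moreover have "v$1 = s^3 * h0 ?z" using sc(2) hh by (simp only:)
        ultimately have "v \<in> Y" unfolding Y_def using s sc(1,3) \<rho>(1) by (intro in_wall_setI[of v s h0 ?z]) auto
        then show False using vX(3) by simp
      qed
      then have "norm ?z < \<rho>" using z by simp
      then have "norm ?z ^ 2 < \<rho>^2" by (intro power_strict_mono) auto
      then have "norm (v$3) ^ 2 < \<rho>^2 * norm (v$2)" unfolding sc(7) using p(1) by (intro mult_strict_right_mono)
      then show ?thesis using lt1 by (simp add: O1_def)
    qed simp
  qed
  have connS: "connected (sheet h ` D)" if "L-lipschitz_on (cball 0 \<rho>) h" for h L
  proof (rule connected_continuous_image[OF _ cD])
    have "continuous_on (cball 0 \<rho>) h" using that by (rule lipschitz_on_continuous_on)
    then have "continuous_on D (\<lambda>w. h (snd w))"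
      by (rule continuous_on_compose2) (auto simp: D_def intro: continuous_intros)
    then show "continuous_on D (sheet h)" unfolding sheet_def
      by (intro continuous_on_vector3 continuous_intros)
  qed
  have D0: "(of_real (\<kappa> / 2), 0) \<in> D" using \<kappa> \<rho> by (simp add: D_def)
  have S_ne: "S \<noteq> {}" using S0 D0 by auto
  obtain A where A: "A \<in> components S" "sheet h0 ` D \<subseteq> A"
    using exists_component_superset[OF _ S_ne connS[OF h0(1)]] S0 by auto
  obtain B where B: "B \<in> components S" "sheet h1 ` D \<subseteq> B"
    using exists_component_superset[OF _ S_ne connS[OF h1(1)]] S1 by auto
  have "A \<noteq> B"
  proof
    assume "A = B"
    have "connected A" using A(1) by (rule in_components_connected)
    moreover have "A \<subseteq> O1 \<union> O2" using in_components_subset[OF A(1)] cover by blast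
    moreover have "O1 \<inter> O2 \<inter> A = {}" by (auto simp: O1_def O2_def)
    ultimately have "O1 \<inter> A = {} \<or> O2 \<inter> A = {}" using op by (intro connectedD)
    moreover have "sheet h0 (of_real (\<kappa> / 2), 0) \<in> O1 \<inter> A" using S0 A(2) D0 by blast
    moreover have "sheet h1 (of_real (\<kappa> / 2), 0) \<in> O2 \<inter> A" using S1 B(2) D0 \<open>A = B\<close> by blast
    ultimately show False by blast
  qed
  have ldA: "0 < lower_density 4 A 0"
    by (rule sheet_lower_density[OF H(2) H(1) \<rho>(1) \<kappa>]) (use A(2) in \<open>simp_all add: D_def\<close>)
  have ldB: "0 < lower_density 4 B 0"
    by (rule sheet_lower_density[OF H(3) H(1) \<rho>(1) \<kappa>]) (use B(2) in \<open>simp_all add: D_def\<close>)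
  have ldX: "0 < lower_density 4 (Xt t) 0"
    by (rule sheet_lower_density[OF H(2) H(1) \<rho>(1) \<kappa>]) (use S0 in \<open>auto simp: D_def S_def\<close>)
  have "separating_set TYPE(real^3) 4 (Xt t) 0 Y"
    unfolding separating_set_def
  proof (intro conjI)
    show "(0::complex^3) \<in> Xt t" by (simp add: Xt_def)
    show "rectifiable_set TYPE(real^3) Y" unfolding Y_def by (rule rectifiable_wall_set[OF h0(1) h0a \<rho>(1)])
    show "Y \<subseteq> Xt t" unfolding Y_def by (rule wall_set_subset_Xt[OF h0(3) \<rho>(1)])
    have ud: "upper_density (real 4 - 1) Y 0 = 0"
      using wall_set_upper_density[OF h0(1) h0a \<rho>(1)] by (simp add: Y_def)
    show "\<exists>\<epsilon>>0. \<exists>A B. A \<in> components (cball 0 \<epsilon> \<inter> Xt t - Y) \<and> B \<in> components (cball 0 \<epsilon> \<inter> Xt t - Y) \<and> A \<noteq> B \<and>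
        upper_density (real 4 - 1) Y 0 = 0 \<and> 0 < lower_density (real 4) A 0 \<and> 0 < lower_density (real 4) B 0"
      using A(1) B(1) \<open>A \<noteq> B\<close> ud ldA ldB unfolding S_def
      by (intro exI[of _ 1] conjI exI[of _ A] exI[of _ B]) auto
  qed (use connected_link_Xt[OF t] ldX zeroY in auto)
  then show ?thesis unfolding has_separating_set_def by blast
qed

theorem theorem4p1:
  shows "(\<forall>t. t \<noteq> 0 \<longrightarrow> has_separating_set TYPE(real^3) 4 (Xt t) 0)
         \<and> \<not> has_separating_set TYPE(real^3) 4 (Xt 0) 0"
  using has_separating_set_Xt no_separating_set_X0 by blast

end
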